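(* Let $n\ge2$, $k\ge1$, let $Z=\{P_1,\dots,P_r\}\subset\mathbb{P}^n$ be a finite set of distinct points, let $\mathcal{H}\subset\mathbb{P}^n$ be a general linear subspace of codimension two with general basis $\alpha=\{\alpha_1,\dots,\alpha_{n-1}\}$, and let $\mathcal{L}=\check{\mathcal{H}}\subset\check{\mathbb{P}}^n$ be the dual line. The map $$\eta:\ \theta=\sum_{j=0}^{N} f_{\beta_j}(Y)\,\partial_{\beta_j}\ \longmapsto\ e_\alpha(F)=\sum_{j=0}^{N} f_{\beta_j}\bigl(e_\alpha(M)\bigr)\,X^{\beta_j},$$ defined on $D^k(\mathcal{A}_Z)|_{\mathcal{L}}$ with values in $I(Z,\mathcal{H})$, is a morphism of graded $\mathcal{P}$-modules (carrying elements with coefficients of degree $d$ to the component of degree $d+k$). Its kernel is $$\bigoplus_{t=1}^{\binom{n+k-1}{n}} \bigl(\check S/I(\mathcal{L})\bigr)\,\theta_{E_{\gamma_t}},$$ where $\gamma_t$ runs over all multi-indices in $\mathbb{N}^{n+1}$ with $|\gamma_t|=k-1$, and there is an isomorphism $$D_0^k(\mathcal{A}_Z)|_{\mathcal{L}}\ \cong\ I(Z,\mathcal{H})(-k),$$ where the twist is normalized so that the degree-$d$ component of $I(Z,\mathcal{H})(-k)$ is $[I(Z)\cap I(\mathcal{H})^d]_{d+k}$.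
   Context: Work over $\mathbb{C}$. $\mathbb{P}^n$ has coordinates $X=(X_0:\dots:X_n)$; the dual space $\check{\mathbb{P}}^n$ has coordinates $Y=(Y_0:\dots:Y_n)$ and coordinate ring $\check S=\mathbb{C}[Y]=\mathbb{C}[Y_0,\dots,Y_n]$. For $P=(p_0:\dots:p_n)\in\mathbb{P}^n$, $\check P$ denotes both the linear form $p_0Y_0+\dots+p_nY_n$ and the hyperplane it defines. $\mathcal{A}_Z=\{\check P_1,\dots,\check P_r\}$, $f=\prod_i\check P_i$, and $J=\langle \partial f/\partial Y_0,\dots,\partial f/\partial Y_n\rangle$. The line $\mathcal{L}=\check{\mathcal{H}}$ consists of all points of $\check{\mathbb{P}}^n$ whose corresponding hyperplane in $\mathbb{P}^n$ contains $\mathcal{H}$. $N=\binom{n+k}{n}-1$ and $\beta_0,\dots,\beta_N$ are the multi-indices in $\mathbb{N}^{n+1}$ with $|\beta_j|=k$; $X^{\beta}=\prod_iX_i^{\beta^{(i)}}$ for $\beta=(\beta^{(0)},\dots,\beta^{(n)})$. $k$-derivations: $\mathrm{Der}^k(\check S)$ is the free $\check S$-module on symbols $\partial_{\beta_j}$, where $\partial_\beta$ is a product of first-order partial derivatives acting multiplicatively: $\partial_\beta(g)=\prod_i(\partial g/\partial Y_i)^{\beta^{(i)}}$, and $\theta(g)=\sum_j f_{\beta_j}\partial_{\beta_j}(g)$ for $\theta=\sum_jf_{\beta_j}\partial_{\beta_j}$ (in particular $\partial_\beta(\check P)=P^\beta$). It is graded by the degree $d$ of the coefficients. Define $$D^k(\mathcal{A}_Z)=\{\theta\in\mathrm{Der}^k(\check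 S)\mid\theta(f)\in J^{k-1}f\}.$$ $D^k(\mathcal{A}_Z)|_{\mathcal{L}}$ is the graded $\check S/I(\mathcal{L})$-module whose degree-$d$ part ($d\ge0$) is $H^0\bigl(\mathcal{L},\widetilde{D^k(\mathcal{A}_Z)}|_{\mathcal{L}}\otimes\mathcal{O}_{\mathcal{L}}(d)\bigr)$, viewed inside the free module on the $\partial_{\beta_j}$ over $\check S/I(\mathcal{L})$. Euler $k$-derivations: for $\gamma\in\mathbb{N}^{n+1}$ with $|\gamma|=k-1$, $\theta_{E_\gamma}=\sum_{m=0}^nY_m\,\partial_{\gamma+e_m}$, with $e_m$ the $m$-th standard unit vector. $D_0^k(\mathcal{A}_Z)=D^k(\mathcal{A}_Z)/\bigoplus_{t}\check S\,\theta_{E_{\gamma_t}}$, and $D_0^k(\mathcal{A}_Z)|_{\mathcal{L}}$ is the quotient of $D^k(\mathcal{A}_Z)|_{\mathcal{L}}$ by the submodule generated by the restrictions of the $\theta_{E_{\gamma_t}}$. The map: $\alpha_i=(\alpha_{i0},\dots,\alpha_{in})$, $i=1,\dots,n-1$, are linearly independent vectors spanning $\mathcal{H}$. For $i=0,\dots,n$, $e_\alpha(M_i)\in\mathbb{C}[X]$ is the determinant of the $(n+1)\times(n+1)$ matrix whose rows are, in order, the $i$-th standard unit vector $(0,\dots,1,\dots,0)$, the vector $(X_0,\dots,X_n)$, and $\alpha_1,\dots,\alpha_{n-1}$; $e_\alpha(M)=(e_\alpha(M_0):\dots:e_\alpha(M_n))$. (The polynomials of $I(\mathcal{L})$ vanish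 at $e_\alpha(M)$, so $\eta$ is defined for coefficients in $\check S/I(\mathcal{L})$.) The modules: $\mathcal{P}$ is the symmetric algebra over $\mathbb{C}$ of the two-dimensional space of linear forms in $X$ vanishing on $\mathcal{H}$ (the polynomial ring $\mathbb{C}[X_0,X_1]$ in coordinates where $\mathcal{H}=\{X_0=X_1=0\}$), a subring of $\mathbb{C}[X]$. It is identified with $\check S/I(\mathcal{L})$ by the graded isomorphism $Y_i\mapsto e_\alpha(M_i)$, which makes $D^k(\mathcal{A}_Z)|_{\mathcal{L}}$ a $\mathcal{P}$-module. $I(Z,\mathcal{H})\subset\mathbb{C}[X]$ is the graded $\mathcal{P}$-module whose component of degree $d+k$ ($d\ge0$) is $[I(Z)\cap I(\mathcal{H})^d]_{d+k}$. *)

theory Defs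
  imports
    Complex_Main
    "HOL-Library.Poly_Mapping"
    "HOL-Algebra.Ideal_Product"
    "HOL-Algebra.QuotRing"
    "HOL-Algebra.Generated_Rings"
    "Jordan_Normal_Form.VS_Connect"
begin

section \<open>Polynomials and projective sets\<close>

type_synonym 'v cpoly = "('v \<Rightarrow>\<^sub>0 nat) \<Rightarrow>\<^sub>0 complex"

type_synonym mindex = "nat \<Rightarrow>\<^sub>0 nat"

definition tdeg :: "mindex \<Rightarrow> nat" where
  "tdeg m = (\<Sum>i\<in>Poly_Mapping.keys m. Poly_Mapping.lookup m i)"

definition const :: "complex \<Rightarrow> 'v cpoly" where
  "const c = Poly_Mapping.single 0 c"

definition var :: "'v \<Rightarrow> 'v cpoly" where
  "var i = Poly_Mapping.single (Poly_Mapping.single i 1) 1"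

definition peval :: "(complex \<Rightarrow> 'a::comm_ring_1) \<Rightarrow> ('v \<Rightarrow> 'a) \<Rightarrow> 'v cpoly \<Rightarrow> 'a" where
  "peval h x p = (\<Sum>m\<in>Poly_Mapping.keys p. h (Poly_Mapping.lookup p m) * (\<Prod>i\<in>Poly_Mapping.keys m. x i ^ Poly_Mapping.lookup m i))"

definition ev :: "complex vec \<Rightarrow> nat cpoly \<Rightarrow> complex" where
  "ev v p = peval id (\<lambda>i. v $ i) p"

definition pdiff :: "nat \<Rightarrow> nat cpoly \<Rightarrow> nat cpoly" where
  "pdiff i p = (\<Sum>m\<in>Poly_Mapping.keys p.
     Poly_Mapping.single (m - Poly_Mapping.single i 1) (of_nat (Poly_Mapping.lookup m i) * Poly_Mapping.lookup p m))"

definition homog :: "nat \<Rightarrow> nat cpoly \<Rightarrow> bool" where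
  "homog d p \<longleftrightarrow> (\<forall>m\<in>Poly_Mapping.keys p. tdeg m = d)"

definition hpart :: "nat \<Rightarrow> nat cpoly \<Rightarrow> nat cpoly" where
  "hpart d p = (\<Sum>m\<in>{m\<in>Poly_Mapping.keys p. tdeg m = d}. Poly_Mapping.single m (Poly_Mapping.lookup p m))"

definition multi :: "nat \<Rightarrow> nat \<Rightarrow> mindex set" where
  "multi n k = {\<beta>. Poly_Mapping.keys \<beta> \<subseteq> {..n} \<and> tdeg \<beta> = k}"

text \<open>The ring \<open>C[Y\<^sub>0, \<dots>, Y\<^sub>n]\<close>; the same ring serves as \<open>C[X\<^sub>0, \<dots>, X\<^sub>n]\<close>.\<close>

definition Sring :: "nat \<Rightarrow> nat cpoly ring" where
  "Sring n = \<lparr>carrier = {p. \<forall>m\<in>Poly_Mapping.keys p. Poly_Mapping.keys m \<subseteq> {..n}}, mult = (*), one = 1, zero = 0, add = (+)\<rparr>"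

text \<open>A subset of \<open>P\<^sup>n\<close> is represented by the set of all its homogeneous coordinate vectors, i.e. by
  a set of nonzero vectors closed under nonzero scaling. A polynomial vanishes on such a set iff all
  its homogeneous components do, so \<open>vanish\<close> is the homogeneous vanishing ideal.\<close>

definition points :: "nat \<Rightarrow> complex vec set" where
  "points n = carrier_vec (Suc n) - {0\<^sub>v (Suc n)}"

definition all_coords :: "complex vec set \<Rightarrow> complex vec set" where
  "all_coords Z = {c \<cdot>\<^sub>v p | c p. c \<noteq> 0 \<and> p \<in> Z}"

definition vanish :: "nat \<Rightarrow> complex vec set \<Rightarrow> nat cpoly set" where
  "vanish n V = {p \<in> carrier (Sring n). \<forall>v\<in>V. ev v p = 0}"

definition dual :: "nat \<Rightarrow> complex vec set \<Rightarrow> complex vec set" where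
  "dual n V = {y \<in> points n. \<forall>x\<in>V. y \<bullet> x = 0}"

text \<open>One coordinate vector is chosen for each point of \<open>Z\<close>.\<close>

definition distinct_points :: "nat \<Rightarrow> complex vec set \<Rightarrow> bool" where
  "distinct_points n Z \<longleftrightarrow> finite Z \<and> Z \<subseteq> points n \<and>
     (\<forall>p\<in>Z. \<forall>q\<in>Z. p \<noteq> q \<longrightarrow> \<not> (\<exists>c. p = c \<cdot>\<^sub>v q))"

definition lin_indep_list :: "nat \<Rightarrow> complex vec list \<Rightarrow> bool" where
  "lin_indep_list n vs \<longleftrightarrow> distinct vs \<and> set vs \<subseteq> carrier_vec (Suc n) \<and>
     \<not> LinearCombinations.module.lin_dep class_ring (module_vec TYPE(complex) (Suc n)) (set vs)"

text \<open>``For general \<open>(\<alpha>\<^sub>1, \<dots>, \<alpha>\<^sub>m)\<close>'': on a nonempty Zariski-open subset of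
  \<open>(C\<^sup>n\<^sup>+\<^sup>1)\<^sup>m\<close>, equivalently off the zero set of some nonzero polynomial in the entries.\<close>

definition for_general_tuple :: "nat \<Rightarrow> nat \<Rightarrow> (complex vec list \<Rightarrow> bool) \<Rightarrow> bool" where
  "for_general_tuple n m Q \<longleftrightarrow> (\<exists>G :: (nat \<times> nat) cpoly. G \<noteq> 0 \<and>
     (\<forall>t\<in>Poly_Mapping.keys G. Poly_Mapping.keys t \<subseteq> {..<m} \<times> {..n}) \<and>
     (\<forall>\<alpha>. length \<alpha> = m \<and> set \<alpha> \<subseteq> carrier_vec (Suc n) \<and>
        peval id (\<lambda>(i, j). \<alpha> ! i $ j) G \<noteq> 0 \<longrightarrow> Q \<alpha>))"


section \<open>Modules\<close>

text \<open>The HOL-Algebra module record also has multiplicative fields, which play no role.\<close>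

definition free_module :: "('a, 'c) ring_scheme \<Rightarrow> 'b set \<Rightarrow> ('a, 'b \<Rightarrow> 'a) module" where
  "free_module R B =
     \<lparr>carrier = B \<rightarrow>\<^sub>E carrier R, mult = undefined, one = undefined,
      zero = (\<lambda>b\<in>B. \<zero>\<^bsub>R\<^esub>), add = (\<lambda>x y. \<lambda>b\<in>B. x b \<oplus>\<^bsub>R\<^esub> y b),
      smult = (\<lambda>r x. \<lambda>b\<in>B. r \<otimes>\<^bsub>R\<^esub> x b)\<rparr>"

definition quot_module :: "('a, 'b) module \<Rightarrow> 'b set \<Rightarrow> ('a, 'b set) module" where
  "quot_module M N =
     \<lparr>carrier = a_rcosets\<^bsub>M\<^esub> N, mult = undefined, one = undefined,
      zero = N, add = set_add M, smult = (\<lambda>r C. \<Union>x\<in>C. N +>\<^bsub>M\<^esub> (r \<odot>\<^bsub>M\<^esub> x))\<rparr>"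

definition quot_grading :: "('a, 'b) module \<Rightarrow> 'b set \<Rightarrow> (nat \<Rightarrow> 'b set) \<Rightarrow> nat \<Rightarrow> 'b set set" where
  "quot_grading M N MC d = (\<lambda>x. N +>\<^bsub>M\<^esub> x) ` MC d"

definition internal_direct_sum :: "('a, 'b) module \<Rightarrow> 'i set \<Rightarrow> ('i \<Rightarrow> 'b set) \<Rightarrow> 'b set \<Rightarrow> bool" where
  "internal_direct_sum M I A N \<longleftrightarrow>
     (\<forall>i\<in>I. subgroup (A i) (add_monoid M)) \<and>
     bij_betw (\<lambda>u. finsum M u {i\<in>I. u i \<noteq> \<zero>\<^bsub>M\<^esub>})
       {u \<in> PiE I A. finite {i\<in>I. u i \<noteq> \<zero>\<^bsub>M\<^esub>}} N"

text \<open>In the following, \<open>RC\<close>, \<open>MC\<close>, \<open>NC\<close> are the families of homogeneous components.\<close>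

definition graded_module ::
    "'a ring \<Rightarrow> (nat \<Rightarrow> 'a set) \<Rightarrow> ('a, 'b) module \<Rightarrow> (nat \<Rightarrow> 'b set) \<Rightarrow> bool" where
  "graded_module R RC M MC \<longleftrightarrow> module R M \<and> internal_direct_sum M UNIV MC (carrier M) \<and>
     (\<forall>i j. \<forall>r\<in>RC i. \<forall>x\<in>MC j. r \<odot>\<^bsub>M\<^esub> x \<in> MC (i + j))"

definition graded_hom ::
    "'a ring \<Rightarrow> (nat \<Rightarrow> 'a set) \<Rightarrow> ('a, 'b) module \<Rightarrow> (nat \<Rightarrow> 'b set) \<Rightarrow>
     ('a, 'c) module \<Rightarrow> (nat \<Rightarrow> 'c set) \<Rightarrow> nat \<Rightarrow> ('b \<Rightarrow> 'c) \<Rightarrow> bool" where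
  "graded_hom R RC M MC N NC k h \<longleftrightarrow>
     graded_module R RC M MC \<and> graded_module R RC N NC \<and>
     h \<in> module_hom R M N \<and> (\<forall>d. h ` MC d \<subseteq> NC (d + k))"

definition graded_isomorphic ::
    "'a ring \<Rightarrow> (nat \<Rightarrow> 'a set) \<Rightarrow> ('a, 'b) module \<Rightarrow> (nat \<Rightarrow> 'b set) \<Rightarrow>
     ('a, 'c) module \<Rightarrow> (nat \<Rightarrow> 'c set) \<Rightarrow> bool" where
  "graded_isomorphic R RC M MC N NC \<longleftrightarrow>
     (\<exists>h. graded_hom R RC M MC N NC 0 h \<and> bij_betw h (carrier M) (carrier N) \<and>
          (\<forall>d. h ` MC d = NC d))"


section \<open>Sections of twisted sheaves of graded modules\<close>

text \<open>For a graded \<open>Sring n\<close>-module \<open>M\<close>, the degree-\<open>d\<close> part of the homogeneous localization of \<open>M\<close> at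
  a point \<open>p\<close> is the stalk at \<open>p\<close> of the sheaf associated with \<open>M(d)\<close>. A pair \<open>(m, g)\<close> stands for
  the fraction \<open>m / g\<close>, and a germ is an equivalence class of fractions.\<close>

definition fractions ::
    "nat \<Rightarrow> (nat \<Rightarrow> 'b set) \<Rightarrow> nat \<Rightarrow> complex vec \<Rightarrow> ('b \<times> nat cpoly) set" where
  "fractions n MC d p =
     {(m, g). \<exists>e. m \<in> MC (d + e) \<and> g \<in> carrier (Sring n) \<and> homog e g \<and> ev p g \<noteq> 0}"

definition germ ::
    "nat \<Rightarrow> (nat cpoly, 'b) module \<Rightarrow> (nat \<Rightarrow> 'b set) \<Rightarrow> nat \<Rightarrow> complex vec \<Rightarrow>
     'b \<Rightarrow> nat cpoly \<Rightarrow> ('b \<times> nat cpoly) set" where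
  "germ n M MC d p m g =
     {(m', g') \<in> fractions n MC d p.
        \<exists>h\<in>carrier (Sring n). (\<exists>e. homog e h) \<and> ev p h \<noteq> 0 \<and>
          h \<odot>\<^bsub>M\<^esub> (g' \<odot>\<^bsub>M\<^esub> m) = h \<odot>\<^bsub>M\<^esub> (g \<odot>\<^bsub>M\<^esub> m')}"

text \<open>Families of germs over \<open>X\<close> which near each point, i.e. on some basic open set
  \<open>{q \<in> X. h(q) \<noteq> 0}\<close> containing it, are given by a single fraction.\<close>

definition sheaf_sections ::
    "nat \<Rightarrow> complex vec set \<Rightarrow> (nat cpoly, 'b) module \<Rightarrow> (nat \<Rightarrow> 'b set) \<Rightarrow> nat \<Rightarrow>
     (complex vec \<Rightarrow> ('b \<times> nat cpoly) set) set" where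
  "sheaf_sections n X M MC d =
     {\<sigma> \<in> extensional X. \<forall>p\<in>X. \<exists>h\<in>carrier (Sring n). \<exists>m g. (\<exists>e. homog e h) \<and> ev p h \<noteq> 0 \<and>
        (\<forall>q\<in>X. ev q h \<noteq> 0 \<longrightarrow>
           (m, g) \<in> fractions n MC d q \<and> \<sigma> q = germ n M MC d q m g)}"


section \<open>Derivations of order k of a hyperplane arrangement\<close>

definition linear_form :: "nat \<Rightarrow> complex vec \<Rightarrow> nat cpoly" where
  "linear_form n p = (\<Sum>i\<le>n. const (p $ i) * var i)"

definition arr_poly :: "nat \<Rightarrow> complex vec set \<Rightarrow> nat cpoly" where
  "arr_poly n Z = (\<Prod>p\<in>Z. linear_form n p)"

definition jacobian_ideal :: "nat \<Rightarrow> nat cpoly \<Rightarrow> nat cpoly set" where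
  "jacobian_ideal n f = Idl\<^bsub>Sring n\<^esub> ((\<lambda>i. pdiff i f) ` {..n})"

text \<open>The power of an ideal is the power in the monoid of ideals; its zeroth power is the ring.\<close>

definition ideal_pow :: "nat \<Rightarrow> nat cpoly set \<Rightarrow> nat \<Rightarrow> nat cpoly set" where
  "ideal_pow n I d = I [^]\<^bsub>ideals_set (Sring n)\<^esub> d"

text \<open>An element \<open>\<theta>\<close> of \<open>Der n k\<close> is the family of its coefficients:
  \<open>\<theta> = \<Sum>\<^sub>\<beta> \<theta>(\<beta>) \<partial>\<^sub>\<beta>\<close>.\<close>

definition Der :: "nat \<Rightarrow> nat \<Rightarrow> (nat cpoly, mindex \<Rightarrow> nat cpoly) module" where
  "Der n k = free_module (Sring n) (multi n k)"

definition Der_comp :: "nat \<Rightarrow> nat \<Rightarrow> nat \<Rightarrow> (mindex \<Rightarrow> nat cpoly) set" where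
  "Der_comp n k d = {\<theta> \<in> carrier (Der n k). \<forall>\<beta>\<in>multi n k. homog d (\<theta> \<beta>)}"

definition apply_der :: "nat \<Rightarrow> nat \<Rightarrow> (mindex \<Rightarrow> nat cpoly) \<Rightarrow> nat cpoly \<Rightarrow> nat cpoly" where
  "apply_der n k \<theta> g = (\<Sum>\<beta>\<in>multi n k. \<theta> \<beta> * (\<Prod>i\<le>n. pdiff i g ^ Poly_Mapping.lookup \<beta> i))"

definition Dk :: "nat \<Rightarrow> nat \<Rightarrow> complex vec set \<Rightarrow> (nat cpoly, mindex \<Rightarrow> nat cpoly) module" where
  "Dk n k Z = (Der n k)\<lparr>carrier := {\<theta> \<in> carrier (Der n k).
     \<exists>a \<in> ideal_pow n (jacobian_ideal n (arr_poly n Z)) (k - 1).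
       apply_der n k \<theta> (arr_poly n Z) = a * arr_poly n Z}\<rparr>"

definition Dk_comp :: "nat \<Rightarrow> nat \<Rightarrow> complex vec set \<Rightarrow> nat \<Rightarrow> (mindex \<Rightarrow> nat cpoly) set" where
  "Dk_comp n k Z d = carrier (Dk n k Z) \<inter> Der_comp n k d"

definition euler_der :: "nat \<Rightarrow> nat \<Rightarrow> mindex \<Rightarrow> mindex \<Rightarrow> nat cpoly" where
  "euler_der n k \<gamma> = (\<lambda>\<beta>\<in>multi n k. \<Sum>m\<le>n. if \<beta> = \<gamma> + Poly_Mapping.single m 1 then var m else 0)"


section \<open>Restriction to the dual line\<close>

definition H_pts :: "nat \<Rightarrow> complex vec list \<Rightarrow> complex vec set" where
  "H_pts n \<alpha> = LinearCombinations.module.span class_ring (module_vec TYPE(complex) (Suc n)) (set \<alpha>)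
       - {0\<^sub>v (Suc n)}"

definition L_pts :: "nat \<Rightarrow> complex vec list \<Rightarrow> complex vec set" where
  "L_pts n \<alpha> = dual n (H_pts n \<alpha>)"

definition IL :: "nat \<Rightarrow> complex vec list \<Rightarrow> nat cpoly set" where
  "IL n \<alpha> = vanish n (L_pts n \<alpha>)"

definition SL :: "nat \<Rightarrow> complex vec list \<Rightarrow> nat cpoly set ring" where
  "SL n \<alpha> = Sring n Quot IL n \<alpha>"

definition Der_L :: "nat \<Rightarrow> nat \<Rightarrow> complex vec list \<Rightarrow> (nat cpoly set, mindex \<Rightarrow> nat cpoly set) module" where
  "Der_L n k \<alpha> = free_module (SL n \<alpha>) (multi n k)"

definition restr :: "nat \<Rightarrow> nat \<Rightarrow> complex vec list \<Rightarrow> (mindex \<Rightarrow> nat cpoly) \<Rightarrow> (mindex \<Rightarrow> nat cpoly set)" where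
  "restr n k \<alpha> \<theta> = (\<lambda>\<beta>\<in>multi n k. IL n \<alpha> +>\<^bsub>Sring n\<^esub> \<theta> \<beta>)"

text \<open>The restriction to \<open>L\<close> of the sheaf associated with \<open>Dk n k Z\<close> is the sheaf associated with
  \<open>D / I(L) D\<close>.\<close>

definition IL_D :: "nat \<Rightarrow> nat \<Rightarrow> complex vec set \<Rightarrow> complex vec list \<Rightarrow> (mindex \<Rightarrow> nat cpoly) set" where
  "IL_D n k Z \<alpha> = generate (add_monoid (Dk n k Z))
     {a \<odot>\<^bsub>Dk n k Z\<^esub> \<theta> | a \<theta>. a \<in> IL n \<alpha> \<and> \<theta> \<in> carrier (Dk n k Z)}"

definition H0_D :: "nat \<Rightarrow> nat \<Rightarrow> complex vec set \<Rightarrow> complex vec list \<Rightarrow> nat \<Rightarrow>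
    (complex vec \<Rightarrow> ((mindex \<Rightarrow> nat cpoly) set \<times> nat cpoly) set) set" where
  "H0_D n k Z \<alpha> d = sheaf_sections n (L_pts n \<alpha>)
     (quot_module (Dk n k Z) (IL_D n k Z \<alpha>)) (quot_grading (Dk n k Z) (IL_D n k Z \<alpha>) (Dk_comp n k Z)) d"

text \<open>A section of degree \<open>d\<close> is viewed as the homogeneous element \<open>s\<close> of degree \<open>d\<close> of the free module
  over \<open>S/I(L)\<close> which it equals locally: \<open>s = \<theta>|\<^sub>L / g\<close> for the fractions \<open>\<theta> / g\<close> in its germs
  (the homogeneous element \<open>s\<close> corresponds to a section of \<open>O\<^sub>L(d)\<^sup>N\<^sup>+\<^sup>1\<close>, and, \<open>S/I(L)\<close> being a domain,
  equality of fractions is equality after cross-multiplication).\<close>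

definition DL_comp :: "nat \<Rightarrow> nat \<Rightarrow> complex vec set \<Rightarrow> complex vec list \<Rightarrow> nat \<Rightarrow>
    (mindex \<Rightarrow> nat cpoly set) set" where
  "DL_comp n k Z \<alpha> d = {s \<in> restr n k \<alpha> ` Der_comp n k d.
     \<exists>\<sigma> \<in> H0_D n k Z \<alpha> d. \<forall>p \<in> L_pts n \<alpha>. \<forall>(m, g) \<in> \<sigma> p.
       the_elem (restr n k \<alpha> ` m) = (IL n \<alpha> +>\<^bsub>Sring n\<^esub> g) \<odot>\<^bsub>Der_L n k \<alpha>\<^esub> s}"


section \<open>The map and the modules\<close>

definition e_coord :: "nat \<Rightarrow> complex vec list \<Rightarrow> nat \<Rightarrow> nat cpoly" where
  "e_coord n \<alpha> i = det (mat_of_rows (Suc n)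
     (unit_vec (Suc n) i # vec (Suc n) var # map (map_vec const) \<alpha>))"

definition subst_e :: "nat \<Rightarrow> complex vec list \<Rightarrow> nat cpoly set \<Rightarrow> nat cpoly" where
  "subst_e n \<alpha> C = the_elem (peval const (e_coord n \<alpha>) ` C)"

definition PH :: "nat \<Rightarrow> complex vec list \<Rightarrow> nat cpoly ring" where
  "PH n \<alpha> = (Sring n)\<lparr>carrier := generate_ring (Sring n)
     (range const \<union> {l \<in> vanish n (H_pts n \<alpha>). homog 1 l})\<rparr>"

definition PH_comp :: "nat \<Rightarrow> complex vec list \<Rightarrow> nat \<Rightarrow> nat cpoly set" where
  "PH_comp n \<alpha> d = {q \<in> carrier (PH n \<alpha>). homog d q}"

text \<open>\<open>PH\<close> acts through the inverse of the isomorphism \<open>subst_e n \<alpha>\<close> from \<open>S/I(L)\<close> onto it.\<close>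

definition DL :: "nat \<Rightarrow> nat \<Rightarrow> complex vec set \<Rightarrow> complex vec list \<Rightarrow>
    (nat cpoly, mindex \<Rightarrow> nat cpoly set) module" where
  "DL n k Z \<alpha> =
     \<lparr>carrier = {finsum (Der_L n k \<alpha>) s {..b} | s b. \<forall>d\<le>b. s d \<in> DL_comp n k Z \<alpha> d},
      mult = undefined, one = undefined,
      zero = \<zero>\<^bsub>Der_L n k \<alpha>\<^esub>, add = add (Der_L n k \<alpha>),
      smult = (\<lambda>q s. inv_into (carrier (SL n \<alpha>)) (subst_e n \<alpha>) q \<odot>\<^bsub>Der_L n k \<alpha>\<^esub> s)\<rparr>"

definition euler_L :: "nat \<Rightarrow> nat \<Rightarrow> complex vec list \<Rightarrow> mindex \<Rightarrow> mindex \<Rightarrow> nat cpoly set" where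
  "euler_L n k \<alpha> \<gamma> = restr n k \<alpha> (euler_der n k \<gamma>)"

definition euler_submodule :: "nat \<Rightarrow> nat \<Rightarrow> complex vec list \<Rightarrow> (mindex \<Rightarrow> nat cpoly set) set" where
  "euler_submodule n k \<alpha> =
     LinearCombinations.module.span (SL n \<alpha>) (Der_L n k \<alpha>) (euler_L n k \<alpha> ` multi n (k - 1))"

definition D0L :: "nat \<Rightarrow> nat \<Rightarrow> complex vec set \<Rightarrow> complex vec list \<Rightarrow>
    (nat cpoly, (mindex \<Rightarrow> nat cpoly set) set) module" where
  "D0L n k Z \<alpha> = quot_module (DL n k Z \<alpha>) (euler_submodule n k \<alpha>)"

definition D0L_comp :: "nat \<Rightarrow> nat \<Rightarrow> complex vec set \<Rightarrow> complex vec list \<Rightarrow> nat \<Rightarrow>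
    (mindex \<Rightarrow> nat cpoly set) set set" where
  "D0L_comp n k Z \<alpha> = quot_grading (DL n k Z \<alpha>) (euler_submodule n k \<alpha>) (DL_comp n k Z \<alpha>)"

text \<open>Here \<open>j\<close> is the degree as polynomials in \<open>X\<close>, so \<open>[I(Z) \<inter> I(H)\<^sup>d]\<^sub>d\<^sub>+\<^sub>k\<close> has index \<open>j = d + k\<close>.\<close>

definition IZH_comp :: "nat \<Rightarrow> nat \<Rightarrow> complex vec set \<Rightarrow> complex vec list \<Rightarrow> nat \<Rightarrow> nat cpoly set" where
  "IZH_comp n k Z \<alpha> j = (if j < k then {0} else
     {F \<in> vanish n (all_coords Z) \<inter> ideal_pow n (vanish n (H_pts n \<alpha>)) (j - k). homog j F})"

definition IZH :: "nat \<Rightarrow> nat \<Rightarrow> complex vec set \<Rightarrow> complex vec list \<Rightarrow> (nat cpoly, nat cpoly) module" where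
  "IZH n k Z \<alpha> =
     \<lparr>carrier = {F \<in> carrier (Sring n). \<forall>j. hpart j F \<in> IZH_comp n k Z \<alpha> j},
      mult = undefined, one = undefined, zero = 0, add = (+), smult = (*)\<rparr>"

definition eta :: "nat \<Rightarrow> nat \<Rightarrow> complex vec list \<Rightarrow> (mindex \<Rightarrow> nat cpoly set) \<Rightarrow> nat cpoly" where
  "eta n k \<alpha> s = (\<Sum>\<beta>\<in>multi n k. subst_e n \<alpha> (s \<beta>) * Poly_Mapping.single \<beta> 1)"

end

theory Submission
  imports Defs "HOL-Library.Product_Lexorder"
begin

text \<open>
  The line \<open>L\<close> is the pencil of hyperplanes through \<open>H\<close>. For general \<open>\<alpha>\<close> it is spanned by two vectors
  \<open>a, b\<close> that restrict to coordinates on the plane of the first two unit vectors; with the linear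
  forms \<open>A = a \<bullet> X\<close>, \<open>B = b \<bullet> X\<close> one gets \<open>H = {A = B = 0}\<close> and \<open>e(M) = D (B a - A b)\<close>
  for a nonzero constant \<open>D\<close>. So \<open>Y \<mapsto> e(M)\<close> identifies \<open>S/I(L)\<close> with \<open>P = \<complex>[A, B]\<close>, and the theorem
  becomes a statement about tuples \<open>(q\<^sub>\<beta>)\<close> of elements of \<open>P\<close> and the polynomials
  \<open>\<Sum> q\<^sub>\<beta> X\<^sup>\<beta>\<close>.

  The heart of the matter is \<open>DL_comp_eq\<close>: a tuple of forms on \<open>L\<close> is a section of the restricted
  sheaf iff its image under \<open>\<eta>\<close> vanishes on \<open>Z\<close>. Let \<open>y\<^sub>P = e(M)(P)\<close> be the point at which \<open>L\<close> meets
  the hyperplane of \<open>P \<in> Z\<close>; since \<open>\<alpha>\<close> is general, no other hyperplane passes through it. By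
  construction \<open>\<eta>(\<theta>)(P) = \<theta>(P)(y\<^sub>P)\<close>. At \<open>y\<^sub>P\<close> the gradient of \<open>f\<close> is a nonzero multiple of \<open>P\<close>, so
  evaluating \<open>\<theta>(f) \<in> (f)\<close> there gives \<open>\<theta>(P)(y\<^sub>P) = 0\<close>. Conversely, off the arrangement every
  \<open>\<theta>\<close> is the fraction \<open>f \<theta> / f\<close>, because \<open>\<theta>(f) \<in> J\<^sup>k\<close>; and near \<open>y\<^sub>P\<close> the ideal \<open>J\<close> is the unit ideal,
  so that it suffices to change \<open>\<theta>\<close> modulo \<open>I(L)\<close> until \<open>P\<close> divides \<open>\<theta>(P)\<close>. This is possible since
  a form on \<open>L\<close> that vanishes at \<open>y\<^sub>P\<close> is divisible by the restriction of \<open>P\<close> (\<open>PH_divides\<close>).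

  The rest is algebra over \<open>P\<close>. The powers of \<open>I(H) = (A, B)\<close> consist of the binary forms in
  \<open>A, B\<close> with polynomial coefficients (\<open>IH_pow_adic\<close>), so \<open>\<eta>\<close> maps onto \<open>I(Z,H)\<close>. A relation
  \<open>\<Sum> q\<^sub>\<beta> X\<^sup>\<beta> = 0\<close> is a consequence of \<open>\<Sum> e(M\<^sub>m) X\<^sub>m = 0\<close>, i.e. of \<open>D (B A - A B) = 0\<close>, by a Koszul
  argument for the regular sequence \<open>A, B\<close> (\<open>relations\<close>); these consequences are the combinations
  of the Euler derivations, which are independent because multiplication by a nonzero linear form
  is injective (\<open>lin_mult_inj\<close>).
\<close>

section \<open>Polynomials as finitely supported functions\<close>

abbreviation lookup :: "('a \<Rightarrow>\<^sub>0 'b::zero) \<Rightarrow> 'a \<Rightarrow> 'b" where "lookup \<equiv> Poly_Mapping.lookup"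
abbreviation keys :: "('a \<Rightarrow>\<^sub>0 'b::zero) \<Rightarrow> 'a set" where "keys \<equiv> Poly_Mapping.keys"
abbreviation single :: "'a \<Rightarrow> 'b \<Rightarrow> 'a \<Rightarrow>\<^sub>0 'b::zero" where "single \<equiv> Poly_Mapping.single"

lemma sum_of_singles:
  fixes p :: "'a \<Rightarrow>\<^sub>0 'b::comm_monoid_add"
  shows "p = (\<Sum>m\<in>keys p. single m (lookup p m))"
proof (rule poly_mapping_eqI)
  fix t
  have "lookup (\<Sum>m\<in>keys p. single m (lookup p m)) t = (\<Sum>m\<in>keys p. if m = t then lookup p m else 0)"
    unfolding lookup_sum by (intro sum.cong refl) (simp add: lookup_single when_def)
  also have "\<dots> = lookup p t" by (simp add: in_keys_iff)
  finally show "lookup p t = lookup (\<Sum>m\<in>keys p. single m (lookup p m)) t" by simp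
qed

lemma poly_induct_keys:
  fixes p :: "'a \<Rightarrow>\<^sub>0 'b::comm_monoid_add"
  assumes "P 0" "\<And>m c. m \<in> keys p \<Longrightarrow> P (single m c)" "\<And>p q. P p \<Longrightarrow> P q \<Longrightarrow> P (p + q)"
  shows "P p"
proof -
  have "P (\<Sum>m\<in>A. single m (lookup p m))" if "finite A" "A \<subseteq> keys p" for A
    using that by (induction A rule: finite_induct) (use assms in auto)
  then show ?thesis using sum_of_singles[of p] by (metis finite_keys order_refl)
qed

lemma poly_induct:
  fixes p :: "'a \<Rightarrow>\<^sub>0 'b::comm_monoid_add"
  assumes "\<And>m c. P (single m c)" "\<And>p q. P p \<Longrightarrow> P q \<Longrightarrow> P (p + q)"
  shows "P p"
  by (rule poly_induct_keys) (use assms assms(1)[of _ 0] in auto)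

definition meval :: "('v \<Rightarrow> 'a::comm_ring_1) \<Rightarrow> ('v \<Rightarrow>\<^sub>0 nat) \<Rightarrow> 'a" where
  "meval x m = (\<Prod>i\<in>keys m. x i ^ lookup m i)"

lemma meval_superset:
  assumes "finite A" "keys m \<subseteq> A"
  shows "meval x m = (\<Prod>i\<in>A. x i ^ lookup m i)"
  unfolding meval_def using assms
  by (intro prod.mono_neutral_left) (auto simp: in_keys_iff)

lemma meval_zero [simp]: "meval x 0 = 1"
  by (simp add: meval_def)

lemma meval_single [simp]: "meval x (single i j) = x i ^ j"
  by (cases "j = 0") (simp_all add: meval_def)

lemma meval_add: "meval x (m + m') = meval x m * meval x m'"
proof -
  let ?A = "keys m \<union> keys m'"
  have "meval x (m + m') = (\<Prod>i\<in>?A. x i ^ lookup (m + m') i)"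
    by (rule meval_superset) (auto simp: keys_add)
  moreover have "meval x m = (\<Prod>i\<in>?A. x i ^ lookup m i)" by (rule meval_superset) auto
  moreover have "meval x m' = (\<Prod>i\<in>?A. x i ^ lookup m' i)" by (rule meval_superset) auto
  ultimately show ?thesis by (simp add: lookup_add power_add prod.distrib)
qed

lemma peval_meval: "peval h x p = (\<Sum>m\<in>keys p. h (lookup p m) * meval x m)"
  by (simp add: peval_def meval_def)

lemma peval_superset:
  assumes "h 0 = 0" "finite A" "keys p \<subseteq> A"
  shows "peval h x p = (\<Sum>m\<in>A. h (lookup p m) * meval x m)"
  unfolding peval_meval using assms
  by (intro sum.mono_neutral_left) (auto simp: in_keys_iff)

lemma peval_single: "h 0 = 0 \<Longrightarrow> peval h x (single m c) = h c * meval x m"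
  by (cases "c = 0") (simp_all add: peval_meval)

lemma comm_ring_hom_peval:
  assumes "comm_ring_hom h"
  shows "comm_ring_hom (peval h x)"
proof -
  interpret h: comm_ring_hom h by fact
  have add: "peval h x (p + q) = peval h x p + peval h x q" for p q
  proof -
    let ?A = "keys p \<union> keys q"
    have "peval h x (p + q) = (\<Sum>m\<in>?A. h (lookup (p + q) m) * meval x m)"
      by (rule peval_superset) (auto simp: keys_add)
    moreover have "peval h x p = (\<Sum>m\<in>?A. h (lookup p m) * meval x m)" by (rule peval_superset) auto
    moreover have "peval h x q = (\<Sum>m\<in>?A. h (lookup q m) * meval x m)" by (rule peval_superset) auto
    ultimately show ?thesis by (simp add: lookup_add h.hom_add sum.distrib distrib_right)
  qed
  have "peval h x (p * q) = peval h x p * peval h x q" for p q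
  proof (induction p rule: poly_induct)
    case (1 m c)
    show ?case
      by (induction q rule: poly_induct)
        (simp_all add: mult_single peval_single h.hom_mult meval_add mult_ac distrib_left distrib_right add)
  qed (simp add: distrib_right add)
  moreover have "peval h x 1 = 1" using peval_single[of h x 0 1] by simp
  ultimately show ?thesis
    by unfold_locales (simp_all add: add, simp add: peval_meval)
qed

interpretation const_hom: comm_ring_hom const
  by unfold_locales (simp_all add: const_def single_add mult_single)

lemma comm_ring_hom_id: "comm_ring_hom (id :: 'a::comm_ring_1 \<Rightarrow> 'a)"
  by unfold_locales simp_all

interpretation subst_hom: comm_ring_hom "peval const x" for x :: "'v \<Rightarrow> 'w cpoly"
  by (rule comm_ring_hom_peval) (rule const_hom.comm_ring_hom_axioms)

interpretation peval_id_hom: comm_ring_hom "peval id x" for x :: "'v \<Rightarrow> complex"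
  by (rule comm_ring_hom_peval) (rule comm_ring_hom_id)

interpretation ev_hom: comm_ring_hom "ev v" for v
proof -
  have "ev v = peval id (\<lambda>i. v $ i)" by (rule ext) (simp add: ev_def)
  then show "comm_ring_hom (ev v)" by (simp add: peval_id_hom.comm_ring_hom_axioms)
qed

lemma subst_const [simp]: "peval const x (const c) = const c"
  unfolding const_def by (subst peval_single) simp_all

lemma subst_var [simp]: "peval const x (var i) = x i"
  unfolding var_def by (subst peval_single) simp_all

lemma peval_id_const [simp]: "peval id x (const c) = c"
  unfolding const_def by (subst peval_single) simp_all

lemma peval_id_var [simp]: "peval id x (var i) = x i"
  unfolding var_def by (subst peval_single) simp_all

lemma ev_const [simp]: "ev v (const c) = c"
  by (simp add: ev_def)

lemma ev_var [simp]: "ev v (var i) = v $ i"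
  by (simp add: ev_def)

lemma ev_single: "ev v (single m c) = c * meval (\<lambda>i. v $ i) m"
  by (simp add: ev_def peval_single)

lemma var_power: "var i ^ j = single (single i j) 1"
  by (induction j) (simp_all add: var_def mult_single single_add[symmetric])

lemma single_eq_meval: "single m c = const c * meval var m"
proof -
  have "(\<Prod>i\<in>A. single (single i (lookup m i)) 1) = single (\<Sum>i\<in>A. single i (lookup m i)) (1::complex)"
    if "finite A" for A
    using that by (induction A rule: finite_induct) (simp_all add: mult_single)
  then have "meval var m = single m (1::complex)"
    by (simp add: meval_def var_power sum_of_singles[of m, symmetric])
  then show ?thesis by (simp add: const_def mult_single)
qed

text \<open>The carrier of \<open>Sring n\<close> is the case \<open>V = {..n}\<close>. For the genericity condition the variables
  are the pairs indexing the entries of a tuple of vectors.\<close>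

definition vars_in :: "'v set \<Rightarrow> 'v cpoly \<Rightarrow> bool" where
  "vars_in V p \<longleftrightarrow> (\<forall>m\<in>keys p. keys m \<subseteq> V)"

lemma carrier_Sring: "p \<in> carrier (Sring n) \<longleftrightarrow> vars_in {..n} p"
  by (simp add: Sring_def vars_in_def)

lemma vars_in_single: "keys m \<subseteq> V \<Longrightarrow> vars_in V (single m c)"
  by (auto simp: vars_in_def split: if_splits)

lemma vars_in_zero [simp]: "vars_in V 0"
  by (simp add: vars_in_def)

lemma vars_in_const [simp]: "vars_in V (const c)"
  unfolding const_def by (rule vars_in_single) simp

lemma vars_in_one [simp]: "vars_in V 1"
  using vars_in_const[of V 1] by (simp add: const_def)

lemma vars_in_var [simp]: "i \<in> V \<Longrightarrow> vars_in V (var i)"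
  unfolding var_def by (rule vars_in_single) simp

lemma vars_in_add [simp]: "vars_in V p \<Longrightarrow> vars_in V q \<Longrightarrow> vars_in V (p + q)"
  unfolding vars_in_def using keys_add[of p q] by blast

lemma vars_in_uminus [simp]: "vars_in V p \<Longrightarrow> vars_in V (- p)"
  by (simp add: vars_in_def in_keys_iff)

lemma vars_in_diff [simp]: "vars_in V p \<Longrightarrow> vars_in V q \<Longrightarrow> vars_in V (p - q)"
  using vars_in_add[of V p "- q"] by simp

lemma vars_in_mult [simp]:
  assumes "vars_in V p" "vars_in V q"
  shows "vars_in V (p * q)"
  unfolding vars_in_def
proof
  fix m assume "m \<in> keys (p * q)"
  then obtain s t where "s \<in> keys p" "t \<in> keys q" "m = s + t"
    using keys_mult[of p q] by blast
  then show "keys m \<subseteq> V" using assms keys_add[of s t] unfolding vars_in_def by blast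
qed

lemma vars_in_sum [simp]: "(\<And>i. i \<in> A \<Longrightarrow> vars_in V (f i)) \<Longrightarrow> vars_in V (sum f A)"
  by (induction A rule: infinite_finite_induct) auto

lemma vars_in_prod [simp]: "(\<And>i. i \<in> A \<Longrightarrow> vars_in V (f i)) \<Longrightarrow> vars_in V (prod f A)"
  by (induction A rule: infinite_finite_induct) auto

lemma vars_in_power [simp]: "vars_in V p \<Longrightarrow> vars_in V (p ^ j)"
  by (induction j) auto

lemma vars_in_induct [consumes 1, case_names const var add mult]:
  assumes "vars_in V p"
    and const: "\<And>c. P (const c)" and var: "\<And>i. i \<in> V \<Longrightarrow> P (var i)"
    and add: "\<And>p q. vars_in V p \<Longrightarrow> vars_in V q \<Longrightarrow> P p \<Longrightarrow> P q \<Longrightarrow> P (p + q)"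
    and mult: "\<And>p q. vars_in V p \<Longrightarrow> vars_in V q \<Longrightarrow> P p \<Longrightarrow> P q \<Longrightarrow> P (p * q)"
  shows "P p"
proof -
  have pow: "vars_in V q \<and> P q \<Longrightarrow> vars_in V (q ^ j) \<and> P (q ^ j)" for q j
    using const[of 1] mult by (induction j) auto
  have "vars_in V (meval var m) \<and> P (meval var m)" if "keys m \<subseteq> V" for m
  proof -
    have "vars_in V (\<Prod>i\<in>A. var i ^ lookup m i) \<and> P (\<Prod>i\<in>A. var i ^ lookup m i)"
      if "finite A" "A \<subseteq> V" for A
      using that pow var const[of 1] mult
      by (induction A rule: finite_induct) auto
    then show ?thesis using that by (simp add: meval_def)
  qed
  then have s: "P (single m c)" if "keys m \<subseteq> V" for m c
    unfolding single_eq_meval using that mult const by simp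
  have "vars_in V p \<and> P p"
  proof (rule poly_induct_keys)
    show "vars_in V 0 \<and> P 0" using const[of 0] by simp
    show "vars_in V (single m c) \<and> P (single m c)" if "m \<in> keys p" for m c
      using s vars_in_single that assms(1) by (auto simp: vars_in_def)
    show "vars_in V (p + q) \<and> P (p + q)" if "vars_in V p \<and> P p" "vars_in V q \<and> P q" for p q
      using that add by simp
  qed
  then show ?thesis ..
qed

text \<open>Identities between substitutions and evaluations are checked on constants and variables.\<close>

lemma hom_eqI:
  assumes "comm_ring_hom f" "comm_ring_hom g" "vars_in V p"
    and "\<And>c. f (const c) = g (const c)" and "\<And>i. i \<in> V \<Longrightarrow> f (var i) = g (var i)"
  shows "f p = g p"
proof -
  interpret f: comm_ring_hom f by fact
  interpret g: comm_ring_hom g by fact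
  show ?thesis using assms(3)
    by (induction rule: vars_in_induct) (use assms in \<open>auto simp: f.hom_add g.hom_add f.hom_mult g.hom_mult\<close>)
qed

lemma vars_in_UNIV [simp]: "vars_in UNIV p"
  by (simp add: vars_in_def)

lemma vars_in_subst [simp]:
  assumes "vars_in V p" "\<And>i. i \<in> V \<Longrightarrow> vars_in W (x i)"
  shows "vars_in W (peval const x p)"
  using assms(1) by (induction rule: vars_in_induct) (auto simp: assms subst_hom.hom_add subst_hom.hom_mult)

lemma ev_subst: "ev v (peval const x p) = ev (vec N (\<lambda>i. ev v (x i))) p" if "vars_in {..<N} p"
proof (rule hom_eqI[OF _ _ that])
  show "comm_ring_hom (\<lambda>p. ev v (peval const x p))"
    by unfold_locales (simp_all add: hom_distribs)
  show "comm_ring_hom (ev (vec N (\<lambda>i. ev v (x i))))" by (rule ev_hom.comm_ring_hom_axioms)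
qed simp_all

lemma subst_var_id [simp]: "peval const var p = p"
  by (rule hom_eqI[where V = UNIV]) (auto intro: subst_hom.comm_ring_hom_axioms comm_ring_hom_id[unfolded id_def])

text \<open>Dedekind's argument for the independence of characters: if two monomials of \<open>p\<close> differ in the
  exponent of \<open>i\<close>, then comparing \<open>p\<close> with its dilation by \<open>2\<close> in the variable \<open>i\<close> yields a nonzero
  vanishing polynomial with fewer monomials.\<close>

lemma poly_eq_zeroI:
  assumes "\<And>x. peval id x p = (0::complex)"
  shows "p = 0"
proof (rule ccontr)
  assume "p \<noteq> 0"
  with assms show False
  proof (induction "card (keys p)" arbitrary: p rule: less_induct)
    case less
    obtain m where m: "m \<in> keys p" using less.prems(2) keys_eq_empty by fastforce
    show False
    proof (cases "keys p = {m}")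
      case True
      then have "peval id (\<lambda>_. 1) p = lookup p m" by (simp add: peval_meval meval_def)
      then show False using less.prems(1) m by (simp add: in_keys_iff)
    next
      case False
      then obtain m' where m': "m' \<in> keys p" "m' \<noteq> m" using m by blast
      then obtain i where i: "lookup m i \<noteq> lookup m' i" by (metis poly_mapping_eqI)
      define q where "q = (\<Sum>t\<in>keys p. single t (lookup p t * (2 ^ lookup t i - 2 ^ lookup m i)))"
      have lq: "lookup q t = lookup p t * (2 ^ lookup t i - 2 ^ lookup m i)" for t
      proof -
        have "lookup q t = (\<Sum>s\<in>keys p. if s = t then lookup p s * (2 ^ lookup s i - 2 ^ lookup m i) else 0)"
          unfolding q_def lookup_sum by (intro sum.cong refl) (simp add: lookup_single when_def)
        then show ?thesis by (simp add: in_keys_iff)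
      qed
      have sub: "keys q \<subseteq> keys p - {m}" by (auto simp: in_keys_iff lq)
      have "(2::complex) ^ lookup m' i \<noteq> 2 ^ lookup m i"
      proof
        assume "(2::complex) ^ lookup m' i = 2 ^ lookup m i"
        then have "of_nat (2 ^ lookup m' i) = (of_nat (2 ^ lookup m i) :: complex)" by simp
        then have "(2::nat) ^ lookup m' i = 2 ^ lookup m i" by (simp only: of_nat_eq_iff)
        with i show False by simp
      qed
      then have "lookup q m' \<noteq> 0" using m' by (simp add: lq in_keys_iff)
      then have q0: "q \<noteq> 0" by auto
      have "peval id x q = 0" for x
      proof -
        let ?y = "x(i := 2 * x i)"
        have dil: "meval ?y t = 2 ^ lookup t i * meval x t" for t
        proof -
          let ?A = "insert i (keys t)"
          have "meval ?y t = (\<Prod>j\<in>?A. (if j = i then 2 ^ lookup t i else 1) * x j ^ lookup t j)"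
            by (rule trans[OF meval_superset[of ?A]], simp, blast, rule prod.cong)
              (simp_all add: power_mult_distrib)
          also have "\<dots> = 2 ^ lookup t i * (\<Prod>j\<in>?A. x j ^ lookup t j)"
            unfolding prod.distrib by (subst prod.delta) auto
          also have "(\<Prod>j\<in>?A. x j ^ lookup t j) = meval x t"
            by (rule meval_superset[symmetric]) auto
          finally show ?thesis .
        qed
        have "peval id x q = (\<Sum>t\<in>keys p. lookup q t * meval x t)"
          using sub by (subst peval_superset[of _ "keys p"]) auto
        also have "\<dots> = (\<Sum>t\<in>keys p. lookup p t * meval ?y t - 2 ^ lookup m i * (lookup p t * meval x t))"
          by (intro sum.cong refl) (simp only: lq dil, simp only: algebra_simps)
        also have "\<dots> = peval id ?y p - 2 ^ lookup m i * peval id x p"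
          by (simp add: peval_meval sum_subtractf sum_distrib_left)
        finally show ?thesis using less.prems(1) by simp
      qed
      moreover have "card (keys q) < card (keys p)"
        using sub m by (intro psubset_card_mono) auto
      ultimately show False using less.hyps q0 by blast
    qed
  qed
qed

lemma Sring_eq_zeroI:
  assumes "p \<in> carrier (Sring n)" "\<And>v. v \<in> carrier_vec (Suc n) \<Longrightarrow> ev v p = 0"
  shows "p = 0"
proof (rule poly_eq_zeroI)
  fix x :: "nat \<Rightarrow> complex"
  have "peval id x p = ev (vec (Suc n) x) p"
  proof (rule hom_eqI[of _ _ "{..n}"])
    show "comm_ring_hom (peval id x)" by (rule peval_id_hom.comm_ring_hom_axioms)
    show "comm_ring_hom (ev (vec (Suc n) x))" by (rule ev_hom.comm_ring_hom_axioms)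
  qed (use assms(1) in \<open>simp_all add: carrier_Sring del: id_apply\<close>)
  then show "peval id x p = 0" using assms(2) by simp
qed

section \<open>Degrees\<close>

lemma tdeg_superset:
  assumes "finite A" "keys m \<subseteq> A"
  shows "tdeg m = (\<Sum>i\<in>A. lookup m i)"
  unfolding tdeg_def using assms by (intro sum.mono_neutral_left) (auto simp: in_keys_iff)

lemma tdeg_zero [simp]: "tdeg 0 = 0"
  by (simp add: tdeg_def)

lemma tdeg_single [simp]: "tdeg (single i j) = j"
  by (cases "j = 0") (simp_all add: tdeg_def)

lemma tdeg_add [simp]: "tdeg (m + m') = tdeg m + tdeg m'"
proof -
  let ?A = "keys m \<union> keys m'"
  have "tdeg (m + m') = (\<Sum>i\<in>?A. lookup (m + m') i)" by (rule tdeg_superset) (auto simp: keys_add)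
  moreover have "tdeg m = (\<Sum>i\<in>?A. lookup m i)" by (rule tdeg_superset) auto
  moreover have "tdeg m' = (\<Sum>i\<in>?A. lookup m' i)" by (rule tdeg_superset) auto
  ultimately show ?thesis by (simp add: lookup_add sum.distrib)
qed

lemma tdeg_eq_0_iff: "tdeg m = 0 \<longleftrightarrow> m = 0"
  by (auto simp: tdeg_def in_keys_iff intro: poly_mapping_eqI)

lemma homog_single [simp]: "tdeg m = d \<Longrightarrow> homog d (single m c)"
  by (auto simp: homog_def split: if_splits)

lemma homog_zero [simp]: "homog d 0"
  by (simp add: homog_def)

lemma homog_const [simp]: "homog 0 (const c)"
  by (simp add: const_def)

lemma homog_one [simp]: "homog 0 1"
  using homog_const[of 1] by simp

lemma homog_var [simp]: "homog 1 (var i)" "homog (Suc 0) (var i)"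
  by (simp_all add: var_def)

lemma homog_add [simp]: "homog d p \<Longrightarrow> homog d q \<Longrightarrow> homog d (p + q)"
  unfolding homog_def using keys_add[of p q] by blast

lemma homog_uminus [simp]: "homog d p \<Longrightarrow> homog d (- p)"
  by (simp add: homog_def in_keys_iff)

lemma homog_diff [simp]: "homog d p \<Longrightarrow> homog d q \<Longrightarrow> homog d (p - q)"
  using homog_add[of d p "- q"] by simp

lemma homog_mult:
  assumes "homog d p" "homog e q"
  shows "homog (d + e) (p * q)"
  unfolding homog_def
proof
  fix m assume "m \<in> keys (p * q)"
  then obtain s t where "s \<in> keys p" "t \<in> keys q" "m = s + t"
    using keys_mult[of p q] by blast
  then show "tdeg m = d + e" using assms by (simp add: homog_def)
qed

lemma homog_const_mult [simp]: "homog d p \<Longrightarrow> homog d (const c * p)"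
  using homog_mult[OF homog_const, of d p c] by simp

lemma homog_sum [simp]: "(\<And>i. i \<in> A \<Longrightarrow> homog d (f i)) \<Longrightarrow> homog d (sum f A)"
  by (induction A rule: infinite_finite_induct) auto

lemma homog_power: "homog d p \<Longrightarrow> homog (j * d) (p ^ j)"
  by (induction j) (auto intro: homog_mult)

lemma homog_prod: "(\<And>i. i \<in> A \<Longrightarrow> homog (d i) (f i)) \<Longrightarrow> homog (sum d A) (prod f A)"
  by (induction A rule: infinite_finite_induct) (auto intro: homog_mult)

lemma lookup_hpart: "lookup (hpart d p) m = (if tdeg m = d then lookup p m else 0)"
proof -
  have "lookup (hpart d p) m = (\<Sum>s\<in>{s \<in> keys p. tdeg s = d}. if s = m then lookup p s else 0)"
    unfolding hpart_def lookup_sum by (intro sum.cong refl) (simp add: lookup_single when_def)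
  then show ?thesis by (simp add: in_keys_iff)
qed

lemma homog_hpart [simp]: "homog d (hpart d p)"
  by (auto simp: homog_def in_keys_iff lookup_hpart split: if_splits)

lemma hpart_add: "hpart d (p + q) = hpart d p + hpart d q"
  by (rule poly_mapping_eqI) (simp add: lookup_hpart lookup_add)

lemma hpart_zero [simp]: "hpart d 0 = 0"
  by (rule poly_mapping_eqI) (simp add: lookup_hpart)

lemma hpart_sum: "hpart d (sum f A) = (\<Sum>i\<in>A. hpart d (f i))"
  by (induction A rule: infinite_finite_induct) (auto simp: hpart_add)

lemma hpart_homog: "homog e p \<Longrightarrow> hpart d p = (if d = e then p else 0)"
  by (rule poly_mapping_eqI) (auto simp: lookup_hpart homog_def in_keys_iff)

lemma homog_hpart_eq: "homog d p \<Longrightarrow> hpart d p = p"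
  by (simp add: hpart_homog)

lemma homog_eqI: "homog d p \<longleftrightarrow> hpart d p = p"
  by (metis homog_hpart homog_hpart_eq)

lemma vars_in_hpart [simp]: "vars_in V p \<Longrightarrow> vars_in V (hpart d p)"
  by (auto simp: vars_in_def in_keys_iff lookup_hpart split: if_splits)

definition deg_bound :: "nat cpoly \<Rightarrow> nat" where
  "deg_bound p = Max (insert 0 (tdeg ` keys p))"

lemma hpart_gt_deg_bound: "d > deg_bound p \<Longrightarrow> hpart d p = 0"
proof (rule poly_mapping_eqI)
  fix m assume "d > deg_bound p"
  then show "lookup (hpart d p) m = lookup 0 m"
    by (auto simp: lookup_hpart in_keys_iff deg_bound_def)
qed

lemma sum_hpart:
  assumes "deg_bound p \<le> b"
  shows "(\<Sum>d\<le>b. hpart d p) = p"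
proof (rule poly_mapping_eqI)
  fix m
  have "lookup (\<Sum>d\<le>b. hpart d p) m = (\<Sum>d\<le>b. if d = tdeg m then lookup p m else 0)"
    unfolding lookup_sum by (intro sum.cong refl) (simp add: lookup_hpart)
  also have "\<dots> = lookup p m"
    using assms by (auto simp: deg_bound_def in_keys_iff)
  finally show "lookup (\<Sum>d\<le>b. hpart d p) m = lookup p m" .
qed

lemma hpart_mult:
  assumes "homog d p"
  shows "hpart j (p * q) = (if j < d then 0 else p * hpart (j - d) q)"
proof -
  have "hpart j (p * q) = (\<Sum>e\<le>deg_bound q. hpart j (p * hpart e q))"
    by (subst sum_hpart[of q, symmetric, OF order_refl]) (simp add: sum_distrib_left hpart_sum)
  also have "\<dots> = (\<Sum>e\<le>deg_bound q. if j = d + e then p * hpart e q else 0)"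
    by (intro sum.cong refl hpart_homog homog_mult assms homog_hpart)
  also have "\<dots> = (if j < d then 0 else p * hpart (j - d) q)"
  proof (cases "j < d")
    case False
    then have "(\<Sum>e\<le>deg_bound q. if j = d + e then p * hpart e q else 0) =
        (\<Sum>e\<le>deg_bound q. if e = j - d then p * hpart e q else 0)"
      by (intro sum.cong) auto
    then show ?thesis using False hpart_gt_deg_bound[of q "j - d"] by (auto simp: not_le)
  qed simp
  finally show ?thesis .
qed

text \<open>Both sides of \<open>p q = p (hpart e q)\<close> have the same part of degree \<open>d + e\<close>.\<close>

lemma homog_cancel:
  assumes "homog d p" "p \<noteq> 0" "homog (d + e) (p * q)"
  shows "homog e q"
proof -
  have "p * q = p * hpart e q"
    using hpart_mult[OF assms(1), of "d + e" q] homog_hpart_eq[OF assms(3)] by simp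
  then show ?thesis using assms(2) by (simp add: homog_eqI)
qed

lemma homog_deg0: "homog 0 p \<Longrightarrow> \<exists>c. p = const c"
proof
  assume "homog 0 p"
  then show "p = const (lookup p 0)"
    by (intro poly_mapping_eqI) (auto simp: homog_def in_keys_iff const_def lookup_single when_def tdeg_eq_0_iff)
qed

text \<open>The degrees \<open>g i\<close> are distinct, so each summand is a homogeneous part of the sum. All gradings
  below are direct for this reason.\<close>

lemma homog_sum_eq_0:
  assumes "finite F" "inj_on g F" "\<And>i. i \<in> F \<Longrightarrow> homog (g i) (u i)" "(\<Sum>i\<in>F. u i) = 0" "i \<in> F"
  shows "u i = 0"
proof -
  have "0 = hpart (g i) (\<Sum>j\<in>F. u j)" using assms by simp
  also have "\<dots> = (\<Sum>j\<in>F. if j = i then u j else 0)"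
    unfolding hpart_sum
    by (intro sum.cong refl) (use assms(2,5) hpart_homog[OF assms(3)] in \<open>auto dest: inj_onD\<close>)
  also have "\<dots> = u i" using assms by simp
  finally show ?thesis by simp
qed

lemma homog_subst:
  assumes "vars_in V p" "homog d p" "\<And>i. i \<in> V \<Longrightarrow> homog 1 (x i)"
  shows "homog d (peval const x p)"
proof -
  have "homog d (const (lookup p m) * meval x m)" if "m \<in> keys p" for m
  proof -
    have "homog (\<Sum>i\<in>keys m. lookup m i * 1) (meval x m)"
      unfolding meval_def by (intro homog_prod homog_power assms(3)) (use that assms(1) in \<open>auto simp: vars_in_def\<close>)
    then show ?thesis using that assms(2) by (simp add: homog_def[of d p] tdeg_def)
  qed
  then show ?thesis unfolding peval_meval by simp
qed

lemma hpart_subst: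
  assumes "vars_in V p" "\<And>i. i \<in> V \<Longrightarrow> homog 1 (x i)"
  shows "hpart d (peval const x p) = peval const x (hpart d p)"
proof -
  let ?b = "max d (deg_bound p)"
  have "hpart d (peval const x p) = hpart d (peval const x (\<Sum>e\<le>?b. hpart e p))"
    by (subst sum_hpart[of p ?b]) simp_all
  also have "\<dots> = (\<Sum>e\<le>?b. hpart d (peval const x (hpart e p)))"
    by (simp only: subst_hom.hom_sum hpart_sum)
  also have "\<dots> = (\<Sum>e\<le>?b. if e = d then peval const x (hpart e p) else 0)"
    by (intro sum.cong refl) (use hpart_homog[OF homog_subst[OF vars_in_hpart[OF assms(1)] homog_hpart assms(2)]] in auto)
  finally show ?thesis by simp
qed

lemma ev_smult:
  assumes "vars_in {..n} p" "homog d p" "v \<in> carrier_vec (Suc n)"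
  shows "ev (c \<cdot>\<^sub>v v) p = c ^ d * ev v p"
proof -
  have "meval (\<lambda>i. (c \<cdot>\<^sub>v v) $ i) m = c ^ d * meval (\<lambda>i. v $ i) m" if "m \<in> keys p" for m
  proof -
    have "meval (\<lambda>i. (c \<cdot>\<^sub>v v) $ i) m = (\<Prod>i\<in>keys m. c ^ lookup m i * (v $ i) ^ lookup m i)"
      unfolding meval_def using that assms
      by (intro prod.cong) (force simp: vars_in_def power_mult_distrib)+
    also have "\<dots> = c ^ tdeg m * meval (\<lambda>i. v $ i) m"
      by (simp add: prod.distrib power_sum tdeg_def meval_def)
    finally show ?thesis using that assms(2) by (simp add: homog_def)
  qed
  then show ?thesis by (simp add: ev_def peval_meval sum_distrib_left mult.left_commute)
qed

text \<open>On the punctured ray through \<open>v\<close> the value of \<open>p\<close> is a polynomial in \<open>c\<close> with infinitely many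
  zeros, whose coefficients are the values of the homogeneous parts.\<close>

lemma hpart_vanish_cone:
  assumes p: "vars_in {..n} p" and v: "v \<in> carrier_vec (Suc n)"
    and z: "\<And>c. c \<noteq> 0 \<Longrightarrow> ev (c \<cdot>\<^sub>v v) p = 0"
  shows "ev v (hpart j p) = 0"
proof -
  define b where "b = max j (deg_bound p)"
  have "(\<Sum>d\<le>b. ev v (hpart d p) * c ^ d) = 0" if "c \<noteq> 0" for c
  proof -
    have "0 = ev (c \<cdot>\<^sub>v v) (\<Sum>d\<le>b. hpart d p)" using z[OF that] by (simp add: sum_hpart b_def)
    also have "\<dots> = (\<Sum>d\<le>b. ev v (hpart d p) * c ^ d)"
      unfolding ev_hom.hom_sum
      by (intro sum.cong refl) (subst ev_smult[OF vars_in_hpart[OF p] homog_hpart v], simp)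
    finally show ?thesis by simp
  qed
  then have "UNIV - {0} \<subseteq> {c. (\<Sum>d\<le>b. ev v (hpart d p) * c ^ d) = 0}" by auto
  moreover have "infinite (UNIV - {0 :: complex})" by (simp add: infinite_UNIV_char_0)
  ultimately have "infinite {c. (\<Sum>d\<le>b. ev v (hpart d p) * c ^ d) = 0}" by (meson finite_subset)
  then have "\<forall>d\<le>b. ev v (hpart d p) = 0" using polyfun_finite_roots[of "\<lambda>d. ev v (hpart d p)" b] by auto
  then show ?thesis by (simp add: b_def)
qed

lemma hpart_vanish_all_coords:
  assumes "Z \<subseteq> carrier_vec (Suc n)" "p \<in> vanish n (all_coords Z)"
  shows "hpart j p \<in> vanish n (all_coords Z)"
proof -
  have p: "vars_in {..n} p" using assms(2) by (simp add: vanish_def carrier_Sring)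
  have "ev v (hpart j p) = 0" if "v \<in> all_coords Z" for v
  proof (rule hpart_vanish_cone[OF p])
    obtain c z where c: "c \<noteq> 0" "z \<in> Z" "v = c \<cdot>\<^sub>v z" using \<open>v \<in> all_coords Z\<close> by (auto simp: all_coords_def)
    then show "v \<in> carrier_vec (Suc n)" using assms(1) by auto
    fix s :: complex assume "s \<noteq> 0"
    then have "s \<cdot>\<^sub>v v \<in> all_coords Z" using c
      by (auto simp: all_coords_def smult_smult_assoc intro!: exI[of _ "s * c"])
    then show "ev (s \<cdot>\<^sub>v v) p = 0" using assms(2) by (simp add: vanish_def)
  qed
  then show ?thesis using p by (simp add: vanish_def carrier_Sring)
qed

lemma homog_vanish_all_coords:
  assumes "Z \<subseteq> carrier_vec (Suc n)" "vars_in {..n} p" "homog d p"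
  shows "p \<in> vanish n (all_coords Z) \<longleftrightarrow> (\<forall>z\<in>Z. ev z p = 0)"
proof
  assume "p \<in> vanish n (all_coords Z)"
  moreover have "z \<in> all_coords Z" if "z \<in> Z" for z
    using that by (auto simp: all_coords_def intro!: exI[of _ "1::complex"] exI[of _ z])
  ultimately show "\<forall>z\<in>Z. ev z p = 0" by (simp add: vanish_def)
next
  assume "\<forall>z\<in>Z. ev z p = 0"
  then have "\<forall>v\<in>all_coords Z. ev v p = 0"
    using ev_smult[OF assms(2,3)] assms(1) by (auto simp: all_coords_def)
  then show "p \<in> vanish n (all_coords Z)" using assms(2) by (simp add: vanish_def carrier_Sring)
qed

section \<open>Partial derivatives\<close>

lemma pdiff_superset:
  assumes "finite A" "keys p \<subseteq> A"
  shows "pdiff i p = (\<Sum>m\<in>A. single (m - single i 1) (of_nat (lookup m i) * lookup p m))"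
  unfolding pdiff_def using assms by (intro sum.mono_neutral_left) (auto simp: in_keys_iff)

lemma pdiff_add: "pdiff i (p + q) = pdiff i p + pdiff i q"
proof -
  let ?A = "keys p \<union> keys q"
  have "pdiff i (p + q) = (\<Sum>m\<in>?A. single (m - single i 1) (of_nat (lookup m i) * lookup (p + q) m))"
    by (rule pdiff_superset) (auto simp: keys_add)
  moreover have "pdiff i p = (\<Sum>m\<in>?A. single (m - single i 1) (of_nat (lookup m i) * lookup p m))"
    by (rule pdiff_superset) auto
  moreover have "pdiff i q = (\<Sum>m\<in>?A. single (m - single i 1) (of_nat (lookup m i) * lookup q m))"
    by (rule pdiff_superset) auto
  ultimately show ?thesis by (simp add: lookup_add distrib_left single_add sum.distrib)
qed

lemma pdiff_single: "pdiff i (single m c) = single (m - single i 1) (of_nat (lookup m i) * c)"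
  by (cases "c = 0") (simp_all add: pdiff_def)

lemma pdiff_mult: "pdiff i (p * q) = pdiff i p * q + p * pdiff i q"
proof (induction p rule: poly_induct)
  case (1 m c)
  show ?case
  proof (induction q rule: poly_induct)
    case (1 m' c')
    have a: "single (m + m' - single i 1) (of_nat (lookup m i) * c * c') =
        single (m - single i 1) (of_nat (lookup m i) * c) * single m' c'"
    proof (cases "lookup m i = 0")
      case False
      then have "m + m' - single i 1 = m - single i 1 + m'"
        by (intro poly_mapping_eqI) (auto simp: lookup_add lookup_minus lookup_single when_def)
      then show ?thesis by (simp add: mult_single)
    qed simp
    have b: "single (m + m' - single i 1) (of_nat (lookup m' i) * c * c') =
        single m c * single (m' - single i 1) (of_nat (lookup m' i) * c')"
    proof (cases "lookup m' i = 0")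
      case False
      then have "m + m' - single i 1 = m + (m' - single i 1)"
        by (intro poly_mapping_eqI) (auto simp: lookup_add lookup_minus lookup_single when_def)
      then show ?thesis by (simp add: mult_single mult_ac)
    qed simp
    have "pdiff i (single m c * single m' c') =
        single (m + m' - single i 1) (of_nat (lookup m i) * c * c' + of_nat (lookup m' i) * c * c')"
      by (simp add: mult_single pdiff_single lookup_add algebra_simps)
    then show ?case unfolding single_add a b pdiff_single .
  qed (simp add: pdiff_add distrib_left algebra_simps)
qed (simp add: pdiff_add algebra_simps)

lemma pdiff_const [simp]: "pdiff i (const c) = 0"
  by (simp add: const_def pdiff_single)

lemma pdiff_zero [simp]: "pdiff i 0 = 0"
  by (simp add: pdiff_def)

lemma pdiff_var: "pdiff i (var j) = (if i = j then 1 else 0)"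
  by (simp add: var_def pdiff_single lookup_single when_def)

lemma pdiff_sum: "pdiff i (sum f A) = (\<Sum>j\<in>A. pdiff i (f j))"
  by (induction A rule: infinite_finite_induct) (auto simp: pdiff_add)

lemma vars_in_pdiff [simp]: "vars_in V p \<Longrightarrow> vars_in V (pdiff i p)"
  unfolding pdiff_def
proof (intro vars_in_sum vars_in_single)
  fix m assume "vars_in V p" "m \<in> keys p"
  moreover have "keys (m - single i 1) \<subseteq> keys m"
    by (metis in_keys_iff lookup_minus subsetI zero_diff)
  ultimately show "keys (m - single i 1) \<subseteq> V" by (auto simp: vars_in_def)
qed

lemma homog_pdiff:
  assumes "homog d p"
  shows "homog (d - 1) (pdiff i p)"
  unfolding pdiff_def
proof (rule homog_sum)
  fix m assume m: "m \<in> keys p"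
  show "homog (d - 1) (single (m - single i 1) (of_nat (lookup m i) * lookup p m))"
  proof (cases "lookup m i = 0")
    case False
    then have "m = m - single i 1 + single i 1"
      by (intro poly_mapping_eqI) (auto simp: lookup_add lookup_minus lookup_single when_def)
    then have "tdeg m = tdeg (m - single i 1) + 1" by (metis tdeg_add tdeg_single)
    then show ?thesis using m assms by (intro homog_single) (auto simp: homog_def)
  qed simp
qed

section \<open>Linear forms\<close>

lemma vars_in_linear_form [simp]: "vars_in {..n} (linear_form n p)"
  unfolding linear_form_def by (intro vars_in_sum vars_in_mult vars_in_const vars_in_var)

lemma homog_linear_form [simp]: "homog 1 (linear_form n p)" "homog (Suc 0) (linear_form n p)"
  by (auto simp: linear_form_def intro!: homog_sum)

lemma ev_linear_form: "v \<in> carrier_vec (Suc n) \<Longrightarrow> ev v (linear_form n p) = p \<bullet> v"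
  by (simp add: linear_form_def ev_hom.hom_sum ev_hom.hom_mult ev_hom.hom_add scalar_prod_def
      lessThan_Suc_atMost[symmetric] atLeast0LessThan)

lemma pdiff_linear_form: "pdiff i (linear_form n p) = (if i \<le> n then const (p $ i) else 0)"
proof -
  have "pdiff i (linear_form n p) = (\<Sum>j\<le>n. if j = i then const (p $ j) else 0)"
    unfolding linear_form_def pdiff_sum by (intro sum.cong refl) (simp add: pdiff_mult pdiff_var)
  then show ?thesis by simp
qed

lemma pdiff_arr_poly:
  assumes "finite Z" "p \<in> Z" "i \<le> n"
  shows "pdiff i (arr_poly n Z) =
    const (p $ i) * arr_poly n (Z - {p}) + linear_form n p * pdiff i (arr_poly n (Z - {p}))"
proof -
  have "arr_poly n Z = linear_form n p * arr_poly n (Z - {p})"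
    using assms by (simp add: arr_poly_def prod.remove)
  then show ?thesis using assms by (simp add: pdiff_mult pdiff_linear_form)
qed

text \<open>Two substitutions that agree modulo the ideal \<open>(a, b)\<close> give values that agree modulo
  \<open>(a, b)\<close>.\<close>

lemma subst_cong_mod:
  assumes "vars_in V F" "\<And>i. i \<in> V \<Longrightarrow> vars_in W (x i)" "\<And>i. i \<in> V \<Longrightarrow> vars_in W (y i)"
    and "\<And>i. i \<in> V \<Longrightarrow> \<exists>u v. vars_in W u \<and> vars_in W v \<and> x i - y i = a * u + b * v"
  shows "\<exists>u v. vars_in W u \<and> vars_in W v \<and> peval const x F - peval const y F = a * u + b * v"
  using assms(1)
proof (induction rule: vars_in_induct)
  case (const c)
  then show ?case by (intro exI[of _ 0]) simp
next
  case (var i)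
  then show ?case using assms(4) by simp
next
  case (add p q)
  then obtain u v u' v' where uv: "vars_in W u" "vars_in W v" "vars_in W u'" "vars_in W v'"
    and e: "peval const x p - peval const y p = a * u + b * v" "peval const x q - peval const y q = a * u' + b * v'"
    by blast
  have "peval const x (p + q) - peval const y (p + q) =
      (peval const x p - peval const y p) + (peval const x q - peval const y q)"
    by (simp add: subst_hom.hom_add)
  also have "\<dots> = a * (u + u') + b * (v + v')" unfolding e by (simp add: algebra_simps)
  finally show ?case using uv by (intro exI[of _ "u + u'"] exI[of _ "v + v'"]) simp
next
  case (mult p q)
  then obtain u v u' v' where uv: "vars_in W u" "vars_in W v" "vars_in W u'" "vars_in W v'"
    and e: "peval const x p - peval const y p = a * u + b * v" "peval const x q - peval const y q = a * u' + b * v'"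
    by blast
  let ?q = "peval const x q" and ?p = "peval const y p"
  have w: "vars_in W ?q" "vars_in W ?p" using mult assms by simp_all
  have "peval const x (p * q) - peval const y (p * q) =
      (peval const x p - peval const y p) * ?q + ?p * (peval const x q - peval const y q)"
    by (simp add: subst_hom.hom_mult algebra_simps)
  also have "\<dots> = a * (u * ?q + ?p * u') + b * (v * ?q + ?p * v')" unfolding e by (simp add: algebra_simps)
  finally show ?case using uv w
    by (intro exI[of _ "u * ?q + ?p * u'"] exI[of _ "v * ?q + ?p * v'"]) simp
qed

section \<open>The dual line of a general codimension-two space\<close>

text \<open>The alternating form \<open>det(x; X; \<alpha>)\<close>; the \<open>e\<^sub>\<alpha>(M\<^sub>i)\<close> are its values at the unit vectors \<open>x\<close>.\<close>

definition bracket :: "nat \<Rightarrow> complex vec list \<Rightarrow> complex vec \<Rightarrow> complex vec \<Rightarrow> complex" where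
  "bracket n \<alpha> x X = det (mat_of_rows (Suc n) (x # X # \<alpha>))"

lemma vars_in_det:
  assumes "A \<in> carrier_mat N N" "\<And>i j. i < N \<Longrightarrow> j < N \<Longrightarrow> vars_in V (A $$ (i, j))"
  shows "vars_in V (det A)"
proof -
  have "vars_in V (of_int (sign p))" for p :: "nat \<Rightarrow> nat"
    by (auto simp: sign_def)
  then show ?thesis
    unfolding det_def'[OF assms(1)]
    by (intro vars_in_sum vars_in_mult vars_in_prod assms(2)) (auto dest: permutes_in_image)
qed

locale frame =
  fixes n :: nat and \<alpha> :: "complex vec list"
  assumes n: "n \<ge> 1" and len: "length \<alpha> = n - 1" and carr: "set \<alpha> \<subseteq> carrier_vec (Suc n)"
begin

lemma rows_carrier: "mat_of_rows (Suc n) (x # X # \<alpha>) \<in> carrier_mat (Suc n) (Suc n)"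
  using n len by (intro carrier_matI) auto

lemma nth_carr: "i < n - 1 \<Longrightarrow> \<alpha> ! i \<in> carrier_vec (Suc n)"
  using carr len by (metis nth_mem subsetD)

lemma bracket_linear:
  "bracket n \<alpha> x X = (\<Sum>j<Suc n. x $ j * cofactor (mat_of_rows (Suc n) (0\<^sub>v (Suc n) # X # \<alpha>)) 0 j)"
proof -
  let ?A = "mat_of_rows (Suc n) (x # X # \<alpha>)" and ?B = "mat_of_rows (Suc n) (0\<^sub>v (Suc n) # X # \<alpha>)"
  have "mat_delete ?A 0 j = mat_delete ?B 0 j" for j
    by (rule eq_matI) (auto simp: mat_delete_def mat_of_rows_index)
  then have "cofactor ?A 0 j = cofactor ?B 0 j" for j by (simp add: cofactor_def)
  then show ?thesis
    unfolding bracket_def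
    by (subst laplace_expansion_row[OF rows_carrier, of 0]) (auto intro!: sum.cong simp: mat_of_rows_index)
qed

lemma bracket_swap:
  assumes "x \<in> carrier_vec (Suc n)" "X \<in> carrier_vec (Suc n)"
  shows "bracket n \<alpha> x X = - bracket n \<alpha> X x"
proof -
  have e: "mat_of_rows (Suc n) (x # X # \<alpha>) = swaprows 0 1 (mat_of_rows (Suc n) (X # x # \<alpha>))"
    by (rule eq_matI) (auto simp: mat_of_rows_index less_Suc_eq_0_disj)
  show ?thesis unfolding bracket_def e
    by (rule det_swaprows[OF _ _ _ rows_carrier]) (use n in auto)
qed

lemma bracket_self: "x \<in> carrier_vec (Suc n) \<Longrightarrow> bracket n \<alpha> x x = 0"
  using bracket_swap[of x x] by simp

lemma bracket_nth:
  assumes "i < n - 1"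
  shows "bracket n \<alpha> (\<alpha> ! i) X = 0"
  unfolding bracket_def
proof (rule det_identical_rows[OF rows_carrier, of 0 "Suc (Suc i)"])
  show "row (mat_of_rows (Suc n) (\<alpha> ! i # X # \<alpha>)) 0 =
      row (mat_of_rows (Suc n) (\<alpha> ! i # X # \<alpha>)) (Suc (Suc i))"
    using assms len n nth_carr[OF assms] by (subst (1 2) mat_of_rows_row) auto
qed (use assms n in auto)

text \<open>The coefficient vector of the linear form \<open>x \<mapsto> det(x; X; \<alpha>)\<close>.\<close>

definition bvec :: "complex vec \<Rightarrow> complex vec" where
  "bvec X = vec (Suc n) (\<lambda>i. bracket n \<alpha> (unit_vec (Suc n) i) X)"

lemma bvec_carrier [simp]: "bvec X \<in> carrier_vec (Suc n)"
  by (simp add: bvec_def)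

lemma bracket_unit:
  assumes "i \<le> n"
  shows "bracket n \<alpha> (unit_vec (Suc n) i) X = cofactor (mat_of_rows (Suc n) (0\<^sub>v (Suc n) # X # \<alpha>)) 0 i"
proof -
  have "bracket n \<alpha> (unit_vec (Suc n) i) X =
      (\<Sum>j<Suc n. if j = i then cofactor (mat_of_rows (Suc n) (0\<^sub>v (Suc n) # X # \<alpha>)) 0 j else 0)"
    unfolding bracket_linear by (intro sum.cong refl) (use assms in \<open>auto simp: unit_vec_def\<close>)
  then show ?thesis using assms by (simp del: sum.lessThan_Suc)
qed

lemma bvec_scalar_prod: "x \<in> carrier_vec (Suc n) \<Longrightarrow> bvec X \<bullet> x = bracket n \<alpha> x X"
  unfolding scalar_prod_def bracket_linear
  by (intro sum.cong) (auto simp: bvec_def bracket_unit)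

lemma ev_e_coord:
  assumes "v \<in> carrier_vec (Suc n)" "i \<le> n"
  shows "ev v (e_coord n \<alpha> i) = bracket n \<alpha> (unit_vec (Suc n) i) v"
proof -
  let ?A = "mat_of_rows (Suc n) (unit_vec (Suc n) i # vec (Suc n) var # map (map_vec const) \<alpha>)"
  have "map_mat (ev v) ?A = mat_of_rows (Suc n) (unit_vec (Suc n) i # v # \<alpha>)"
  proof (rule eq_matI, goal_cases)
    case (1 r c)
    then have r: "r < Suc (Suc (length \<alpha>))" and c: "c < Suc n" by auto
    consider "r = 0" | "r = 1" | s where "r = Suc (Suc s)" "s < length \<alpha>"
      using r by (metis One_nat_def less_Suc_eq_0_disj)
    then show ?case
    proof cases
      case 3
      then have "dim_vec (\<alpha> ! s) = Suc n" using nth_carr len by auto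
      then show ?thesis using 3 c by (simp add: mat_of_rows_index)
    qed (use c assms in \<open>auto simp: mat_of_rows_index unit_vec_def\<close>)
  qed auto
  then show ?thesis unfolding e_coord_def bracket_def by (metis ev_hom.hom_det)
qed

lemma vars_in_e_coord:
  assumes "i \<le> n"
  shows "vars_in {..n} (e_coord n \<alpha> i)"
  unfolding e_coord_def
proof (rule vars_in_det)
  show "mat_of_rows (Suc n) (unit_vec (Suc n) i # vec (Suc n) var # map (map_vec const) \<alpha>) \<in>
      carrier_mat (Suc n) (Suc n)"
    using n len by (intro carrier_matI) auto
  fix r c assume "r < Suc n" and c: "c < Suc n"
  then have r: "r < Suc (Suc (length \<alpha>))" using len n by auto
  then consider "r = 0" | "r = 1" | s where "r = Suc (Suc s)" "s < length \<alpha>"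
    by (metis One_nat_def less_Suc_eq_0_disj)
  then show "vars_in {..n} (mat_of_rows (Suc n) (unit_vec (Suc n) i # vec (Suc n) var # map (map_vec const) \<alpha>) $$ (r, c))"
  proof cases
    case 3
    then have "dim_vec (\<alpha> ! s) = Suc n" using nth_carr len by auto
    then show ?thesis using 3 c by (simp add: mat_of_rows_index)
  qed (use c assms in \<open>auto simp: mat_of_rows_index unit_vec_def\<close>)
qed

end

lemma scalar_prod_mat_of_cols:
  fixes w :: "complex vec"
  assumes "set vs \<subseteq> carrier_vec N" "w \<in> carrier_vec N" "c \<in> carrier_vec (length vs)"
    and "\<And>v. v \<in> set vs \<Longrightarrow> w \<bullet> v = 0"
  shows "w \<bullet> (mat_of_cols N vs *\<^sub>v c) = 0"
proof -
  have "(mat_of_cols N vs)\<^sup>T *\<^sub>v w = 0\<^sub>v (length vs)"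
  proof (rule eq_vecI)
    fix i assume "i < dim_vec (0\<^sub>v (length vs) :: complex vec)"
    then have i: "i < length vs" by simp
    then have "vs ! i \<in> carrier_vec N" using assms(1) by (metis nth_mem subsetD)
    then have "((mat_of_cols N vs)\<^sup>T *\<^sub>v w) $ i = vs ! i \<bullet> w" using i by simp
    also have "\<dots> = w \<bullet> vs ! i" using \<open>vs ! i \<in> _\<close> assms(2) by (metis comm_scalar_prod)
    also have "\<dots> = 0" using assms(4) i by simp
    finally show "((mat_of_cols N vs)\<^sup>T *\<^sub>v w) $ i = 0\<^sub>v (length vs) $ i" using i by simp
  qed simp
  then show ?thesis
    using transpose_vec_mult_scalar[of "mat_of_cols N vs" N "length vs" c w] assms by simp
qed

text \<open>When \<open>det(e\<^sub>0; e\<^sub>1; \<alpha>)\<close> is nonzero, the annihilator of \<open>H\<close> has a basis \<open>a, b\<close> that is dual to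
  \<open>e\<^sub>0, e\<^sub>1\<close>. The bracket vanishes on \<open>H\<close> in both arguments and is alternating, so it is a
  multiple of \<open>a \<and> b\<close>; its coefficients are the \<open>e\<^sub>\<alpha>(M\<^sub>i)\<close>.\<close>

locale line =
  fixes n :: nat and \<alpha> :: "complex vec list" and a b :: "complex vec" and D :: complex
  assumes n2: "n \<ge> 2"
    and a_carrier [simp]: "a \<in> carrier_vec (Suc n)" and b_carrier [simp]: "b \<in> carrier_vec (Suc n)"
    and ab_unit [simp]: "a $ 0 = 1" "a $ Suc 0 = 0" "b $ 0 = 0" "b $ Suc 0 = 1"
    and D [simp]: "D \<noteq> 0"
    and e_coord: "i \<le> n \<Longrightarrow> e_coord n \<alpha> i =
      const D * (const (a $ i) * linear_form n b - const (b $ i) * linear_form n a)"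
    and H_pts: "H_pts n \<alpha> = {x \<in> points n. a \<bullet> x = 0 \<and> b \<bullet> x = 0}"
    and L_pts: "L_pts n \<alpha> = {y \<in> points n. \<exists>s t. y = s \<cdot>\<^sub>v a + t \<cdot>\<^sub>v b}"

context frame
begin

text \<open>The vectors \<open>a, b\<close> are the multiples of \<open>det(-; e\<^sub>1; \<alpha>)\<close> and \<open>det(-; e\<^sub>0; \<alpha>)\<close> normalized at
  \<open>e\<^sub>0, e\<^sub>1\<close>. Every \<open>x\<close> is \<open>(a \<bullet> x) e\<^sub>0 + (b \<bullet> x) e\<^sub>1\<close> plus an element of the span of \<open>\<alpha>\<close>; linear
  forms vanishing on \<open>\<alpha>\<close>, and the bracket in each argument, are therefore determined by
  \<open>a \<bullet> x\<close> and \<open>b \<bullet> x\<close>.\<close>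

lemma lineI:
  assumes n2: "n \<ge> 2"
    and "D = bracket n \<alpha> (unit_vec (Suc n) 0) (unit_vec (Suc n) 1)" "D \<noteq> 0"
  obtains a b where "line n \<alpha> a b D"
    and "\<And>x y. x \<in> carrier_vec (Suc n) \<Longrightarrow> y \<in> carrier_vec (Suc n) \<Longrightarrow>
      bracket n \<alpha> x y = D * ((a \<bullet> x) * (b \<bullet> y) - (b \<bullet> x) * (a \<bullet> y))"
proof -
  interpret V: vec_space "TYPE(complex)" "Suc n" .
  let ?e0 = "unit_vec (Suc n) 0 :: complex vec" and ?e1 = "unit_vec (Suc n) 1 :: complex vec"
  let ?C = "mat_of_cols (Suc n) \<alpha>"
  define a where "a = (1 / D) \<cdot>\<^sub>v bvec ?e1"
  define b where "b = (- 1 / D) \<cdot>\<^sub>v bvec ?e0"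
  have ab: "a \<in> carrier_vec (Suc n)" "b \<in> carrier_vec (Suc n)" by (simp_all add: a_def b_def)
  have e01: "?e0 \<in> carrier_vec (Suc n)" "?e1 \<in> carrier_vec (Suc n)" by simp_all
  have v: "bvec ?e1 $ 0 = D" "bvec ?e1 $ 1 = 0" "bvec ?e0 $ 0 = 0" "bvec ?e0 $ 1 = - D"
  proof -
    have i: "bvec X $ 0 = bracket n \<alpha> ?e0 X" "bvec X $ 1 = bracket n \<alpha> ?e1 X" for X
      using n by (simp_all add: bvec_def)
    show "bvec ?e1 $ 0 = D" unfolding i by (rule assms(2)[symmetric])
    show "bvec ?e1 $ 1 = 0" unfolding i by (rule bracket_self[OF e01(2)])
    show "bvec ?e0 $ 0 = 0" unfolding i by (rule bracket_self[OF e01(1)])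
    show "bvec ?e0 $ 1 = - D" unfolding i assms(2) by (rule bracket_swap[OF e01(2,1)])
  qed
  have bd: "dim_vec (bvec X) = Suc n" for X by (simp add: bvec_def)
  have sm: "(c \<cdot>\<^sub>v bvec X) $ i = c * bvec X $ i" if "i \<le> n" for c X i
    by (rule index_smult_vec) (use that in \<open>simp add: bd\<close>)
  have u: "a $ 0 = 1" "a $ Suc 0 = 0" "b $ 0 = 0" "b $ Suc 0 = 1"
    using sm[OF le0] sm[OF n] v assms(3) by (simp_all only: a_def b_def One_nat_def) auto
  have ad: "a \<bullet> x = bracket n \<alpha> x ?e1 / D" "b \<bullet> x = - bracket n \<alpha> x ?e0 / D"
    if "x \<in> carrier_vec (Suc n)" for x
    using that by (simp_all add: a_def b_def bvec_scalar_prod)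
  have perp: "a \<bullet> v = 0" "b \<bullet> v = 0" if "v \<in> set \<alpha>" for v
  proof -
    obtain i where "i < n - 1" "v = \<alpha> ! i" using \<open>v \<in> set \<alpha>\<close> len by (metis in_set_conv_nth)
    moreover have "v \<in> carrier_vec (Suc n)" using that carr by blast
    ultimately show "a \<bullet> v = 0" "b \<bullet> v = 0" using bracket_nth[of i ?e0] bracket_nth[of i ?e1] ad[of v] by simp_all
  qed
  have spanC: "V.span (set \<alpha>) = {?C *\<^sub>v vec (length \<alpha>) c | c. True}"
  proof -
    have "V.span (set \<alpha>) = V.span_list \<alpha>" by (rule V.span_list_as_span[OF carr, symmetric])
    moreover have "V.lincomb_list c \<alpha> = ?C *\<^sub>v vec (length \<alpha>) c" for c
      by (rule V.lincomb_list_as_mat_mult) (use carr in auto)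
    ultimately show ?thesis by (auto simp: V.span_list_def)
  qed
  have dec: "\<exists>c0 c1 c. x = c0 \<cdot>\<^sub>v ?e0 + (c1 \<cdot>\<^sub>v ?e1 + ?C *\<^sub>v vec (length \<alpha>) c)"
    if x: "x \<in> carrier_vec (Suc n)" for x
  proof -
    let ?A = "mat_of_rows (Suc n) (?e0 # ?e1 # \<alpha>)" and ?B = "mat_of_cols (Suc n) (?e0 # ?e1 # \<alpha>)"
    have B: "?B \<in> carrier_mat (Suc n) (Suc n)" using n len by (intro carrier_matI) auto
    have "?B = transpose_mat ?A" by (simp add: transpose_mat_of_rows)
    then have "det ?B \<noteq> 0" using det_transpose[OF rows_carrier] assms by (simp add: bracket_def)
    then have "?B \<in> Units (ring_mat TYPE(complex) (Suc n) ())" by (rule det_non_zero_imp_unit[OF B])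
    then obtain B' where B': "B' \<in> carrier_mat (Suc n) (Suc n)" "?B * B' = 1\<^sub>m (Suc n)"
      unfolding Units_def ring_mat_def by auto
    define c where "c = B' *\<^sub>v x"
    have c: "c \<in> carrier_vec (Suc n)" using B' x by (simp add: c_def)
    have "x = 1\<^sub>m (Suc n) *\<^sub>v x" using x by simp
    also have "\<dots> = ?B *\<^sub>v c" unfolding c_def using assoc_mult_mat_vec[OF B B'(1) x] B'(2) by simp
    also have "c = vec (length (?e0 # ?e1 # \<alpha>)) (\<lambda>i. c $ i)" using c n len by (intro eq_vecI) auto
    also have "?B *\<^sub>v \<dots> = V.lincomb_list (\<lambda>i. c $ i) (?e0 # ?e1 # \<alpha>)"
      by (rule V.lincomb_list_as_mat_mult[symmetric]) (use carr in auto)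
    also have "\<dots> = c $ 0 \<cdot>\<^sub>v ?e0 + (c $ Suc 0 \<cdot>\<^sub>v ?e1 + V.lincomb_list ((\<lambda>i. c $ i) \<circ> Suc \<circ> Suc) \<alpha>)"
      by (simp add: module_vec_simps o_assoc)
    also have "V.lincomb_list ((\<lambda>i. c $ i) \<circ> Suc \<circ> Suc) \<alpha> = ?C *\<^sub>v vec (length \<alpha>) ((\<lambda>i. c $ i) \<circ> Suc \<circ> Suc)"
      by (rule V.lincomb_list_as_mat_mult) (use carr in auto)
    finally show ?thesis by blast
  qed
  have C0: "w \<bullet> (?C *\<^sub>v vec (length \<alpha>) c) = 0"
    if "w \<in> carrier_vec (Suc n)" "\<And>v. v \<in> set \<alpha> \<Longrightarrow> w \<bullet> v = 0" for w :: "complex vec" and c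
    using that carr by (intro scalar_prod_mat_of_cols) auto
  have val: "w \<bullet> (c0 \<cdot>\<^sub>v ?e0 + (c1 \<cdot>\<^sub>v ?e1 + ?C *\<^sub>v vec (length \<alpha>) c)) = c0 * w $ 0 + c1 * w $ Suc 0"
    if w: "w \<in> carrier_vec (Suc n)" "\<And>v. v \<in> set \<alpha> \<Longrightarrow> w \<bullet> v = 0" for w c0 c1 c
  proof -
    have k: "?C *\<^sub>v vec (length \<alpha>) c \<in> carrier_vec (Suc n)" by (metis carrier_matI mat_of_cols_carrier(1) mult_mat_vec_carrier vec_carrier)
    show ?thesis using w k n
      by (simp add: scalar_prod_add_distrib[of _ "Suc n"] C0)
  qed
  have main: "\<exists>z \<in> V.span (set \<alpha>). x = (a \<bullet> x) \<cdot>\<^sub>v ?e0 + ((b \<bullet> x) \<cdot>\<^sub>v ?e1 + z)"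
    and dot: "\<And>w. w \<in> carrier_vec (Suc n) \<Longrightarrow> (\<And>v. v \<in> set \<alpha> \<Longrightarrow> w \<bullet> v = 0) \<Longrightarrow>
      w \<bullet> x = (a \<bullet> x) * w $ 0 + (b \<bullet> x) * w $ Suc 0"
    if x: "x \<in> carrier_vec (Suc n)" for x
  proof -
    obtain c0 c1 c where xe: "x = c0 \<cdot>\<^sub>v ?e0 + (c1 \<cdot>\<^sub>v ?e1 + ?C *\<^sub>v vec (length \<alpha>) c)" using dec[OF x] by blast
    have c01: "a \<bullet> x = c0" "b \<bullet> x = c1" using val[OF ab(1) perp(1)] val[OF ab(2) perp(2)] by (auto simp: xe u)
    show "\<exists>z \<in> V.span (set \<alpha>). x = (a \<bullet> x) \<cdot>\<^sub>v ?e0 + ((b \<bullet> x) \<cdot>\<^sub>v ?e1 + z)"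
      unfolding c01 spanC using xe by blast
    show "w \<bullet> x = (a \<bullet> x) * w $ 0 + (b \<bullet> x) * w $ Suc 0"
      if "w \<in> carrier_vec (Suc n)" "\<And>v. v \<in> set \<alpha> \<Longrightarrow> w \<bullet> v = 0" for w
      unfolding c01 using val[OF that, of c0 c1 c] by (simp add: xe)
  qed
  have br: "bracket n \<alpha> x y = D * ((a \<bullet> x) * (b \<bullet> y) - (b \<bullet> x) * (a \<bullet> y))"
    if x: "x \<in> carrier_vec (Suc n)" and y: "y \<in> carrier_vec (Suc n)" for x y
  proof -
    have "bracket n \<alpha> x y = bvec y \<bullet> x" using x by (simp add: bvec_scalar_prod)
    also have "\<dots> = (a \<bullet> x) * bvec y $ 0 + (b \<bullet> x) * bvec y $ Suc 0"
    proof (rule dot[OF x])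
      fix v assume "v \<in> set \<alpha>"
      then obtain i where "i < n - 1" "v = \<alpha> ! i" using len by (metis in_set_conv_nth)
      then show "bvec y \<bullet> v = 0" using nth_carr bracket_nth by (simp add: bvec_scalar_prod)
    qed simp
    also have "bvec y $ 0 = D * (b \<bullet> y)"
      using y assms bracket_swap[of ?e0 y] by (simp add: bvec_def ad)
    also have "bvec y $ Suc 0 = - D * (a \<bullet> y)"
      using y n assms bracket_swap[of ?e1 y] by (simp add: bvec_def ad)
    finally show ?thesis by (simp add: algebra_simps)
  qed
  have "line n \<alpha> a b D"
  proof
    fix i assume i: "i \<le> n"
    have "e_coord n \<alpha> i - const D * (const (a $ i) * linear_form n b - const (b $ i) * linear_form n a) = 0"
    proof (rule Sring_eq_zeroI[of _ n])
      fix v :: "complex vec" assume v: "v \<in> carrier_vec (Suc n)"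
      show "ev v (e_coord n \<alpha> i - const D * (const (a $ i) * linear_form n b - const (b $ i) * linear_form n a)) = 0"
        using v i ab by (simp add: ev_hom.hom_minus ev_hom.hom_mult ev_e_coord br ev_linear_form)
    qed (use vars_in_e_coord[OF i] in \<open>simp add: carrier_Sring\<close>)
    then show "e_coord n \<alpha> i = const D * (const (a $ i) * linear_form n b - const (b $ i) * linear_form n a)" by simp
  next
    have sp: "x \<in> V.span (set \<alpha>) \<longleftrightarrow> x \<in> carrier_vec (Suc n) \<and> a \<bullet> x = 0 \<and> b \<bullet> x = 0" for x
    proof
      assume "x \<in> V.span (set \<alpha>)"
      then obtain c where "x = ?C *\<^sub>v vec (length \<alpha>) c" using spanC by blast
      then show "x \<in> carrier_vec (Suc n) \<and> a \<bullet> x = 0 \<and> b \<bullet> x = 0"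
        using C0[OF ab(1) perp(1)] C0[OF ab(2) perp(2)] 
        by (metis carrier_matI mat_of_cols_carrier(1) mult_mat_vec_carrier vec_carrier)
    next
      assume x: "x \<in> carrier_vec (Suc n) \<and> a \<bullet> x = 0 \<and> b \<bullet> x = 0"
      then obtain z where z: "z \<in> V.span (set \<alpha>)" and e: "x = 0 \<cdot>\<^sub>v ?e0 + (0 \<cdot>\<^sub>v ?e1 + z)" using main by metis
      then have "z \<in> carrier_vec (Suc n)" using V.span_closed[OF carr] by auto
      then have "0 \<cdot>\<^sub>v ?e0 + (0 \<cdot>\<^sub>v ?e1 + z) = z" by (intro eq_vecI) auto
      then have "x = z" using e by simp
      then show "x \<in> V.span (set \<alpha>)" using z by simp
    qed
    show H: "H_pts n \<alpha> = {x \<in> points n. a \<bullet> x = 0 \<and> b \<bullet> x = 0}"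
      unfolding H_pts_def points_def using sp by auto
    show "L_pts n \<alpha> = {y \<in> points n. \<exists>s t. y = s \<cdot>\<^sub>v a + t \<cdot>\<^sub>v b}"
    proof (intro equalityI subsetI)
      fix y assume "y \<in> L_pts n \<alpha>"
      then have y: "y \<in> points n" "y \<in> carrier_vec (Suc n)" and p: "\<And>x. x \<in> H_pts n \<alpha> \<Longrightarrow> y \<bullet> x = 0"
        by (auto simp: L_pts_def dual_def points_def)
      have py: "y \<bullet> v = 0" if "v \<in> set \<alpha>" for v
      proof (cases "v = 0\<^sub>v (Suc n)")
        case False
        then have "v \<in> H_pts n \<alpha>" unfolding H using that perp carr by (auto simp: points_def)
        then show ?thesis by (rule p)
      qed (use y in simp)
      have "y = (y $ 0) \<cdot>\<^sub>v a + (y $ Suc 0) \<cdot>\<^sub>v b"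
      proof (rule eq_vecI)
        fix i assume "i < dim_vec ((y $ 0) \<cdot>\<^sub>v a + (y $ Suc 0) \<cdot>\<^sub>v b)"
        then have i: "i < Suc n" using ab by auto
        then have "y $ i = y \<bullet> unit_vec (Suc n) i" using y by simp
        also have "\<dots> = (a \<bullet> unit_vec (Suc n) i) * y $ 0 + (b \<bullet> unit_vec (Suc n) i) * y $ Suc 0"
          by (rule dot) (use y py in auto)
        finally show "y $ i = ((y $ 0) \<cdot>\<^sub>v a + (y $ Suc 0) \<cdot>\<^sub>v b) $ i" using i ab by simp
      qed (use ab y in auto)
      then show "y \<in> {y \<in> points n. \<exists>s t. y = s \<cdot>\<^sub>v a + t \<cdot>\<^sub>v b}" using y by blast
    next
      fix y assume y: "y \<in> {y \<in> points n. \<exists>s t. y = s \<cdot>\<^sub>v a + t \<cdot>\<^sub>v b}"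
      have "y \<bullet> x = 0" if "x \<in> H_pts n \<alpha>" for x
        using that y ab unfolding H by (auto simp: points_def add_scalar_prod_distrib[of _ "Suc n"])
      then show "y \<in> L_pts n \<alpha>" using y by (auto simp: L_pts_def dual_def)
    qed
  qed (use n2 ab u assms in auto)
  then show thesis using br that by blast
qed

end

section \<open>General position\<close>

text \<open>Take for \<open>\<alpha>\<close> the unit vectors other than \<open>e\<^sub>i, e\<^sub>j\<close>. A vector orthogonal to all rows is then
  supported on \<open>{i, j}\<close>, where the minor of \<open>u, v\<close> forces it to vanish.\<close>

lemma bracket_nonzero_exists:
  assumes n: "n \<ge> 1" and ij: "i \<le> n" "j \<le> n" and minor: "u $ i * v $ j - u $ j * v $ i \<noteq> 0"
    and u: "u \<in> carrier_vec (Suc n)" and v: "v \<in> carrier_vec (Suc n)"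
  obtains \<alpha> where "length \<alpha> = n - 1" "set \<alpha> \<subseteq> carrier_vec (Suc n)" "bracket n \<alpha> u v \<noteq> 0"
proof -
  have neq: "i \<noteq> j" using minor by auto
  define ls where "ls = filter (\<lambda>l. l \<noteq> i \<and> l \<noteq> j) [0..<Suc n]"
  define \<alpha> where "\<alpha> = map (unit_vec (Suc n) :: nat \<Rightarrow> complex vec) ls"
  have "set ls = {..<Suc n} - {i, j}" by (auto simp: ls_def)
  moreover have "card ({..<Suc n} - {i, j}) = n - 1" using neq ij by (subst card_Diff_subset) auto
  moreover have "distinct ls" by (simp add: ls_def)
  ultimately have len: "length \<alpha> = n - 1" by (metis \<alpha>_def distinct_card length_map)
  have carr: "set \<alpha> \<subseteq> carrier_vec (Suc n)" by (auto simp: \<alpha>_def)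
  interpret frame n \<alpha> using n len carr by unfold_locales
  have "bracket n \<alpha> u v \<noteq> 0"
  proof
    let ?A = "mat_of_rows (Suc n) (u # v # \<alpha>)"
    assume "bracket n \<alpha> u v = 0"
    then obtain x where x: "x \<in> carrier_vec (Suc n)" "x \<noteq> 0\<^sub>v (Suc n)" and Ax: "?A *\<^sub>v x = 0\<^sub>v (Suc n)"
      unfolding bracket_def using det_0_iff_vec_prod_zero[OF rows_carrier] by blast
    have r: "(u # v # \<alpha>) ! r \<bullet> x = 0" if "r < Suc n" for r
    proof -
      have d: "r < length (u # v # \<alpha>)" using that len n by auto
      have "(u # v # \<alpha>) ! r \<in> carrier_vec (Suc n)" using d u v carr by (metis insert_subset list.simps(15) nth_mem subsetD)
      then have "row ?A r = (u # v # \<alpha>) ! r" using d by (intro mat_of_rows_row)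
      moreover have "(?A *\<^sub>v x) $ r = row ?A r \<bullet> x" using d by simp
      ultimately show ?thesis using Ax that by simp
    qed
    have x0: "x $ l = 0" if "l \<le> n" "l \<noteq> i" "l \<noteq> j" for l
    proof -
      have "l \<in> set ls" using that by (auto simp: ls_def)
      then obtain s where s: "s < length ls" "ls ! s = l" by (auto simp: in_set_conv_nth)
      then have "Suc (Suc s) < Suc n" using len n by (simp add: \<alpha>_def)
      from r[OF this] s x that show ?thesis by (simp add: \<alpha>_def)
    qed
    have two: "w \<bullet> x = w $ i * x $ i + w $ j * x $ j" if "w \<in> carrier_vec (Suc n)" for w
    proof -
      have "w \<bullet> x = (\<Sum>l\<in>{0..<Suc n}. w $ l * x $ l)" using x by (simp add: scalar_prod_def)
      also have "\<dots> = (\<Sum>l\<in>{i, j}. w $ l * x $ l)"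
        by (rule sum.mono_neutral_right) (use ij x0 in auto)
      finally show ?thesis using neq by simp
    qed
    have "u \<bullet> x = 0" "v \<bullet> x = 0" using r[of 0] r[of 1] n by auto
    then have e: "u $ i * x $ i + u $ j * x $ j = 0" "v $ i * x $ i + v $ j * x $ j = 0"
      using two u v by auto
    have "(u $ i * v $ j - u $ j * v $ i) * x $ i =
        v $ j * (u $ i * x $ i + u $ j * x $ j) - u $ j * (v $ i * x $ i + v $ j * x $ j)"
      by (simp add: algebra_simps)
    then have xi: "x $ i = 0" using e minor by simp
    have "(u $ i * v $ j - u $ j * v $ i) * x $ j =
        u $ i * (v $ i * x $ i + v $ j * x $ j) - v $ i * (u $ i * x $ i + u $ j * x $ j)"
      by (simp add: algebra_simps)
    then have xj: "x $ j = 0" using e minor by simp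
    have "x = 0\<^sub>v (Suc n)" using x x0 xi xj by (intro eq_vecI) (auto, metis less_Suc_eq_le)
    with x show False by simp
  qed
  then show thesis using that len carr by blast
qed

text \<open>The bracket as a polynomial in the entries of \<open>\<alpha>\<close>; the variable \<open>(i, j)\<close> is entry \<open>j\<close> of the
  \<open>i\<close>-th vector.\<close>

definition generic_bracket :: "nat \<Rightarrow> complex vec \<Rightarrow> complex vec \<Rightarrow> (nat \<times> nat) cpoly" where
  "generic_bracket n u v = det (mat_of_rows (Suc n)
     (map_vec const u # map_vec const v # map (\<lambda>i. vec (Suc n) (\<lambda>j. var (i, j))) [0..<n - 1]))"

lemma peval_generic_bracket:
  assumes "u \<in> carrier_vec (Suc n)" "v \<in> carrier_vec (Suc n)"
    and "length \<alpha> = n - 1"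
  shows "peval id (\<lambda>(i, j). \<alpha> ! i $ j) (generic_bracket n u v) = bracket n \<alpha> u v"
proof -
  let ?ev = "peval id (\<lambda>(i, j). \<alpha> ! i $ j)"
  let ?A = "mat_of_rows (Suc n)
     (map_vec const u # map_vec const v # map (\<lambda>i. vec (Suc n) (\<lambda>j. var (i, j))) [0..<n - 1])"
  have "map_mat ?ev ?A = mat_of_rows (Suc n) (u # v # \<alpha>)"
  proof (rule eq_matI, goal_cases)
    case (1 r c)
    then have r: "r < Suc (Suc (length \<alpha>))" and c: "c < Suc n" by auto
    consider "r = 0" | "r = 1" | s where "r = Suc (Suc s)" "s < length \<alpha>"
      using r by (metis One_nat_def less_Suc_eq_0_disj)
    then show ?case
      by cases (use c assms in \<open>auto simp: mat_of_rows_index simp del: id_apply\<close>)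
  qed (use assms in auto)
  then show ?thesis unfolding generic_bracket_def bracket_def by (metis peval_id_hom.hom_det)
qed

lemma vars_in_generic_bracket:
  assumes "n \<ge> 1" "u \<in> carrier_vec (Suc n)" "v \<in> carrier_vec (Suc n)"
  shows "vars_in ({..<n - 1} \<times> {..n}) (generic_bracket n u v)"
  unfolding generic_bracket_def
proof (rule vars_in_det)
  show "mat_of_rows (Suc n) (map_vec const u # map_vec const v # map (\<lambda>i. vec (Suc n) (\<lambda>j. var (i, j))) [0..<n - 1])
      \<in> carrier_mat (Suc n) (Suc n)" using assms by (intro carrier_matI) auto
  fix r c assume "r < Suc n" and c: "c < Suc n"
  then have r: "r < Suc (Suc (n - 1))" by auto
  then consider "r = 0" | "r = 1" | s where "r = Suc (Suc s)" "s < n - 1"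
    by (metis One_nat_def less_Suc_eq_0_disj)
  then show "vars_in ({..<n - 1} \<times> {..n}) (mat_of_rows (Suc n) (map_vec const u # map_vec const v #
      map (\<lambda>i. vec (Suc n) (\<lambda>j. var (i, j))) [0..<n - 1]) $$ (r, c))"
    by cases (use c assms in \<open>auto simp: mat_of_rows_index\<close>)
qed

text \<open>Finitely many brackets of independent pairs are simultaneously nonzero on a nonempty open set:
  the product of the corresponding polynomials is nonzero, because polynomials form a domain.\<close>

lemma for_general_tuple_brackets:
  assumes n: "n \<ge> 1" and PQ: "finite PQ"
    and minors: "\<And>u v. (u, v) \<in> PQ \<Longrightarrow> u \<in> carrier_vec (Suc n) \<and> v \<in> carrier_vec (Suc n) \<and>
      (\<exists>i\<le>n. \<exists>j\<le>n. u $ i * v $ j - u $ j * v $ i \<noteq> 0)"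
    and Q: "\<And>\<alpha>. length \<alpha> = n - 1 \<Longrightarrow> set \<alpha> \<subseteq> carrier_vec (Suc n) \<Longrightarrow>
      (\<And>u v. (u, v) \<in> PQ \<Longrightarrow> bracket n \<alpha> u v \<noteq> 0) \<Longrightarrow> Q \<alpha>"
  shows "for_general_tuple n (n - 1) Q"
  unfolding for_general_tuple_def
proof (intro exI[of _ "\<Prod>(u, v)\<in>PQ. generic_bracket n u v"] conjI allI impI)
  have "generic_bracket n u v \<noteq> 0" if uv: "(u, v) \<in> PQ" for u v
  proof
    assume z: "generic_bracket n u v = 0"
    obtain i j where "i \<le> n" "j \<le> n" "u $ i * v $ j - u $ j * v $ i \<noteq> 0" using minors[OF uv] by blast
    then obtain \<alpha> where "length \<alpha> = n - 1" "bracket n \<alpha> u v \<noteq> 0"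
      using bracket_nonzero_exists[OF n] minors[OF uv] by metis
    then show False using peval_generic_bracket[of u n v \<alpha>] minors[OF uv] z by simp
  qed
  then show "(\<Prod>(u, v)\<in>PQ. generic_bracket n u v) \<noteq> 0" using PQ by (auto simp: prod_zero_iff)
  have "vars_in ({..<n - 1} \<times> {..n}) (\<Prod>(u, v)\<in>PQ. generic_bracket n u v)"
    by (intro vars_in_prod) (use minors vars_in_generic_bracket[OF n] in auto)
  then show "\<forall>t\<in>keys (\<Prod>(u, v)\<in>PQ. generic_bracket n u v). keys t \<subseteq> {..<n - 1} \<times> {..n}"
    by (simp add: vars_in_def)
next
  fix \<alpha> assume \<alpha>: "length \<alpha> = n - 1 \<and> set \<alpha> \<subseteq> carrier_vec (Suc n) \<and>
      peval id (\<lambda>(i, j). \<alpha> ! i $ j) (\<Prod>(u, v)\<in>PQ. generic_bracket n u v) \<noteq> 0"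
  then have "(\<Prod>(u, v)\<in>PQ. peval id (\<lambda>(i, j). \<alpha> ! i $ j) (generic_bracket n u v)) \<noteq> 0"
    unfolding peval_id_hom.hom_prod by (simp add: case_prod_unfold)
  then have "peval id (\<lambda>(i, j). \<alpha> ! i $ j) (generic_bracket n u v) \<noteq> 0" if "(u, v) \<in> PQ" for u v
    using that PQ by (auto simp: prod_zero_iff)
  then show "Q \<alpha>" using \<alpha> Q peval_generic_bracket minors by metis
qed

lemma distinct_points_minor:
  assumes "distinct_points n Z" "p \<in> Z" "q \<in> Z" "p \<noteq> q"
  shows "\<exists>i\<le>n. \<exists>j\<le>n. p $ i * q $ j - p $ j * q $ i \<noteq> 0"
proof (rule ccontr)
  assume *: "\<not> ?thesis"
  have pq: "p \<in> carrier_vec (Suc n)" "q \<in> carrier_vec (Suc n)" "q \<noteq> 0\<^sub>v (Suc n)"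
    using assms by (auto simp: distinct_points_def points_def)
  then obtain j where j: "j \<le> n" "q $ j \<noteq> 0"
    by (metis carrier_vecD eq_vecI index_zero_vec less_Suc_eq_le)
  have "p = (p $ j / q $ j) \<cdot>\<^sub>v q"
  proof (rule eq_vecI)
    fix i assume "i < dim_vec ((p $ j / q $ j) \<cdot>\<^sub>v q)"
    then have i: "i \<le> n" using pq by auto
    then have "p $ i * q $ j = p $ j * q $ i" using * j by auto
    then show "p $ i = ((p $ j / q $ j) \<cdot>\<^sub>v q) $ i" using i j pq by (simp add: field_simps)
  qed (use pq in auto)
  then show False using assms by (auto simp: distinct_points_def)
qed

text \<open>The two conditions of general position: \<open>H\<close> misses \<open>Z\<close>, and \<open>H\<close> misses the lines joining two
  points of \<open>Z\<close>. Dually, \<open>L\<close> lies on no hyperplane of the arrangement and meets no two of them in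
  the same point.\<close>

locale general_line = line +
  fixes k :: nat and Z :: "complex vec set"
  assumes k: "k \<ge> 1" and Z: "distinct_points n Z"
    and off_H: "p \<in> Z \<Longrightarrow> a \<bullet> p \<noteq> 0 \<or> b \<bullet> p \<noteq> 0"
    and separated: "p \<in> Z \<Longrightarrow> q \<in> Z \<Longrightarrow> p \<noteq> q \<Longrightarrow> (a \<bullet> p) * (b \<bullet> q) - (b \<bullet> p) * (a \<bullet> q) \<noteq> 0"

text \<open>The brackets needed are those of \<open>e\<^sub>0, e\<^sub>1\<close> (for the coordinates on \<open>L\<close>), of two points of \<open>Z\<close>
  (for \<open>separated\<close>), and of a point of \<open>Z\<close> with some unit vector (for \<open>off_H\<close>).\<close>

lemma for_general_line:
  assumes n2: "n \<ge> 2" and k: "k \<ge> 1" and Z: "distinct_points n Z"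
    and Q: "\<And>\<alpha> a b D. general_line n \<alpha> a b D k Z \<Longrightarrow> Q \<alpha>"
  shows "for_general_tuple n (n - 1) Q"
proof (rule for_general_tuple_brackets)
  let ?E = "unit_vec (Suc n) ` {..n} :: complex vec set"
  let ?PQ = "{(u, v) \<in> (Z \<union> ?E) \<times> (Z \<union> ?E). \<exists>i\<le>n. \<exists>j\<le>n. u $ i * v $ j - u $ j * v $ i \<noteq> 0}"
  have Zc: "finite Z" "Z \<subseteq> carrier_vec (Suc n)" "\<And>z. z \<in> Z \<Longrightarrow> z \<noteq> 0\<^sub>v (Suc n)"
    using Z by (auto simp: distinct_points_def points_def)
  show "finite ?PQ"
    by (rule finite_subset[of _ "(Z \<union> ?E) \<times> (Z \<union> ?E)"]) (use Zc in auto)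
  show "n \<ge> 1" using n2 by simp
  show "u \<in> carrier_vec (Suc n) \<and> v \<in> carrier_vec (Suc n) \<and>
      (\<exists>i\<le>n. \<exists>j\<le>n. u $ i * v $ j - u $ j * v $ i \<noteq> 0)" if "(u, v) \<in> ?PQ" for u v
    using that Zc by auto
  fix \<alpha> assume \<alpha>: "length \<alpha> = n - 1" "set \<alpha> \<subseteq> carrier_vec (Suc n)"
    and br: "\<And>u v. (u, v) \<in> ?PQ \<Longrightarrow> bracket n \<alpha> u v \<noteq> 0"
  interpret frame n \<alpha> using n2 \<alpha> by unfold_locales auto
  define D where "D = bracket n \<alpha> (unit_vec (Suc n) 0) (unit_vec (Suc n) 1)"
  have "(unit_vec (Suc n) 0 :: complex vec) $ 0 * unit_vec (Suc n) 1 $ 1 -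
      (unit_vec (Suc n) 0 :: complex vec) $ 1 * unit_vec (Suc n) 1 $ 0 \<noteq> 0"
    using n by simp
  moreover have "0 \<le> n" "1 \<le> n" using n by auto
  ultimately have "\<exists>i\<le>n. \<exists>j\<le>n. (unit_vec (Suc n) 0 :: complex vec) $ i * unit_vec (Suc n) 1 $ j -
      (unit_vec (Suc n) 0 :: complex vec) $ j * unit_vec (Suc n) 1 $ i \<noteq> 0" by blast
  then have "D \<noteq> 0" unfolding D_def using n by (intro br) simp
  then obtain a b where ln: "line n \<alpha> a b D" and e: "\<And>x y. x \<in> carrier_vec (Suc n) \<Longrightarrow> y \<in> carrier_vec (Suc n) \<Longrightarrow>
      bracket n \<alpha> x y = D * ((a \<bullet> x) * (b \<bullet> y) - (b \<bullet> x) * (a \<bullet> y))"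
    using lineI[OF n2 D_def] by metis
  interpret line n \<alpha> a b D by (rule ln)
  show "Q \<alpha>"
  proof (rule Q)
    show "general_line n \<alpha> a b D k Z"
    proof
      fix p assume p: "p \<in> Z"
      then obtain i where i: "i \<le> n" "p $ i \<noteq> 0"
        using Zc by (metis carrier_vecD eq_vecI index_zero_vec less_Suc_eq_le subsetD)
      obtain j where j: "j \<le> n" "j \<noteq> i" using n by (metis le0 One_nat_def one_le_numeral le_trans n_not_Suc_n)
      have "bracket n \<alpha> p (unit_vec (Suc n) j) \<noteq> 0"
      proof (rule br)
        have "p $ i * unit_vec (Suc n) j $ j - p $ j * unit_vec (Suc n) j $ i \<noteq> 0" using i j by simp
        then have "\<exists>i\<le>n. \<exists>l\<le>n. p $ i * unit_vec (Suc n) j $ l - p $ l * unit_vec (Suc n) j $ i \<noteq> 0"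
          using i j by blast
        then show "(p, unit_vec (Suc n) j) \<in> ?PQ" using p j by simp
      qed
      then show "a \<bullet> p \<noteq> 0 \<or> b \<bullet> p \<noteq> 0" using e[of p "unit_vec (Suc n) j"] p Zc by auto
      fix q assume q: "q \<in> Z" "p \<noteq> q"
      have "bracket n \<alpha> p q \<noteq> 0"
        by (rule br) (use p q distinct_points_minor[OF Z] in auto)
      then show "(a \<bullet> p) * (b \<bullet> q) - (b \<bullet> p) * (a \<bullet> q) \<noteq> 0" using e[OF subsetD[OF Zc(2) p] subsetD[OF Zc(2) q(1)]] by auto
    qed (use k Z in auto)
  qed
qed

section \<open>Modules and direct sums\<close>

lemma cring_Sring: "cring (Sring n)"
proof (rule cringI)
  show "abelian_group (Sring n)"
  proof (rule abelian_groupI)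
    fix x assume "x \<in> carrier (Sring n)"
    then show "\<exists>y\<in>carrier (Sring n). y \<oplus>\<^bsub>Sring n\<^esub> x = \<zero>\<^bsub>Sring n\<^esub>"
      by (intro bexI[of _ "- x"]) (simp_all add: carrier_Sring, simp add: Sring_def)
  qed (simp_all add: carrier_Sring, simp_all add: Sring_def vars_in_def[symmetric])
  show "comm_monoid (Sring n)"
    by (rule comm_monoidI) (simp_all add: carrier_Sring, simp_all add: Sring_def vars_in_def[symmetric])
qed (simp add: Sring_def distrib_right)

interpretation Sring: cring "Sring n" for n
  by (rule cring_Sring)

lemma Sring_simps [simp]:
  "x \<otimes>\<^bsub>Sring n\<^esub> y = x * y" "x \<oplus>\<^bsub>Sring n\<^esub> y = x + y" "\<one>\<^bsub>Sring n\<^esub> = 1" "\<zero>\<^bsub>Sring n\<^esub> = 0"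
  by (simp_all add: Sring_def)

lemma Sring_a_inv [simp]: "x \<in> carrier (Sring n) \<Longrightarrow> \<ominus>\<^bsub>Sring n\<^esub> x = - x"
  by (rule Sring.minus_equality) (simp_all add: carrier_Sring)

lemma Sring_ideal_iff:
  "ideal I (Sring n) \<longleftrightarrow> I \<subseteq> carrier (Sring n) \<and> 0 \<in> I \<and> (\<forall>x\<in>I. \<forall>y\<in>I. x + y \<in> I) \<and>
     (\<forall>x\<in>I. \<forall>r\<in>carrier (Sring n). r * x \<in> I)"
proof
  assume "ideal I (Sring n)"
  then interpret ideal I "Sring n" .
  show "I \<subseteq> carrier (Sring n) \<and> 0 \<in> I \<and> (\<forall>x\<in>I. \<forall>y\<in>I. x + y \<in> I) \<and>
     (\<forall>x\<in>I. \<forall>r\<in>carrier (Sring n). r * x \<in> I)"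
    using a_subset zero_closed a_closed I_l_closed by auto
next
  assume *: "I \<subseteq> carrier (Sring n) \<and> 0 \<in> I \<and> (\<forall>x\<in>I. \<forall>y\<in>I. x + y \<in> I) \<and>
     (\<forall>x\<in>I. \<forall>r\<in>carrier (Sring n). r * x \<in> I)"
  show "ideal I (Sring n)"
  proof (rule idealI)
    show "subgroup I (add_monoid (Sring n))"
    proof (rule Sring.add.subgroupI)
      fix x assume x: "x \<in> I"
      have "- 1 \<in> carrier (Sring n)" by (simp add: carrier_Sring)
      then have "(- 1) * x \<in> I" using * x by blast
      moreover have "\<ominus>\<^bsub>Sring n\<^esub> x = - x" using * x by (intro Sring_a_inv) blast
      ultimately show "\<ominus>\<^bsub>Sring n\<^esub> x \<in> I" by simp
    qed (use * in auto)
  qed (use * in \<open>auto simp: Sring.ring_axioms mult.commute\<close>)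
qed

lemma free_module_is_module:
  assumes "cring R"
  shows "module R (free_module R B)"
proof -
  interpret cring R by fact
  let ?M = "free_module R B"
  show ?thesis
  proof (rule moduleI)
    show "abelian_group ?M"
    proof (rule abelian_groupI)
      fix x assume x: "x \<in> carrier ?M"
      show "\<exists>y\<in>carrier ?M. y \<oplus>\<^bsub>?M\<^esub> x = \<zero>\<^bsub>?M\<^esub>"
        by (rule bexI[of _ "\<lambda>b\<in>B. \<ominus>\<^bsub>R\<^esub> x b"])
          (use x in \<open>auto simp: free_module_def PiE_def Pi_def l_neg\<close>)
      show "\<zero>\<^bsub>?M\<^esub> \<oplus>\<^bsub>?M\<^esub> x = x"
        using x by (auto simp: free_module_def PiE_def Pi_def extensional_def fun_eq_iff)
      fix y assume y: "y \<in> carrier ?M"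
      show "x \<oplus>\<^bsub>?M\<^esub> y = y \<oplus>\<^bsub>?M\<^esub> x"
        using x y by (auto simp: free_module_def PiE_def Pi_def a_comm)
      fix z assume z: "z \<in> carrier ?M"
      show "x \<oplus>\<^bsub>?M\<^esub> y \<oplus>\<^bsub>?M\<^esub> z = x \<oplus>\<^bsub>?M\<^esub> (y \<oplus>\<^bsub>?M\<^esub> z)"
        using x y z by (auto simp: free_module_def PiE_def Pi_def a_assoc fun_eq_iff)
    qed (auto simp: free_module_def PiE_def Pi_def)
  qed (use assms in \<open>auto simp: free_module_def PiE_def Pi_def fun_eq_iff extensional_def
      l_distr r_distr m_assoc restrict_def\<close>)
qed

text \<open>Restriction to a subset closed under the operations, and along a ring homomorphism, at once. The
  first serves for \<open>D\<^sup>k\<close> inside \<open>Der\<^sup>k\<close>, both together for \<open>D\<^sup>k|\<^sub>L\<close> as a \<open>P\<close>-module.\<close>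

lemma module_pullback:
  assumes "module R M" "cring R'"
    and sub: "carrier M' \<subseteq> carrier M" and ops: "zero M' = zero M" "add M' = add M"
    and z: "\<zero>\<^bsub>M\<^esub> \<in> carrier M'"
    and cl: "\<And>x y. x \<in> carrier M' \<Longrightarrow> y \<in> carrier M' \<Longrightarrow> x \<oplus>\<^bsub>M\<^esub> y \<in> carrier M'"
    and smult_cl: "\<And>q x. q \<in> carrier R' \<Longrightarrow> x \<in> carrier M' \<Longrightarrow> \<phi> q \<odot>\<^bsub>M\<^esub> x \<in> carrier M'"
    and sm: "\<And>q x. q \<in> carrier R' \<Longrightarrow> x \<in> carrier M' \<Longrightarrow> q \<odot>\<^bsub>M'\<^esub> x = \<phi> q \<odot>\<^bsub>M\<^esub> x"
    and \<phi>: "\<phi> \<in> Ring.ring_hom R' R"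
  shows "module R' M'"
proof -
  interpret M: module R M by fact
  interpret R': cring R' by fact
  interpret h: ring_hom_cring R' R \<phi>
    using \<phi> by unfold_locales
  show ?thesis
  proof (rule moduleI)
    show "abelian_group M'"
    proof (rule abelian_groupI)
      fix x assume x: "x \<in> carrier M'"
      then have xM: "x \<in> carrier M" using sub by blast
      have "\<phi> (\<ominus>\<^bsub>R'\<^esub> \<one>\<^bsub>R'\<^esub>) \<odot>\<^bsub>M\<^esub> x \<in> carrier M'"
        using smult_cl[OF R'.a_inv_closed[OF R'.one_closed] x] .
      moreover have "\<phi> (\<ominus>\<^bsub>R'\<^esub> \<one>\<^bsub>R'\<^esub>) \<odot>\<^bsub>M\<^esub> x = \<ominus>\<^bsub>M\<^esub> x" using xM by (simp add: M.smult_l_minus)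
      ultimately show "\<exists>y\<in>carrier M'. y \<oplus>\<^bsub>M'\<^esub> x = \<zero>\<^bsub>M'\<^esub>"
        using xM M.M.l_neg by (auto simp: ops)
    next
      fix x y z assume "x \<in> carrier M'" "y \<in> carrier M'" "z \<in> carrier M'"
      then have "x \<in> carrier M" "y \<in> carrier M" "z \<in> carrier M" using sub by auto
      then show "x \<oplus>\<^bsub>M'\<^esub> y \<oplus>\<^bsub>M'\<^esub> z = x \<oplus>\<^bsub>M'\<^esub> (y \<oplus>\<^bsub>M'\<^esub> z)" by (simp add: ops M.M.a_assoc)
    next
      fix x y assume "x \<in> carrier M'" "y \<in> carrier M'"
      then have "x \<in> carrier M" "y \<in> carrier M" using sub by auto
      then show "x \<oplus>\<^bsub>M'\<^esub> y = y \<oplus>\<^bsub>M'\<^esub> x" by (simp add: ops M.M.a_comm)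
    qed (use sub z cl in \<open>auto simp: ops\<close>)
  next
    fix q r x assume "q \<in> carrier R'" "r \<in> carrier R'" and x: "x \<in> carrier M'"
    moreover from x have "x \<in> carrier M" using sub by auto
    ultimately show "(q \<oplus>\<^bsub>R'\<^esub> r) \<odot>\<^bsub>M'\<^esub> x = q \<odot>\<^bsub>M'\<^esub> x \<oplus>\<^bsub>M'\<^esub> r \<odot>\<^bsub>M'\<^esub> x"
      "(q \<otimes>\<^bsub>R'\<^esub> r) \<odot>\<^bsub>M'\<^esub> x = q \<odot>\<^bsub>M'\<^esub> (r \<odot>\<^bsub>M'\<^esub> x)"
      by (simp_all add: sm smult_cl ops M.smult_l_distr M.smult_assoc1)
  next
    fix q x y assume "q \<in> carrier R'" and xy: "x \<in> carrier M'" "y \<in> carrier M'"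
    moreover from xy have "x \<in> carrier M" "y \<in> carrier M" using sub by auto
    ultimately show "q \<odot>\<^bsub>M'\<^esub> (x \<oplus>\<^bsub>M'\<^esub> y) = q \<odot>\<^bsub>M'\<^esub> x \<oplus>\<^bsub>M'\<^esub> q \<odot>\<^bsub>M'\<^esub> y"
      by (simp add: sm cl ops M.smult_r_distr)
  next
    fix x assume x: "x \<in> carrier M'"
    moreover from x have "x \<in> carrier M" using sub by auto
    ultimately show "\<one>\<^bsub>R'\<^esub> \<odot>\<^bsub>M'\<^esub> x = x" by (simp add: sm)
  qed (use sub in \<open>auto simp: sm smult_cl R'.is_cring\<close>)
qed

locale quotient_module = M: module R M
  for R :: "('a, 'r) ring_scheme" (structure) and M :: "('a, 'b) module" (structure) +
  fixes N :: "'b set"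
  assumes N_sub: "N \<subseteq> carrier M" and N_zero: "\<zero>\<^bsub>M\<^esub> \<in> N"
    and N_add: "x \<in> N \<Longrightarrow> y \<in> N \<Longrightarrow> x \<oplus>\<^bsub>M\<^esub> y \<in> N"
    and N_smult: "r \<in> carrier R \<Longrightarrow> x \<in> N \<Longrightarrow> r \<odot>\<^bsub>M\<^esub> x \<in> N"
begin

lemma N_neg: "x \<in> N \<Longrightarrow> \<ominus>\<^bsub>M\<^esub> x \<in> N"
  using N_smult[of "\<ominus>\<^bsub>R\<^esub> \<one>\<^bsub>R\<^esub>" x] N_sub M.smult_l_minus[of "\<one>\<^bsub>R\<^esub>" x] by auto

lemma N_subgroup: "subgroup N (add_monoid M)"
  by (rule M.M.add.subgroupI) (use N_sub N_zero N_add N_neg in auto)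

sublocale N: abelian_subgroup N M
  by (rule abelian_subgroupI3) (use N_subgroup M.M.abelian_group_axioms in \<open>auto simp: additive_subgroup_def\<close>)

lemma coset_eq_iff:
  assumes "x \<in> carrier M" "y \<in> carrier M"
  shows "N +>\<^bsub>M\<^esub> x = N +>\<^bsub>M\<^esub> y \<longleftrightarrow> x \<ominus>\<^bsub>M\<^esub> y \<in> N"
proof
  assume "N +>\<^bsub>M\<^esub> x = N +>\<^bsub>M\<^esub> y"
  then have "x \<in> N +>\<^bsub>M\<^esub> y" using assms N.a_rcos_self by blast
  then obtain m where m: "m \<in> N" "x = m \<oplus>\<^bsub>M\<^esub> y" by (auto simp: a_r_coset_def')
  then have "x \<ominus>\<^bsub>M\<^esub> y = m" using assms N_sub by (auto simp: a_minus_def M.M.a_assoc M.M.r_neg)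
  then show "x \<ominus>\<^bsub>M\<^esub> y \<in> N" using m by simp
next
  assume *: "x \<ominus>\<^bsub>M\<^esub> y \<in> N"
  have "x = (x \<ominus>\<^bsub>M\<^esub> y) \<oplus>\<^bsub>M\<^esub> y" using assms by (simp add: a_minus_def M.M.a_assoc M.M.l_neg)
  then have "x \<in> N +>\<^bsub>M\<^esub> y" using * by (auto simp: a_r_coset_def')
  then show "N +>\<^bsub>M\<^esub> x = N +>\<^bsub>M\<^esub> y"
    using N.a_repr_independence'[of x y] assms by metis
qed

lemma carrier_quot: "carrier (quot_module M N) = (\<lambda>x. N +>\<^bsub>M\<^esub> x) ` carrier M"
  by (auto simp: quot_module_def A_RCOSETS_def' a_r_coset_def')

lemma quot_simps:
  "zero (quot_module M N) = N" "add (quot_module M N) = set_add M"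
  by (simp_all add: quot_module_def)

lemma zero_coset: "N +>\<^bsub>M\<^esub> \<zero>\<^bsub>M\<^esub> = N"
  by (rule M.M.a_coset_add_zero[OF N_sub])

lemma add_coset:
  "x \<in> carrier M \<Longrightarrow> y \<in> carrier M \<Longrightarrow>
    (N +>\<^bsub>M\<^esub> x) \<oplus>\<^bsub>quot_module M N\<^esub> (N +>\<^bsub>M\<^esub> y) = N +>\<^bsub>M\<^esub> (x \<oplus>\<^bsub>M\<^esub> y)"
  by (simp add: quot_simps N.a_rcos_sum)

lemma smult_coset:
  assumes "r \<in> carrier R" "x \<in> carrier M"
  shows "r \<odot>\<^bsub>quot_module M N\<^esub> (N +>\<^bsub>M\<^esub> x) = N +>\<^bsub>M\<^esub> (r \<odot>\<^bsub>M\<^esub> x)"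
proof -
  have "N +>\<^bsub>M\<^esub> (r \<odot>\<^bsub>M\<^esub> y) = N +>\<^bsub>M\<^esub> (r \<odot>\<^bsub>M\<^esub> x)" if "y \<in> N +>\<^bsub>M\<^esub> x" for y
  proof -
    obtain m where m: "m \<in> N" "y = m \<oplus>\<^bsub>M\<^esub> x"
      using \<open>y \<in> N +>\<^bsub>M\<^esub> x\<close> by (auto simp: a_r_coset_def')
    have mc: "m \<in> carrier M" using m N_sub by auto
    have "r \<odot>\<^bsub>M\<^esub> y = r \<odot>\<^bsub>M\<^esub> m \<oplus>\<^bsub>M\<^esub> r \<odot>\<^bsub>M\<^esub> x" using m mc assms by (simp add: M.smult_r_distr)
    then have "N +>\<^bsub>M\<^esub> (r \<odot>\<^bsub>M\<^esub> y) = (N +>\<^bsub>M\<^esub> (r \<odot>\<^bsub>M\<^esub> m)) <+>\<^bsub>M\<^esub> (N +>\<^bsub>M\<^esub> (r \<odot>\<^bsub>M\<^esub> x))"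
      using mc assms by (simp add: N.a_rcos_sum)
    also have "N +>\<^bsub>M\<^esub> (r \<odot>\<^bsub>M\<^esub> m) = N +>\<^bsub>M\<^esub> \<zero>\<^bsub>M\<^esub>"
      using N_smult[OF assms(1) m(1)] N_sub zero_coset by (metis M.M.a_coset_join2 N_subgroup subsetD)
    finally show ?thesis using assms by (simp add: N.a_rcos_sum)
  qed
  then have "(\<Union>y\<in>N +>\<^bsub>M\<^esub> x. N +>\<^bsub>M\<^esub> (r \<odot>\<^bsub>M\<^esub> y)) = (\<Union>y\<in>N +>\<^bsub>M\<^esub> x. N +>\<^bsub>M\<^esub> (r \<odot>\<^bsub>M\<^esub> x))"
    by (intro SUP_cong refl)
  also have "\<dots> = N +>\<^bsub>M\<^esub> (r \<odot>\<^bsub>M\<^esub> x)" using N.a_rcos_self[OF assms(2)] by blast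
  finally show ?thesis by (simp add: quot_module_def)
qed

lemma module_quot: "module R (quot_module M N)"
proof (rule moduleI)
  let ?Q = "quot_module M N"
  show "abelian_group ?Q"
  proof (rule abelian_groupI)
    show "\<zero>\<^bsub>?Q\<^esub> \<in> carrier ?Q" unfolding carrier_quot quot_simps using zero_coset by force
    fix C assume "C \<in> carrier ?Q"
    then obtain x where x: "x \<in> carrier M" "C = N +>\<^bsub>M\<^esub> x" unfolding carrier_quot by blast
    show "\<zero>\<^bsub>?Q\<^esub> \<oplus>\<^bsub>?Q\<^esub> C = C"
      unfolding x(2) quot_simps(1) by (subst (1) zero_coset[symmetric]) (simp add: add_coset x)
    have "(N +>\<^bsub>M\<^esub> \<ominus>\<^bsub>M\<^esub> x) \<oplus>\<^bsub>?Q\<^esub> C = \<zero>\<^bsub>?Q\<^esub>"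
      using x by (simp add: add_coset M.M.l_neg zero_coset quot_simps(1))
    then show "\<exists>B\<in>carrier ?Q. B \<oplus>\<^bsub>?Q\<^esub> C = \<zero>\<^bsub>?Q\<^esub>" unfolding carrier_quot using x by blast
  qed (auto simp: carrier_quot add_coset M.M.a_ac)
qed (auto simp: carrier_quot add_coset smult_coset M.smult_l_distr M.smult_r_distr M.smult_assoc1 M.R.is_cring)

end

text \<open>Two families with equal sums have a difference that sums to zero, so uniqueness reduces to
  \<open>indep\<close>.\<close>

lemma internal_direct_sumI:
  assumes "abelian_group M"
    and sg: "\<And>i. i \<in> I \<Longrightarrow> subgroup (A i) (add_monoid M)"
    and gen: "\<And>x. x \<in> N \<Longrightarrow> \<exists>F u. finite F \<and> F \<subseteq> I \<and> (\<forall>i\<in>F. u i \<in> A i) \<and> x = finsum M u F"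
    and cl: "\<And>F u. finite F \<Longrightarrow> F \<subseteq> I \<Longrightarrow> (\<And>i. i \<in> F \<Longrightarrow> u i \<in> A i) \<Longrightarrow> finsum M u F \<in> N"
    and indep: "\<And>F u i. finite F \<Longrightarrow> F \<subseteq> I \<Longrightarrow> (\<And>i. i \<in> F \<Longrightarrow> u i \<in> A i) \<Longrightarrow>
      finsum M u F = \<zero>\<^bsub>M\<^esub> \<Longrightarrow> i \<in> F \<Longrightarrow> u i = \<zero>\<^bsub>M\<^esub>"
  shows "internal_direct_sum M I A N"
proof -
  interpret M: abelian_group M by fact
  have Ac: "A i \<subseteq> carrier M" if "i \<in> I" for i using sg[OF that] subgroup.subset by fastforce
  have Az: "\<zero>\<^bsub>M\<^esub> \<in> A i" if "i \<in> I" for i using sg[OF that] subgroup.one_closed by fastforce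
  let ?S = "\<lambda>u. {i\<in>I. u i \<noteq> \<zero>\<^bsub>M\<^esub>}"
  have ext: "finsum M u (?S u) = finsum M u F"
    if "u \<in> PiE I A" "finite F" "F \<subseteq> I" "?S u \<subseteq> F" for u F
    by (rule M.add.finprod_mono_neutral_cong_left) (use that Ac in \<open>fastforce simp: PiE_def Pi_def\<close>)+
  have "inj_on (\<lambda>u. finsum M u (?S u)) {u \<in> PiE I A. finite (?S u)}"
  proof (rule inj_onI)
    fix u v assume u: "u \<in> {u \<in> PiE I A. finite (?S u)}" and v: "v \<in> {u \<in> PiE I A. finite (?S u)}"
      and e: "finsum M u (?S u) = finsum M v (?S v)"
    define F where "F = ?S u \<union> ?S v"
    have F: "finite F" "F \<subseteq> I" using u v by (auto simp: F_def)
    have uA: "u i \<in> A i" "v i \<in> A i" if "i \<in> I" for i using u v that by auto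
    have mv: "\<ominus>\<^bsub>M\<^esub> v i \<in> A i" if "i \<in> I" for i
      using subgroup.m_inv_closed[OF sg[OF that] uA(2)[OF that]] by (simp add: a_inv_def)
    have uF: "finsum M u F = finsum M v F"
      using ext[of u F] ext[of v F] u v F e by (simp add: F_def)
    have uvc: "u \<in> F \<rightarrow> carrier M" "v \<in> F \<rightarrow> carrier M" using uA Ac F by blast+
    have sum: "finsum M v F \<oplus>\<^bsub>M\<^esub> finsum M (\<lambda>i. u i \<oplus>\<^bsub>M\<^esub> \<ominus>\<^bsub>M\<^esub> v i) F = finsum M u F"
    proof -
      have "finsum M v F \<oplus>\<^bsub>M\<^esub> finsum M (\<lambda>i. u i \<oplus>\<^bsub>M\<^esub> \<ominus>\<^bsub>M\<^esub> v i) F =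
          finsum M (\<lambda>i. v i \<oplus>\<^bsub>M\<^esub> (u i \<oplus>\<^bsub>M\<^esub> \<ominus>\<^bsub>M\<^esub> v i)) F"
        by (rule M.finsum_addf[symmetric]) (use uvc in auto)
      also have "\<dots> = finsum M u F"
      proof (rule M.finsum_cong'[OF refl uvc(1)])
        fix i assume "i \<in> F"
        then have "u i \<in> carrier M" "v i \<in> carrier M" using uvc by auto
        then show "v i \<oplus>\<^bsub>M\<^esub> (u i \<oplus>\<^bsub>M\<^esub> \<ominus>\<^bsub>M\<^esub> v i) = u i"
          by (simp add: M.a_lcomm M.r_neg)
      qed
      finally show ?thesis .
    qed
    have "finsum M (\<lambda>i. u i \<oplus>\<^bsub>M\<^esub> \<ominus>\<^bsub>M\<^esub> v i) F = \<zero>\<^bsub>M\<^esub>"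
    proof -
      have "finsum M (\<lambda>i. u i \<oplus>\<^bsub>M\<^esub> \<ominus>\<^bsub>M\<^esub> v i) F \<in> carrier M" "finsum M v F \<in> carrier M"
        by (rule M.finsum_closed, use uvc in auto)+
      then show ?thesis using sum uF by simp
    qed
    note z = this
    have eqF: "u i = v i" if iF: "i \<in> F" for i
    proof -
      have "u i \<oplus>\<^bsub>M\<^esub> \<ominus>\<^bsub>M\<^esub> v i = \<zero>\<^bsub>M\<^esub>"
      proof (rule indep[OF F _ z iF])
        fix j assume "j \<in> F"
        then have j: "j \<in> I" using F by blast
        show "u j \<oplus>\<^bsub>M\<^esub> \<ominus>\<^bsub>M\<^esub> v j \<in> A j"
          using subgroup.m_closed[OF sg[OF j] uA(1)[OF j] mv[OF j]] by simp
      qed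
      moreover have "u i \<in> carrier M" "v i \<in> carrier M" using iF uvc by auto
      ultimately show ?thesis using M.minus_equality M.minus_minus by (metis M.a_inv_closed)
    qed
    show "u = v"
    proof
      fix i
      show "u i = v i"
      proof (cases "i \<in> I")
        case True
        then show ?thesis using eqF[of i] by (cases "i \<in> F") (auto simp: F_def)
      next
        case False
        then show ?thesis using u v by (auto simp: PiE_def extensional_def)
      qed
    qed
  qed
  moreover have "(\<lambda>u. finsum M u (?S u)) ` {u \<in> PiE I A. finite (?S u)} = N"
  proof (intro equalityI subsetI)
    fix x assume "x \<in> N"
    then obtain F u where F: "finite F" "F \<subseteq> I" "\<And>i. i \<in> F \<Longrightarrow> u i \<in> A i" "x = finsum M u F"
      using gen by meson
    define w where "w = (\<lambda>i\<in>I. if i \<in> F then u i else \<zero>\<^bsub>M\<^esub>)"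
    have w: "w \<in> PiE I A" using F Az by (auto simp: w_def)
    have S: "?S w \<subseteq> F" by (auto simp: w_def)
    have "x = finsum M w F"
      unfolding F(4) by (rule M.finsum_cong') (use F Ac in \<open>auto simp: w_def Pi_def\<close>)
    also have "\<dots> = finsum M w (?S w)" using ext[OF w F(1,2) S] by simp
    finally show "x \<in> (\<lambda>u. finsum M u (?S u)) ` {u \<in> PiE I A. finite (?S u)}"
      using w finite_subset[OF S F(1)] by blast
  next
    fix x assume "x \<in> (\<lambda>u. finsum M u (?S u)) ` {u \<in> PiE I A. finite (?S u)}"
    then obtain u where "u \<in> PiE I A" "finite (?S u)" "x = finsum M u (?S u)" by blast
    then show "x \<in> N" using cl[of "?S u" u] by auto
  qed
  ultimately show ?thesis
    unfolding internal_direct_sum_def bij_betw_def using sg by blast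
qed

lemma (in abelian_group) additive_finsum:
  fixes h :: "'a \<Rightarrow> 'd::ab_group_add"
  assumes "finite F" "\<And>i. i \<in> F \<Longrightarrow> u i \<in> carrier G" "h \<zero> = 0"
    and "\<And>x y. x \<in> carrier G \<Longrightarrow> y \<in> carrier G \<Longrightarrow> h (x \<oplus> y) = h x + h y"
  shows "h (finsum G u F) = (\<Sum>i\<in>F. h (u i))"
  using assms(1,2)
  by (induction F rule: finite_induct) (auto simp: assms(3,4) finsum_insert finsum_closed Pi_def)

section \<open>Monomials of fixed degree\<close>

lemma finite_multi [simp]: "finite (multi n k)"
proof -
  have "inj_on (\<lambda>\<beta>. restrict (lookup \<beta>) {..n}) (multi n k)"
  proof (rule inj_onI)
    fix \<beta> \<gamma> assume "\<beta> \<in> multi n k" "\<gamma> \<in> multi n k" and e: "restrict (lookup \<beta>) {..n} = restrict (lookup \<gamma>) {..n}"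
    then have out: "i \<notin> {..n} \<Longrightarrow> lookup \<beta> i = 0 \<and> lookup \<gamma> i = 0" for i by (auto simp: multi_def in_keys_iff)
    show "\<beta> = \<gamma>"
    proof (rule poly_mapping_eqI)
      fix i
      show "lookup \<beta> i = lookup \<gamma> i"
        using fun_cong[OF e, of i] out[of i] by (cases "i \<in> {..n}") auto
    qed
  qed
  moreover have "(\<lambda>\<beta>. restrict (lookup \<beta>) {..n}) ` multi n k \<subseteq> PiE {..n} (\<lambda>_. {..k})"
  proof -
    have "lookup \<beta> i \<le> tdeg \<beta>" for \<beta> :: mindex and i
      by (cases "i \<in> keys \<beta>") (auto simp: tdeg_def in_keys_iff intro: member_le_sum)
    then show ?thesis by (intro image_subsetI restrict_PiE_iff[THEN iffD2]) (auto simp: multi_def)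
  qed
  ultimately show ?thesis by (meson finite_PiE finite_atMost finite_imageD finite_subset)
qed

lemma multi_add_single: "\<gamma> \<in> multi n k \<Longrightarrow> m \<le> n \<Longrightarrow> \<gamma> + single m 1 \<in> multi n (Suc k)"
  using keys_add[of \<gamma> "single m 1"] by (fastforce simp: multi_def)

abbreviation xpow :: "mindex \<Rightarrow> nat cpoly" where "xpow \<beta> \<equiv> single \<beta> 1"

lemma vars_in_xpow [simp]: "\<beta> \<in> multi n k \<Longrightarrow> vars_in {..n} (xpow \<beta>)"
  by (rule vars_in_single) (simp add: multi_def)

lemma homog_xpow [simp]: "\<beta> \<in> multi n k \<Longrightarrow> homog k (xpow \<beta>)"
  by (simp add: multi_def)

lemma lookup_const_sum:
  assumes "\<beta> \<in> multi n k"
  shows "lookup (\<Sum>\<beta>\<in>multi n k. const (c \<beta>) * xpow \<beta>) \<beta> = c \<beta>"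
proof -
  have "lookup (\<Sum>\<beta>\<in>multi n k. const (c \<beta>) * xpow \<beta>) \<beta> = (\<Sum>\<gamma>\<in>multi n k. if \<gamma> = \<beta> then c \<gamma> else 0)"
    unfolding lookup_sum by (intro sum.cong refl) (simp add: const_def mult_single lookup_single when_def)
  then show ?thesis using assms by simp
qed

lemma homog_expand:
  assumes "vars_in {..n} F" "homog k F"
  shows "F = (\<Sum>\<beta>\<in>multi n k. const (lookup F \<beta>) * xpow \<beta>)"
proof -
  have "F = (\<Sum>\<beta>\<in>keys F. const (lookup F \<beta>) * xpow \<beta>)"
    by (subst sum_of_singles[of F]) (simp add: const_def mult_single)
  also have "\<dots> = (\<Sum>\<beta>\<in>multi n k. const (lookup F \<beta>) * xpow \<beta>)"
  proof (rule sum.mono_neutral_left[OF finite_multi])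
    show "keys F \<subseteq> multi n k" using assms by (auto simp: multi_def vars_in_def homog_def)
  qed (auto simp: in_keys_iff)
  finally show ?thesis .
qed

text \<open>Coefficients of the product of \<open>\<Sum> r\<^sub>\<gamma> T\<^sup>\<gamma>\<close> with a linear form \<open>\<Sum> l\<^sub>m T\<^sub>m\<close> in auxiliary
  variables \<open>T\<close>.\<close>

definition lin_mult :: "nat \<Rightarrow> nat \<Rightarrow> (nat \<Rightarrow> 'a::comm_ring_1) \<Rightarrow> (mindex \<Rightarrow> 'a) \<Rightarrow> mindex \<Rightarrow> 'a" where
  "lin_mult n j l r \<beta> = (\<Sum>\<gamma>\<in>multi n j. \<Sum>m\<le>n. if \<beta> = \<gamma> + single m 1 then l m * r \<gamma> else 0)"

lemma lin_mult_eval: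
  "(\<Sum>\<beta>\<in>multi n (Suc j). lin_mult n j l r \<beta> * xpow \<beta>) =
    (\<Sum>m\<le>n. l m * var m) * (\<Sum>\<gamma>\<in>multi n j. r \<gamma> * xpow \<gamma>)"
proof -
  have "(\<Sum>\<beta>\<in>multi n (Suc j). lin_mult n j l r \<beta> * xpow \<beta>) =
      (\<Sum>\<beta>\<in>multi n (Suc j). \<Sum>\<gamma>\<in>multi n j. \<Sum>m\<le>n. if \<beta> = \<gamma> + single m 1 then l m * r \<gamma> * xpow \<beta> else 0)"
    unfolding lin_mult_def sum_distrib_right by (intro sum.cong refl) simp
  also have "\<dots> = (\<Sum>\<gamma>\<in>multi n j. \<Sum>m\<le>n. \<Sum>\<beta>\<in>multi n (Suc j). if \<beta> = \<gamma> + single m 1 then l m * r \<gamma> * xpow \<beta> else 0)"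
    by (subst sum.swap) (intro sum.cong refl sum.swap)
  also have "\<dots> = (\<Sum>\<gamma>\<in>multi n j. \<Sum>m\<le>n. l m * r \<gamma> * xpow (\<gamma> + single m 1))"
    by (intro sum.cong refl) (simp add: multi_add_single[simplified])
  also have "\<dots> = (\<Sum>\<gamma>\<in>multi n j. \<Sum>m\<le>n. (l m * var m) * (r \<gamma> * xpow \<gamma>))"
  proof (intro sum.cong refl)
    fix \<gamma> m
    have "xpow (\<gamma> + single m 1) = xpow \<gamma> * var m" by (simp add: var_def mult_single)
    then show "l m * r \<gamma> * xpow (\<gamma> + single m 1) = (l m * var m) * (r \<gamma> * xpow \<gamma>)" by (simp add: mult_ac)
  qed
  also have "\<dots> = (\<Sum>m\<le>n. l m * var m) * (\<Sum>\<gamma>\<in>multi n j. r \<gamma> * xpow \<gamma>)"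
    by (subst sum.swap) (simp add: sum_product)
  finally show ?thesis .
qed

lemma lin_mult_add_right: "lin_mult n j l (\<lambda>\<gamma>. r \<gamma> + s \<gamma>) \<beta> = lin_mult n j l r \<beta> + lin_mult n j l s \<beta>"
  unfolding lin_mult_def sum.distrib[symmetric] by (intro sum.cong refl) (simp add: distrib_left)

lemma lin_mult_scale_right: "lin_mult n j l (\<lambda>\<gamma>. c * r \<gamma>) \<beta> = c * lin_mult n j l r \<beta>"
  unfolding lin_mult_def sum_distrib_left by (intro sum.cong refl) simp

lemma lin_mult_diff_left: "lin_mult n j (\<lambda>m. l m - l' m) r \<beta> = lin_mult n j l r \<beta> - lin_mult n j l' r \<beta>"
  unfolding lin_mult_def sum_subtractf[symmetric] by (intro sum.cong refl) (simp add: left_diff_distrib)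

lemma lin_mult_scale_left: "lin_mult n j (\<lambda>m. c * l m) r \<beta> = c * lin_mult n j l r \<beta>"
  unfolding lin_mult_def sum_distrib_left by (intro sum.cong refl) simp

lemma lin_mult_const: "lin_mult n j (\<lambda>m. const (l m)) (\<lambda>\<gamma>. const (r \<gamma>)) \<beta> = const (lin_mult n j l r \<beta>)"
  unfolding lin_mult_def const_hom.hom_sum by (intro sum.cong refl) (simp add: const_hom.hom_mult)

text \<open>The coefficient of \<open>T\<^sub>0 T\<^sup>\<gamma>\<close>, where \<open>\<gamma>\<close> has the largest exponent of \<open>T\<^sub>0\<close> among the indices with
  \<open>r\<^sub>\<gamma> \<noteq> 0\<close>, is \<open>l\<^sub>0 r\<^sub>\<gamma>\<close>: every other contribution would come from an index with a larger exponent.\<close>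

lemma lin_mult_inj:
  fixes r :: "mindex \<Rightarrow> 'a::idom"
  assumes "l 0 \<noteq> 0" and z: "\<And>\<beta>. \<beta> \<in> multi n (Suc j) \<Longrightarrow> lin_mult n j l r \<beta> = 0" and \<gamma>: "\<gamma> \<in> multi n j"
  shows "r \<gamma> = 0"
proof (rule ccontr)
  assume "r \<gamma> \<noteq> 0"
  define S where "S = {\<gamma> \<in> multi n j. r \<gamma> \<noteq> 0}"
  have S: "finite S" "S \<noteq> {}" using \<gamma> \<open>r \<gamma> \<noteq> 0\<close> by (auto simp: S_def)
  define t where "t = Max ((\<lambda>\<gamma>. lookup \<gamma> 0) ` S)"
  have "t \<in> (\<lambda>\<gamma>. lookup \<gamma> 0) ` S" unfolding t_def using S by (intro Max_in) auto
  then obtain \<delta> where \<delta>: "\<delta> \<in> S" "lookup \<delta> 0 = t" by auto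
  have max: "lookup \<gamma>' 0 \<le> lookup \<delta> 0" if "\<gamma>' \<in> S" for \<gamma>' using that S \<delta> by (auto simp: t_def)
  have \<delta>m: "\<delta> \<in> multi n j" "r \<delta> \<noteq> 0" using \<delta> by (auto simp: S_def)
  have "0 = lin_mult n j l r (\<delta> + single 0 1)" using z multi_add_single[OF \<delta>m(1), of 0] by simp
  also have "\<dots> = (\<Sum>\<gamma>'\<in>multi n j. if \<gamma>' = \<delta> then l 0 * r \<delta> else 0)"
    unfolding lin_mult_def
  proof (intro sum.cong refl)
    fix \<gamma>' assume \<gamma>': "\<gamma>' \<in> multi n j"
    have "(\<Sum>m\<le>n. if \<delta> + single 0 1 = \<gamma>' + single m 1 then l m * r \<gamma>' else 0) =
        (\<Sum>m\<le>n. if m = 0 then (if \<gamma>' = \<delta> then l 0 * r \<delta> else 0) else 0)"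
    proof (intro sum.cong refl)
      fix m
      show "(if \<delta> + single 0 1 = \<gamma>' + single m 1 then l m * r \<gamma>' else 0) =
          (if m = 0 then (if \<gamma>' = \<delta> then l 0 * r \<delta> else 0) else 0)"
      proof (cases "m = 0")
        case False
        have "r \<gamma>' = 0" if "\<delta> + single 0 1 = \<gamma>' + single m 1"
        proof (rule ccontr)
          assume "r \<gamma>' \<noteq> 0"
          then have "lookup \<gamma>' 0 \<le> lookup \<delta> 0" using max \<gamma>' by (simp add: S_def)
          moreover have "lookup (\<delta> + single 0 1) 0 = lookup (\<gamma>' + single m 1) 0" using that by simp
          ultimately show False using False by (simp add: lookup_add lookup_single when_def)
        qed
        then show ?thesis using False by simp
      qed auto
    qed
    then show "(\<Sum>m\<le>n. if \<delta> + single 0 1 = \<gamma>' + single m 1 then l m * r \<gamma>' else 0) =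
        (if \<gamma>' = \<delta> then l 0 * r \<delta> else 0)" by simp
  qed
  also have "\<dots> = l 0 * r \<delta>" using \<delta>m by simp
  finally show False using assms(1) \<delta>m by simp
qed

section \<open>The coordinate ring of the dual line\<close>

context line
begin

abbreviation A :: "nat cpoly" where "A \<equiv> linear_form n a"
abbreviation B :: "nat cpoly" where "B \<equiv> linear_form n b"
abbreviation psi :: "nat cpoly \<Rightarrow> nat cpoly" where "psi \<equiv> peval const (e_coord n \<alpha>)"

lemma unit_coords [simp]:
  "a \<bullet> unit_vec (Suc n) 0 = 1" "a \<bullet> unit_vec (Suc n) (Suc 0) = 0"
  "b \<bullet> unit_vec (Suc n) 0 = 0" "b \<bullet> unit_vec (Suc n) (Suc 0) = 1"
  using n2 by simp_all

lemma A_nonzero: "A \<noteq> 0" and B_nonzero: "B \<noteq> 0"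
proof -
  have "ev (unit_vec (Suc n) 0) A \<noteq> 0" "ev (unit_vec (Suc n) (Suc 0)) B \<noteq> 0"
    by (simp_all add: ev_linear_form)
  then show "A \<noteq> 0" "B \<noteq> 0" by auto
qed

lemma e_coord_0: "e_coord n \<alpha> 0 = const D * B"
  by (simp add: e_coord)

lemma e_coord_1: "e_coord n \<alpha> (Suc 0) = - (const D * A)"
  using n2 by (simp add: e_coord)

lemma vars_in_e_coord [simp]: "i \<le> n \<Longrightarrow> vars_in {..n} (e_coord n \<alpha> i)"
  by (simp add: e_coord)

lemma homog_e_coord [simp]: "i \<le> n \<Longrightarrow> homog 1 (e_coord n \<alpha> i)" "i \<le> n \<Longrightarrow> homog (Suc 0) (e_coord n \<alpha> i)"
  by (simp_all add: e_coord)

lemma vars_in_psi [simp]: "vars_in {..n} p \<Longrightarrow> vars_in {..n} (psi p)"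
  by (rule vars_in_subst) auto

lemma homog_psi: "vars_in {..n} p \<Longrightarrow> homog d p \<Longrightarrow> homog d (psi p)"
  by (rule homog_subst) auto

lemma hpart_psi: "vars_in {..n} p \<Longrightarrow> hpart d (psi p) = psi (hpart d p)"
  by (rule hpart_subst) auto

text \<open>The point of \<open>L\<close> dual to the hyperplane spanned by \<open>H\<close> and a point.\<close>

definition epoint :: "complex vec \<Rightarrow> complex vec" where
  "epoint X = (D * (b \<bullet> X)) \<cdot>\<^sub>v a + (- D * (a \<bullet> X)) \<cdot>\<^sub>v b"

lemma epoint_carrier [simp]: "epoint X \<in> carrier_vec (Suc n)"
  by (simp add: epoint_def)

lemma epoint_index:
  assumes "i \<le> n"
  shows "epoint X $ i = D * (b \<bullet> X) * a $ i - D * (a \<bullet> X) * b $ i"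
  using assms unfolding epoint_def
  by (simp add: carrier_vecD[OF a_carrier] carrier_vecD[OF b_carrier])

lemma ev_psi:
  assumes "vars_in {..n} p" "X \<in> carrier_vec (Suc n)"
  shows "ev X (psi p) = ev (epoint X) p"
proof -
  have "vec (Suc n) (\<lambda>i. ev X (e_coord n \<alpha> i)) = epoint X"
  proof (rule eq_vecI)
    fix i assume "i < dim_vec (epoint X)"
    then have i: "i < Suc n" using carrier_vecD[OF epoint_carrier] by simp
    then show "vec (Suc n) (\<lambda>i. ev X (e_coord n \<alpha> i)) $ i = epoint X $ i"
      using assms by (simp add: epoint_index e_coord ev_hom.hom_mult ev_hom.hom_minus ev_linear_form algebra_simps)
  qed (simp add: carrier_vecD[OF epoint_carrier])
  then show ?thesis using ev_subst[of "Suc n" p] assms(1) by (simp add: lessThan_Suc_atMost)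
qed

text \<open>Solve \<open>D (b \<bullet> X) = s\<close> and \<open>- D (a \<bullet> X) = t\<close> in the plane of \<open>e\<^sub>0, e\<^sub>1\<close>, to which \<open>a, b\<close> are dual.\<close>

lemma L_pts_epoint:
  assumes "y \<in> L_pts n \<alpha>"
  obtains X where "X \<in> carrier_vec (Suc n)" "y = epoint X"
proof -
  obtain s t where y: "y = s \<cdot>\<^sub>v a + t \<cdot>\<^sub>v b" using assms L_pts by auto
  define X where "X = (- t / D) \<cdot>\<^sub>v unit_vec (Suc n) 0 + (s / D) \<cdot>\<^sub>v unit_vec (Suc n) (Suc 0)"
  have "a \<bullet> X = - t / D" "b \<bullet> X = s / D"
    by (simp_all add: X_def scalar_prod_add_distrib[of _ "Suc n"])
  then have "y = epoint X" by (simp add: y epoint_def)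
  then show thesis using that[of X] by (simp add: X_def)
qed

lemma epoint_in_L_pts:
  assumes "X \<in> carrier_vec (Suc n)" "a \<bullet> X \<noteq> 0 \<or> b \<bullet> X \<noteq> 0"
  shows "epoint X \<in> L_pts n \<alpha>"
proof -
  have "epoint X $ 0 = D * (b \<bullet> X)" "epoint X $ Suc 0 = - D * (a \<bullet> X)"
    using n2 by (simp_all add: epoint_index)
  then have "epoint X \<noteq> 0\<^sub>v (Suc n)" using assms n2 by auto
  then show ?thesis unfolding L_pts points_def by (auto simp: epoint_def)
qed

text \<open>The values of \<open>psi p\<close> are the values of \<open>p\<close> on \<open>L\<close>. Multiplication by \<open>B\<close> removes the vectors \<open>X\<close>
  that are sent to zero, which is not a point of \<open>L\<close>.\<close>

lemma psi_eq_0_iff: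
  assumes p: "vars_in {..n} p"
  shows "psi p = 0 \<longleftrightarrow> p \<in> IL n \<alpha>"
proof
  assume "psi p = 0"
  then have "ev y p = 0" if "y \<in> L_pts n \<alpha>" for y
    using L_pts_epoint[OF that] ev_psi[OF p] by (metis ev_hom.hom_zero)
  then show "p \<in> IL n \<alpha>" using p by (simp add: IL_def vanish_def carrier_Sring)
next
  assume IL: "p \<in> IL n \<alpha>"
  have "psi p * B = 0"
  proof (rule Sring_eq_zeroI[of _ n])
    fix X :: "complex vec" assume X: "X \<in> carrier_vec (Suc n)"
    show "ev X (psi p * B) = 0"
    proof (cases "b \<bullet> X = 0")
      case False
      then have "ev (epoint X) p = 0" using IL epoint_in_L_pts[OF X] by (simp add: IL_def vanish_def)
      then show ?thesis using ev_psi[OF p X] by (simp add: ev_hom.hom_mult)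
    qed (simp add: ev_hom.hom_mult ev_linear_form X)
  qed (use p in \<open>simp add: carrier_Sring\<close>)
  then show "psi p = 0" using B_nonzero by simp
qed

lemma IL_eq: "IL n \<alpha> = {p \<in> carrier (Sring n). psi p = 0}"
  using psi_eq_0_iff by (auto simp: carrier_Sring IL_def vanish_def)

lemma ideal_IL: "ideal (IL n \<alpha>) (Sring n)"
  unfolding Sring_ideal_iff IL_eq by (auto simp: carrier_Sring subst_hom.hom_add subst_hom.hom_mult)

text \<open>The substitution \<open>X \<mapsto> X - (a \<bullet> X) e\<^sub>0 - (b \<bullet> X) e\<^sub>1\<close> maps into the cone over \<open>H\<close> and is the identity
  modulo \<open>(A, B)\<close>. The zero vector is not a point of \<open>H\<close>; the factor \<open>X\<^sub>2\<close> avoids it.\<close>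

lemma vanish_H: "vanish n (H_pts n \<alpha>) = {A * u + B * v | u v. vars_in {..n} u \<and> vars_in {..n} v}"
proof (intro equalityI subsetI)
  fix F assume F: "F \<in> vanish n (H_pts n \<alpha>)"
  then have Fv: "vars_in {..n} F" and Fz: "\<And>x. x \<in> H_pts n \<alpha> \<Longrightarrow> ev x F = 0"
    by (auto simp: vanish_def carrier_Sring)
  define y where "y i = (if i = 0 then var 0 - A else if i = Suc 0 then var (Suc 0) - B else var i)" for i
  have yv: "vars_in {..n} (y i)" if "i \<in> {..n}" for i using that by (auto simp: y_def)
  have "\<exists>u v. vars_in {..n} u \<and> vars_in {..n} v \<and> var i - y i = A * u + B * v" if "i \<in> {..n}" for i
    unfolding y_def
    by (rule exI[of _ "if i = 0 then 1 else 0"], rule exI[of _ "if i = Suc 0 then 1 else 0"]) auto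
  then obtain u v where uv: "vars_in {..n} u" "vars_in {..n} v" "peval const var F - peval const y F = A * u + B * v"
    using subst_cong_mod[OF Fv, of "{..n}" var y A B] yv by auto
  have "peval const y F * var 2 = 0"
  proof (rule Sring_eq_zeroI[of _ n])
    fix x :: "complex vec" assume x: "x \<in> carrier_vec (Suc n)"
    show "ev x (peval const y F * var 2) = 0"
    proof (cases "x $ 2 = 0")
      case False
      define w where "w = x - ((a \<bullet> x) \<cdot>\<^sub>v unit_vec (Suc n) 0 + (b \<bullet> x) \<cdot>\<^sub>v unit_vec (Suc n) (Suc 0))"
      have w: "w \<in> carrier_vec (Suc n)" using x by (simp add: w_def)
      have "a \<bullet> w = 0" "b \<bullet> w = 0" using x
        by (simp_all add: w_def scalar_prod_minus_distrib[of _ "Suc n"] scalar_prod_add_distrib[of _ "Suc n"])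
      moreover have "w $ 2 = x $ 2" using n2 x by (simp add: w_def)
      then have "w \<noteq> 0\<^sub>v (Suc n)" using False n2 by auto
      ultimately have "w \<in> H_pts n \<alpha>" using w by (simp add: H_pts points_def)
      moreover have "vec (Suc n) (\<lambda>i. ev x (y i)) = w"
        using x n2 by (intro eq_vecI) (auto simp: w_def y_def ev_hom.hom_minus ev_linear_form unit_vec_def)
      ultimately show ?thesis using Fz ev_subst[of "Suc n" F x y] Fv
        by (simp add: ev_hom.hom_mult lessThan_Suc_atMost)
    qed (simp add: ev_hom.hom_mult)
  next
    show "peval const y F * var 2 \<in> carrier (Sring n)"
      unfolding carrier_Sring by (intro vars_in_mult vars_in_subst[OF Fv] yv vars_in_var) (use n2 in auto)
  qed
  moreover have "var 2 \<noteq> (0 :: nat cpoly)"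
  proof
    assume "var 2 = (0 :: nat cpoly)"
    then have "keys (var 2 :: nat cpoly) = {}" by simp
    then show False by (simp add: var_def)
  qed
  ultimately have "peval const y F = 0" by simp
  then show "F \<in> {A * u + B * v | u v. vars_in {..n} u \<and> vars_in {..n} v}" using uv by auto
next
  fix F assume "F \<in> {A * u + B * v | u v. vars_in {..n} u \<and> vars_in {..n} v}"
  then show "F \<in> vanish n (H_pts n \<alpha>)"
    by (auto simp: vanish_def carrier_Sring H_pts points_def ev_hom.hom_add ev_hom.hom_mult ev_linear_form)
qed

lemma linear_in_PH:
  "l \<in> vanish n (H_pts n \<alpha>) \<and> homog 1 l \<longleftrightarrow> (\<exists>s t. l = const s * A + const t * B)"
proof
  assume l: "l \<in> vanish n (H_pts n \<alpha>) \<and> homog 1 l"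
  then obtain u v where uv: "l = A * u + B * v" unfolding vanish_H by blast
  have "l = hpart 1 (A * u + B * v)" using l uv by (simp add: homog_hpart_eq)
  also have "\<dots> = A * hpart 0 u + B * hpart 0 v"
    unfolding hpart_add hpart_mult[OF homog_linear_form(1)] by simp
  finally have l: "l = A * hpart 0 u + B * hpart 0 v" .
  obtain s t where "hpart 0 u = const s" "hpart 0 v = const t" by (metis homog_deg0 homog_hpart)
  then show "\<exists>s t. l = const s * A + const t * B" using l by (auto simp: mult.commute)
next
  assume "\<exists>s t. l = const s * A + const t * B"
  then obtain s t where l: "l = A * const s + B * const t" by (auto simp: mult.commute)
  then have "homog 1 l" by (metis homog_add homog_const_mult homog_linear_form(1) mult.commute)
  then show "l \<in> vanish n (H_pts n \<alpha>) \<and> homog 1 l" unfolding vanish_H using l vars_in_const by blast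
qed

lemma A_vanish: "A \<in> vanish n (H_pts n \<alpha>)" and B_vanish: "B \<in> vanish n (H_pts n \<alpha>)"
proof -
  have "A = const 1 * A + const 0 * B" "B = const 0 * A + const 1 * B" by simp_all
  then show "A \<in> vanish n (H_pts n \<alpha>)" "B \<in> vanish n (H_pts n \<alpha>)" using linear_in_PH by blast+
qed

text \<open>By \<open>e(M\<^sub>0) = D B\<close> and \<open>e(M\<^sub>1) = - D A\<close> the linear forms in \<open>A, B\<close> are values of the substitution.\<close>

lemma carrier_PH: "carrier (PH n \<alpha>) = psi ` carrier (Sring n)"
proof (intro equalityI subsetI)
  fix q assume "q \<in> carrier (PH n \<alpha>)"
  then have "q \<in> generate_ring (Sring n) (range const \<union> {l \<in> vanish n (H_pts n \<alpha>). homog 1 l})"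
    by (simp add: PH_def)
  then show "q \<in> psi ` carrier (Sring n)"
  proof (induction rule: generate_ring.induct)
    case one
    show ?case by (rule image_eqI[of _ _ 1]) (simp_all add: carrier_Sring)
  next
    case (incl h)
    show ?case
    proof (cases "h \<in> range const")
      case True
      then obtain c where "h = const c" by blast
      then show ?thesis by (intro image_eqI[of _ _ "const c"]) (simp_all add: carrier_Sring)
    next
      case False
      then obtain s t where h: "h = const s * A + const t * B" using incl linear_in_PH by blast
      have "psi (const (- s / D) * var (Suc 0) + const (t / D) * var 0) =
          const (- s / D) * (- (const D * A)) + const (t / D) * (const D * B)"
        by (simp add: subst_hom.hom_add subst_hom.hom_mult e_coord_0 e_coord_1)
      also have "\<dots> = h"
        unfolding h by (simp add: mult.assoc[symmetric] const_hom.hom_mult[symmetric] const_hom.hom_uminus[symmetric]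
            minus_mult_left del: mult_minus_left)
      finally have "h = psi (const (- s / D) * var (Suc 0) + const (t / D) * var 0)" by simp
      moreover have "const (- s / D) * var (Suc 0) + const (t / D) * var 0 \<in> carrier (Sring n)"
        using n2 by (simp add: carrier_Sring)
      ultimately show ?thesis by blast
    qed
  next
    case (a_inv h)
    then obtain p where "vars_in {..n} p" "h = psi p" by (auto simp: carrier_Sring)
    then show ?case by (intro image_eqI[of _ _ "- p"]) (simp_all add: carrier_Sring subst_hom.hom_uminus)
  next
    case (eng_add h1 h2)
    then obtain p q where "vars_in {..n} p" "h1 = psi p" "vars_in {..n} q" "h2 = psi q" by (auto simp: carrier_Sring)
    then show ?case by (intro image_eqI[of _ _ "p + q"]) (simp_all add: carrier_Sring subst_hom.hom_add)
  next
    case (eng_mult h1 h2)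
    then obtain p q where "vars_in {..n} p" "h1 = psi p" "vars_in {..n} q" "h2 = psi q" by (auto simp: carrier_Sring)
    then show ?case by (intro image_eqI[of _ _ "p * q"]) (simp_all add: carrier_Sring subst_hom.hom_mult)
  qed
next
  fix q assume "q \<in> psi ` carrier (Sring n)"
  then obtain p where p: "vars_in {..n} p" "q = psi p" by (auto simp: carrier_Sring)
  let ?G = "generate_ring (Sring n) (range const \<union> {l \<in> vanish n (H_pts n \<alpha>). homog 1 l})"
  have "psi p \<in> ?G" using p(1)
  proof (induction rule: vars_in_induct)
    case (const c)
    then show ?case by (auto intro: generate_ring.incl)
  next
    case (var i)
    then have "e_coord n \<alpha> i = const (- D * b $ i) * A + const (D * a $ i) * B"
      by (simp add: e_coord const_hom.hom_mult const_hom.hom_uminus algebra_simps)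
    then have "e_coord n \<alpha> i \<in> {l \<in> vanish n (H_pts n \<alpha>). homog 1 l}" using linear_in_PH by blast
    then show ?case by (auto intro: generate_ring.incl)
  next
    case (add p q)
    then show ?case using generate_ring.eng_add[of "psi p" "Sring n" _ "psi q"] by (simp add: subst_hom.hom_add)
  next
    case (mult p q)
    then show ?case using generate_ring.eng_mult[of "psi p" "Sring n" _ "psi q"] by (simp add: subst_hom.hom_mult)
  qed
  then show "q \<in> carrier (PH n \<alpha>)" by (simp add: PH_def p)
qed

lemma PH_simps [simp]:
  "x \<otimes>\<^bsub>PH n \<alpha>\<^esub> y = x * y" "x \<oplus>\<^bsub>PH n \<alpha>\<^esub> y = x + y" "\<one>\<^bsub>PH n \<alpha>\<^esub> = 1" "\<zero>\<^bsub>PH n \<alpha>\<^esub> = 0"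
  by (simp_all add: PH_def)

lemma PH_comp_iff: "q \<in> PH_comp n \<alpha> d \<longleftrightarrow> (\<exists>p. vars_in {..n} p \<and> homog d p \<and> q = psi p)"
proof
  assume "q \<in> PH_comp n \<alpha> d"
  then obtain p where p: "vars_in {..n} p" "q = psi p" "homog d q"
    unfolding PH_comp_def carrier_PH by (auto simp: carrier_Sring)
  then have "q = psi (hpart d p)" using hpart_psi[of p d] homog_hpart_eq[of d q] by simp
  then show "\<exists>p. vars_in {..n} p \<and> homog d p \<and> q = psi p" using p vars_in_hpart homog_hpart by blast
qed (auto simp: PH_comp_def carrier_PH carrier_Sring homog_psi)

lemma PH_closed:
  "p \<in> carrier (PH n \<alpha>) \<Longrightarrow> q \<in> carrier (PH n \<alpha>) \<Longrightarrow> p + q \<in> carrier (PH n \<alpha>)"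
  "p \<in> carrier (PH n \<alpha>) \<Longrightarrow> q \<in> carrier (PH n \<alpha>) \<Longrightarrow> p * q \<in> carrier (PH n \<alpha>)"
  "p \<in> carrier (PH n \<alpha>) \<Longrightarrow> - p \<in> carrier (PH n \<alpha>)"
  "const c \<in> carrier (PH n \<alpha>)" "A \<in> carrier (PH n \<alpha>)" "B \<in> carrier (PH n \<alpha>)"
proof -
  show ab: "A \<in> carrier (PH n \<alpha>)" "B \<in> carrier (PH n \<alpha>)"
    using A_vanish B_vanish by (auto simp: PH_def intro!: generate_ring.incl)
  show "const c \<in> carrier (PH n \<alpha>)" by (auto simp: PH_def intro: generate_ring.incl)
  show add: "p \<in> carrier (PH n \<alpha>) \<Longrightarrow> q \<in> carrier (PH n \<alpha>) \<Longrightarrow> p + q \<in> carrier (PH n \<alpha>)"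
    using generate_ring.eng_add[of p "Sring n" _ q] by (simp add: PH_def)
  show mult: "p \<in> carrier (PH n \<alpha>) \<Longrightarrow> q \<in> carrier (PH n \<alpha>) \<Longrightarrow> p * q \<in> carrier (PH n \<alpha>)" for p q
    using generate_ring.eng_mult[of p "Sring n" _ q] by (simp add: PH_def)
  show "- p \<in> carrier (PH n \<alpha>)" if "p \<in> carrier (PH n \<alpha>)"
  proof -
    have "const (- 1) \<in> carrier (PH n \<alpha>)" by (auto simp: PH_def intro: generate_ring.incl)
    from mult[OF this that] show ?thesis by (simp add: const_hom.hom_uminus)
  qed
qed

lemma PH_power: "p \<in> carrier (PH n \<alpha>) \<Longrightarrow> p ^ j \<in> carrier (PH n \<alpha>)"
  using PH_closed(2) PH_closed(4)[of 1] by (induction j) auto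

lemma subst_e_iso: "subst_e n \<alpha> \<in> ring_iso (SL n \<alpha>) (PH n \<alpha>)"
  and cring_PH: "cring (PH n \<alpha>)"
proof -
  interpret h: ring_hom_ring "Sring n" "Sring n" psi
  proof (rule ring_hom_ringI2)
    show "psi \<in> Ring.ring_hom (Sring n) (Sring n)"
      by (rule ring_hom_memI) (simp_all add: carrier_Sring subst_hom.hom_add subst_hom.hom_mult)
  qed (rule Sring.ring_axioms)+
  have k: "a_kernel (Sring n) (Sring n) psi = IL n \<alpha>"
    unfolding IL_eq a_kernel_def' Sring_simps ..
  have PH: "(Sring n)\<lparr>carrier := psi ` carrier (Sring n)\<rparr> = PH n \<alpha>"
    unfolding carrier_PH[symmetric] by (simp add: PH_def)
  have "(\<lambda>X. the_elem (psi ` X)) \<in> ring_iso (Sring n Quot IL n \<alpha>) (PH n \<alpha>)"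
    using h.FactRing_iso_set_aux unfolding k PH .
  moreover have "subst_e n \<alpha> = (\<lambda>X. the_elem (psi ` X))" by (simp add: subst_e_def fun_eq_iff)
  ultimately show "subst_e n \<alpha> \<in> ring_iso (SL n \<alpha>) (PH n \<alpha>)" by (simp add: SL_def)
  show "cring (PH n \<alpha>)" using h.img_is_cring[OF cring_Sring] unfolding PH .
qed

lemma cring_SL: "cring (SL n \<alpha>)"
  unfolding SL_def by (rule ideal.quotient_is_cring[OF ideal_IL cring_Sring])

lemma mem_coset_iff:
  assumes "p \<in> carrier (Sring n)"
  shows "q \<in> IL n \<alpha> +>\<^bsub>Sring n\<^esub> p \<longleftrightarrow> q \<in> carrier (Sring n) \<and> psi q = psi p"
proof
  assume "q \<in> IL n \<alpha> +>\<^bsub>Sring n\<^esub> p"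
  then show "q \<in> carrier (Sring n) \<and> psi q = psi p"
    using assms by (auto simp: a_r_coset_def' IL_eq carrier_Sring subst_hom.hom_add)
next
  assume q: "q \<in> carrier (Sring n) \<and> psi q = psi p"
  then have "q - p \<in> IL n \<alpha>" using assms by (simp add: IL_eq carrier_Sring subst_hom.hom_minus)
  then show "q \<in> IL n \<alpha> +>\<^bsub>Sring n\<^esub> p" by (auto simp: a_r_coset_def' intro!: bexI[of _ "q - p"])
qed

lemma subst_e_coset:
  assumes "p \<in> carrier (Sring n)"
  shows "subst_e n \<alpha> (IL n \<alpha> +>\<^bsub>Sring n\<^esub> p) = psi p"
proof -
  have "psi ` (IL n \<alpha> +>\<^bsub>Sring n\<^esub> p) = {psi p}" using mem_coset_iff[OF assms] assms by blast
  then show ?thesis by (simp add: subst_e_def)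
qed

lemma carrier_SL: "carrier (SL n \<alpha>) = (\<lambda>p. IL n \<alpha> +>\<^bsub>Sring n\<^esub> p) ` carrier (Sring n)"
  by (auto simp: SL_def FactRing_def A_RCOSETS_def' a_r_coset_def')

lemma coset_eq_iff:
  assumes "p \<in> carrier (Sring n)" "q \<in> carrier (Sring n)"
  shows "IL n \<alpha> +>\<^bsub>Sring n\<^esub> p = IL n \<alpha> +>\<^bsub>Sring n\<^esub> q \<longleftrightarrow> psi p = psi q"
proof
  assume "IL n \<alpha> +>\<^bsub>Sring n\<^esub> p = IL n \<alpha> +>\<^bsub>Sring n\<^esub> q"
  then show "psi p = psi q" using subst_e_coset[OF assms(1)] subst_e_coset[OF assms(2)] by simp
next
  assume e: "psi p = psi q"
  show "IL n \<alpha> +>\<^bsub>Sring n\<^esub> p = IL n \<alpha> +>\<^bsub>Sring n\<^esub> q"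
    by (rule Set.set_eqI) (simp only: mem_coset_iff[OF assms(1)] mem_coset_iff[OF assms(2)] e)
qed

section \<open>Powers of the ideal of \<open>H\<close>\<close>

text \<open>Forms of degree \<open>d\<close> in \<open>A, B\<close> with coefficients in \<open>C\<close>, written in Horner form. For
  \<open>C = \<complex>\<close> these are the components of \<open>P\<close>, for \<open>C = S\<close> the powers of \<open>I(H) = (A, B)\<close>.\<close>

primrec adic :: "nat cpoly set \<Rightarrow> nat \<Rightarrow> nat cpoly set" where
  "adic C 0 = C"
| "adic C (Suc d) = {c * A ^ Suc d + B * q | c q. c \<in> C \<and> q \<in> adic C d}"

lemma adic_add:
  assumes "\<And>x y. x \<in> C \<Longrightarrow> y \<in> C \<Longrightarrow> x + y \<in> C"
  shows "x \<in> adic C d \<Longrightarrow> y \<in> adic C d \<Longrightarrow> x + y \<in> adic C d"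
proof (induction d arbitrary: x y)
  case (Suc d)
  then obtain c q c' q' where "c \<in> C" "c' \<in> C" "q \<in> adic C d" "q' \<in> adic C d"
    and "x = c * A ^ Suc d + B * q" "y = c' * A ^ Suc d + B * q'" by auto
  moreover from this have "x + y = (c + c') * A ^ Suc d + B * (q + q')" by (simp add: algebra_simps)
  ultimately show ?case using Suc.IH assms unfolding adic.simps by blast
qed (use assms in auto)

lemma adic_scale:
  assumes "\<And>x. x \<in> C \<Longrightarrow> r * x \<in> C"
  shows "x \<in> adic C d \<Longrightarrow> r * x \<in> adic C d"
proof (induction d arbitrary: x)
  case (Suc d)
  then obtain c q where "c \<in> C" "q \<in> adic C d" "x = c * A ^ Suc d + B * q" by auto
  moreover from this have "r * x = (r * c) * A ^ Suc d + B * (r * q)" by (simp add: algebra_simps)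
  ultimately show ?case using Suc.IH assms unfolding adic.simps by blast
qed (use assms in auto)

lemma adic_zero: "0 \<in> C \<Longrightarrow> 0 \<in> adic C d"
proof (induction d)
  case (Suc d)
  then show ?case by simp (rule exI[of _ 0], rule exI[of _ 0], simp)
qed simp

lemma adic_B: "0 \<in> C \<Longrightarrow> x \<in> adic C d \<Longrightarrow> B * x \<in> adic C (Suc d)"
  by simp (rule exI[of _ 0], rule exI[of _ x], simp)

lemma adic_A:
  assumes "0 \<in> C"
  shows "x \<in> adic C d \<Longrightarrow> A * x \<in> adic C (Suc d)"
proof (induction d arbitrary: x)
  case 0
  then show ?case using assms by simp (rule exI[of _ x], rule exI[of _ 0], simp add: mult.commute)
next
  case (Suc d)
  then obtain c q where c: "c \<in> C" "q \<in> adic C d" "x = c * A ^ Suc d + B * q" by auto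
  then have "A * x = c * A ^ Suc (Suc d) + B * (A * q)" by (simp add: algebra_simps)
  moreover have "A * q \<in> adic C (Suc d)" using Suc.IH c by blast
  ultimately show ?case using c(1) unfolding adic.simps(2)[of C "Suc d"] by blast
qed

lemma adic_A_power: "0 \<in> C \<Longrightarrow> c \<in> C \<Longrightarrow> c * A ^ d \<in> adic C d"
proof (cases d)
  case (Suc e)
  assume "0 \<in> C" "c \<in> C"
  then show ?thesis unfolding Suc using adic_zero[of C e] by simp (rule exI[of _ c], rule exI[of _ 0], simp)
qed simp

lemma adic_const_closed:
  "x \<in> adic (range const) d \<Longrightarrow> y \<in> adic (range const) d \<Longrightarrow> x + y \<in> adic (range const) d"
  "x \<in> adic (range const) d \<Longrightarrow> const c * x \<in> adic (range const) d"
  by (rule adic_add; auto simp: const_hom.hom_add[symmetric] simp del: const_hom.hom_add)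
    (rule adic_scale; auto simp: const_hom.hom_mult[symmetric] simp del: const_hom.hom_mult)

lemma zero_range_const: "(0 :: nat cpoly) \<in> range const"
  by (metis const_hom.hom_zero rangeI)

lemma adic_const_linear:
  assumes "x \<in> adic (range const) d"
  shows "(const s * A + const t * B) * x \<in> adic (range const) (Suc d)"
proof -
  have "A * (const s * x) + B * (const t * x) \<in> adic (range const) (Suc d)"
    by (intro adic_const_closed(1) adic_A adic_B adic_const_closed(2) assms zero_range_const)
  then show ?thesis by (simp add: algebra_simps)
qed

text \<open>The substitution replaces a monomial of degree \<open>d\<close> by a product of \<open>d\<close> linear forms in \<open>A, B\<close>.\<close>

lemma psi_monomial_adic: "keys m \<subseteq> {..n} \<Longrightarrow> tdeg m = d \<Longrightarrow> psi (single m c) \<in> adic (range const) d"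
proof (induction d arbitrary: m)
  case 0
  then have "m = 0" by (simp add: tdeg_eq_0_iff)
  then show ?case by (simp add: const_def[symmetric])
next
  case (Suc d)
  then obtain i where i: "i \<in> keys m" by (metis equals0I keys_eq_empty tdeg_zero nat.distinct(1))
  have m: "m = single i 1 + (m - single i 1)"
    using i by (intro poly_mapping_eqI) (auto simp: lookup_add lookup_minus lookup_single when_def in_keys_iff)
  then have "tdeg m = 1 + tdeg (m - single i 1)" by (metis tdeg_add tdeg_single)
  then have t: "tdeg (m - single i 1) = d" using Suc.prems by simp
  have "keys (m - single i 1) \<subseteq> keys m" by (metis in_keys_iff lookup_minus subsetI zero_diff)
  then have IH: "psi (single (m - single i 1) c) \<in> adic (range const) d" using Suc t by (intro Suc.IH) auto
  have "single m c = var i * single (m - single i 1) c"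
    by (subst m) (simp add: var_def mult_single)
  then have "psi (single m c) = e_coord n \<alpha> i * psi (single (m - single i 1) c)" by (simp add: subst_hom.hom_mult)
  also have "e_coord n \<alpha> i = const (- D * b $ i) * A + const (D * a $ i) * B"
    using i Suc.prems by (auto simp: e_coord const_hom.hom_mult const_hom.hom_uminus algebra_simps)
  finally show ?case using adic_const_linear[OF IH] by simp
qed

lemma PH_comp_adic: "PH_comp n \<alpha> d = adic (range const) d"
proof (intro equalityI subsetI)
  fix q assume "q \<in> PH_comp n \<alpha> d"
  then obtain p where p: "vars_in {..n} p" "homog d p" "q = psi p" using PH_comp_iff by blast
  have "psi (\<Sum>m\<in>M. single m (lookup p m)) \<in> adic (range const) d" if "finite M" "M \<subseteq> keys p" for M
    using that
  proof (induction M rule: finite_induct)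
    case (insert m M)
    then have "psi (single m (lookup p m)) \<in> adic (range const) d"
      using p by (intro psi_monomial_adic) (auto simp: vars_in_def homog_def)
    then show ?case using insert adic_const_closed(1) by (simp add: subst_hom.hom_add)
  qed (simp add: adic_zero zero_range_const)
  then show "q \<in> adic (range const) d" using p sum_of_singles[of p] by (metis finite_keys order_refl)
next
  have "q \<in> carrier (PH n \<alpha>) \<and> homog d q" if "q \<in> adic (range const) d" for q using that
  proof (induction d arbitrary: q)
    case (Suc d)
    then obtain c q' where c: "q' \<in> adic (range const) d" "q = const c * A ^ Suc d + B * q'" by auto
    then have "q' \<in> carrier (PH n \<alpha>)" "homog d q'" using Suc by auto
    moreover have "homog (Suc d) (A ^ Suc d)" using homog_power[OF homog_linear_form(1), of "Suc d"] by simp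
    moreover have "homog (Suc d) (B * q')" using homog_mult[OF homog_linear_form(2) \<open>homog d q'\<close>] by simp
    moreover have "A ^ Suc d \<in> carrier (PH n \<alpha>)" by (rule PH_power[OF PH_closed(5)])
    ultimately show ?case unfolding c(2) using PH_closed by (metis homog_add homog_const_mult)
  qed (auto simp: PH_closed)
  then show "q \<in> PH_comp n \<alpha> d" if "q \<in> adic (range const) d" for q
    using that by (simp add: PH_comp_def)
qed

abbreviation IH_pow :: "nat \<Rightarrow> nat cpoly set" where
  "IH_pow d \<equiv> ideal_pow n (vanish n (H_pts n \<alpha>)) d"

lemma ideal_pow_simps:
  "ideal_pow n I 0 = carrier (Sring n)" "ideal_pow n I (Suc d) = ideal_prod (Sring n) (ideal_pow n I d) I"
  by (simp_all add: ideal_pow_def nat_pow_def ideals_set_def)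

lemma IH_pow_adic: "IH_pow d = adic (carrier (Sring n)) d"
proof (induction d)
  case 0
  show ?case by (simp add: ideal_pow_simps)
next
  case (Suc d)
  let ?S = "carrier (Sring n)"
  have z: "0 \<in> ?S" by (simp add: carrier_Sring)
  have add: "x \<in> adic ?S d \<Longrightarrow> y \<in> adic ?S d \<Longrightarrow> x + y \<in> adic ?S d" for x y d
    by (rule adic_add) (auto simp: carrier_Sring)
  have sc: "r \<in> ?S \<Longrightarrow> x \<in> adic ?S d \<Longrightarrow> r * x \<in> adic ?S d" for r x d
    by (rule adic_scale) (auto simp: carrier_Sring)
  have Apow: "A ^ j \<in> IH_pow j" for j
  proof (induction j)
    case 0 show ?case by (simp add: ideal_pow_simps carrier_Sring)
  next
    case (Suc j)
    from ideal_prod.prod[OF Suc A_vanish, of "Sring n"] show ?case by (simp add: ideal_pow_simps mult.commute)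
  qed
  show ?case
  proof (intro equalityI subsetI)
    fix x assume "x \<in> IH_pow (Suc d)"
    then have "x \<in> ideal_prod (Sring n) (adic ?S d) (vanish n (H_pts n \<alpha>))" by (simp add: ideal_pow_simps Suc)
    then show "x \<in> adic ?S (Suc d)"
    proof (induction rule: ideal_prod.induct)
      case (prod q l)
      then obtain u v where uv: "vars_in {..n} u" "vars_in {..n} v" "l = A * u + B * v" unfolding vanish_H by blast
      have "A * (u * q) + B * (v * q) \<in> adic ?S (Suc d)"
        by (intro add adic_A adic_B sc prod z) (use uv in \<open>simp_all add: carrier_Sring\<close>)
      then show ?case by (simp add: uv algebra_simps)
    next
      case (sum s1 s2)
      show ?case unfolding Sring_simps by (rule add[OF sum.IH])
    qed
  next
    fix x assume "x \<in> adic ?S (Suc d)"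
    then obtain c q where c: "c \<in> ?S" "q \<in> IH_pow d" "x = c * A ^ Suc d + B * q" by (auto simp: Suc)
    have "c * A = A * c + B * 0" by (simp add: mult.commute)
    then have A: "c * A \<in> vanish n (H_pts n \<alpha>)"
      unfolding vanish_H using c(1) vars_in_zero unfolding carrier_Sring by blast
    have "A ^ d * (c * A) + q * B \<in> IH_pow (Suc d)"
      using ideal_prod.sum[OF ideal_prod.prod[OF Apow[of d] A] ideal_prod.prod[OF c(2) B_vanish], where R = "Sring n"]
      by (simp add: ideal_pow_simps)
    then show "x \<in> IH_pow (Suc d)" by (simp add: c(3) algebra_simps)
  qed
qed

lemma adic_mono: "C \<subseteq> C' \<Longrightarrow> adic C d \<subseteq> adic C' d"
  by (induction d) fastforce+

lemma PH_comp_in_IH_pow: "PH_comp n \<alpha> d \<subseteq> IH_pow d"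
  unfolding PH_comp_adic IH_pow_adic by (rule adic_mono) (auto simp: carrier_Sring)

text \<open>Taking parts of degree \<open>d + k\<close> makes the coefficients of the binary form homogeneous of degree
  \<open>k\<close>, hence combinations of the \<open>X\<^sup>\<beta>\<close>; rearranging gives binary forms with constant coefficients
  in front of the \<open>X\<^sup>\<beta>\<close>.\<close>

lemma IH_pow_expand:
  assumes "F \<in> IH_pow d"
  shows "\<exists>q. (\<forall>\<beta>\<in>multi n k. q \<beta> \<in> PH_comp n \<alpha> d) \<and> hpart (d + k) F = (\<Sum>\<beta>\<in>multi n k. q \<beta> * xpow \<beta>)"
  using assms unfolding IH_pow_adic PH_comp_adic
proof (induction d arbitrary: F)
  case 0
  then have "vars_in {..n} (hpart k F)" by (simp add: carrier_Sring)
  from homog_expand[OF this homog_hpart]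
  show ?case by (intro exI[of _ "\<lambda>\<beta>. const (lookup (hpart k F) \<beta>)"]) simp
next
  case (Suc d)
  then obtain c G where c: "vars_in {..n} c" "G \<in> adic (carrier (Sring n)) d" "F = A ^ Suc d * c + B * G"
    by (auto simp: carrier_Sring mult.commute)
  obtain q where q: "\<forall>\<beta>\<in>multi n k. q \<beta> \<in> adic (range const) d" "hpart (d + k) G = (\<Sum>\<beta>\<in>multi n k. q \<beta> * xpow \<beta>)"
    using Suc.IH[OF c(2)] by blast
  have h: "homog (Suc d) (A ^ Suc d)" using homog_power[OF homog_linear_form(1), of "Suc d"] by simp
  have "hpart (Suc d + k) F = A ^ Suc d * hpart k c + B * hpart (d + k) G"
    unfolding c(3) hpart_add hpart_mult[OF h] hpart_mult[OF homog_linear_form(2)] by simp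
  also have "hpart k c = (\<Sum>\<beta>\<in>multi n k. const (lookup (hpart k c) \<beta>) * xpow \<beta>)"
    by (rule homog_expand) (use c in auto)
  finally have "hpart (Suc d + k) F =
      (\<Sum>\<beta>\<in>multi n k. (const (lookup (hpart k c) \<beta>) * A ^ Suc d + B * q \<beta>) * xpow \<beta>)"
    unfolding q(2) by (simp only: sum_distrib_left sum.distrib[symmetric]) (intro sum.cong refl, simp add: algebra_simps)
  moreover have "\<forall>\<beta>\<in>multi n k. const (lookup (hpart k c) \<beta>) * A ^ Suc d + B * q \<beta> \<in> adic (range const) (Suc d)"
    using q(1) by auto
  ultimately show ?case by (intro exI[of _ "\<lambda>\<beta>. const (lookup (hpart k c) \<beta>) * A ^ Suc d + B * q \<beta>"]) blast
qed

section \<open>Relations between the monomials over \<open>P\<close>\<close>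

text \<open>The substitution \<open>X\<^sub>1 \<mapsto> X\<^sub>1 - B\<close> kills \<open>B\<close> and fixes \<open>A\<close>, since \<open>b\<^sub>1 = 1\<close> and \<open>a\<^sub>1 = 0\<close>; so it kills
  \<open>C\<close>, and it is the identity modulo \<open>B\<close>.\<close>

lemma B_dvd:
  assumes C: "vars_in {..n} C" and e: "A ^ d * C + B * S = 0"
  obtains R where "vars_in {..n} R" "C = B * R"
proof -
  define y where "y i = (if i = Suc 0 then var (Suc 0) - B else var i)" for i :: nat
  have yv: "vars_in {..n} (y i)" if "i \<in> {..n}" for i using that by (auto simp: y_def)
  have lin: "peval const y (linear_form n w) = linear_form n w - const (w $ Suc 0) * B" for w
  proof -
    have "peval const y (linear_form n w) = (\<Sum>i\<le>n. const (w $ i) * var i - (if i = Suc 0 then const (w $ i) * B else 0))"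
      unfolding linear_form_def subst_hom.hom_sum
      by (intro sum.cong refl) (auto simp: subst_hom.hom_mult y_def algebra_simps linear_form_def)
    also have "\<dots> = linear_form n w - const (w $ Suc 0) * B"
      using n2 by (simp add: sum_subtractf linear_form_def[of n w])
    finally show ?thesis .
  qed
  have "peval const y (A ^ d * C + B * S) = A ^ d * peval const y C"
    by (simp add: subst_hom.hom_add subst_hom.hom_mult subst_hom.hom_power lin)
  then have "peval const y C = 0" using e A_nonzero by simp
  moreover have "\<exists>u v. vars_in {..n} u \<and> vars_in {..n} v \<and> peval const var C - peval const y C = B * u + 0 * v"
  proof (rule subst_cong_mod[OF C])
    fix i assume "i \<in> {..n}"
    show "\<exists>u v. vars_in {..n} u \<and> vars_in {..n} v \<and> var i - y i = B * u + 0 * v"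
      unfolding y_def by (rule exI[of _ "if i = Suc 0 then 1 else 0"], rule exI[of _ 0]) auto
  qed (use yv in auto)
  ultimately show thesis using that by auto
qed

text \<open>Write \<open>q\<^sub>\<beta> = c\<^sub>\<beta> A\<^sup>d\<^sup>+\<^sup>1 + B q\<^sub>\<beta>'\<close>. Then \<open>B\<close> divides \<open>C = \<Sum> c\<^sub>\<beta> X\<^sup>\<beta>\<close>, say \<open>C = B R\<close>, and the relation
  divided by \<open>B\<close> reads \<open>A\<^sup>d (A R) + \<Sum> q\<^sub>\<beta>' X\<^sup>\<beta> = 0\<close>. Expanding \<open>A R\<close> into monomials turns this
  into a relation of degree \<open>d\<close>, to which induction applies; the leftover terms are multiples of
  \<open>A b\<^sub>m - B a\<^sub>m\<close>, that is, of \<open>e(M\<^sub>m)\<close>.\<close>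

lemma relations:
  assumes "\<And>\<beta>. \<beta> \<in> multi n (Suc j) \<Longrightarrow> q \<beta> \<in> PH_comp n \<alpha> d"
    and "(\<Sum>\<beta>\<in>multi n (Suc j). q \<beta> * xpow \<beta>) = 0"
  shows "\<exists>r. (\<forall>\<gamma>. r \<gamma> \<in> carrier (PH n \<alpha>)) \<and>
    (\<forall>\<beta>\<in>multi n (Suc j). q \<beta> = lin_mult n j (e_coord n \<alpha>) r \<beta>)"
  using assms unfolding PH_comp_adic
proof (induction d arbitrary: q)
  case 0
  then have "\<forall>\<beta>\<in>multi n (Suc j). \<exists>c. q \<beta> = const c" by auto
  then obtain c where c: "\<And>\<beta>. \<beta> \<in> multi n (Suc j) \<Longrightarrow> q \<beta> = const (c \<beta>)" by metis
  have "(\<Sum>\<beta>\<in>multi n (Suc j). const (c \<beta>) * xpow \<beta>) = 0" using 0(2) by (simp add: c)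
  then have "c \<beta> = 0" if "\<beta> \<in> multi n (Suc j)" for \<beta> using lookup_const_sum[OF that, of c] by simp
  then have "q \<beta> = lin_mult n j (e_coord n \<alpha>) (\<lambda>_. 0) \<beta>" if "\<beta> \<in> multi n (Suc j)" for \<beta>
    using that c by (simp add: lin_mult_def)
  moreover have "0 \<in> carrier (PH n \<alpha>)" using PH_closed(4)[of 0] by simp
  ultimately show ?case by (intro exI[of _ "\<lambda>_. 0"]) auto
next
  case (Suc d)
  have "\<forall>\<beta>\<in>multi n (Suc j). \<exists>c q'. q \<beta> = const c * A ^ Suc d + B * q' \<and> q' \<in> adic (range const) d"
    using Suc.prems(1) by fastforce
  then obtain c q' where qc: "\<And>\<beta>. \<beta> \<in> multi n (Suc j) \<Longrightarrow> q \<beta> = const (c \<beta>) * A ^ Suc d + B * q' \<beta>"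
    and q': "\<And>\<beta>. \<beta> \<in> multi n (Suc j) \<Longrightarrow> q' \<beta> \<in> adic (range const) d" by metis
  define C where "C = (\<Sum>\<beta>\<in>multi n (Suc j). const (c \<beta>) * xpow \<beta>)"
  define S where "S = (\<Sum>\<beta>\<in>multi n (Suc j). q' \<beta> * xpow \<beta>)"
  have Cv: "vars_in {..n} C" unfolding C_def by (intro vars_in_sum vars_in_mult) auto
  have Ch: "homog (Suc j) C" unfolding C_def by (intro homog_sum homog_const_mult homog_xpow)
  have "A ^ Suc d * C + B * S = (\<Sum>\<beta>\<in>multi n (Suc j). q \<beta> * xpow \<beta>)"
    unfolding C_def S_def sum_distrib_left sum.distrib[symmetric]
    by (intro sum.cong refl) (simp add: qc algebra_simps)
  then have e: "A ^ Suc d * C + B * S = 0" using Suc.prems(2) by simp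
  obtain R where R: "vars_in {..n} R" "C = B * R" using B_dvd[OF Cv e] by blast
  have Rh: "homog j R"
    by (rule homog_cancel[OF homog_linear_form(1) B_nonzero]) (use Ch R in simp)
  define r where "r \<gamma> = lookup R \<gamma>" for \<gamma>
  have Re: "R = (\<Sum>\<gamma>\<in>multi n j. const (r \<gamma>) * xpow \<gamma>)" unfolding r_def by (rule homog_expand[OF R(1) Rh])
  have form: "linear_form n w * R =
      (\<Sum>\<beta>\<in>multi n (Suc j). const (lin_mult n j (($) w) r \<beta>) * xpow \<beta>)" for w
    unfolding lin_mult_const[symmetric] lin_mult_eval Re linear_form_def ..
  have cb: "c \<beta> = lin_mult n j (($) b) r \<beta>" if "\<beta> \<in> multi n (Suc j)" for \<beta>
  proof -
    have "(\<Sum>\<beta>\<in>multi n (Suc j). const (c \<beta>) * xpow \<beta>) =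
        (\<Sum>\<beta>\<in>multi n (Suc j). const (lin_mult n j (($) b) r \<beta>) * xpow \<beta>)"
      using R(2) form[of b] by (simp add: C_def)
    then show ?thesis
      using lookup_const_sum[OF that, of c] lookup_const_sum[OF that, of "lin_mult n j (($) b) r"] by simp
  qed
  define q'' where "q'' \<beta> = q' \<beta> + const (lin_mult n j (($) a) r \<beta>) * A ^ d" for \<beta>
  have q''d: "q'' \<beta> \<in> adic (range const) d" if "\<beta> \<in> multi n (Suc j)" for \<beta>
    unfolding q''_def by (intro adic_const_closed(1) q'[OF that] adic_A_power zero_range_const rangeI)
  have "B * (A ^ Suc d * R + S) = 0" using e R(2) by (simp add: algebra_simps)
  then have AS: "A ^ Suc d * R + S = 0" using B_nonzero by simp
  have "(\<Sum>\<beta>\<in>multi n (Suc j). q'' \<beta> * xpow \<beta>) = S + A ^ d * (A * R)"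
    unfolding form[of a] S_def sum_distrib_left sum.distrib[symmetric]
    by (intro sum.cong refl) (simp add: q''_def algebra_simps)
  then have "(\<Sum>\<beta>\<in>multi n (Suc j). q'' \<beta> * xpow \<beta>) = 0" using AS by (simp add: algebra_simps)
  from Suc.IH[OF q''d this] obtain r'' where r'': "\<And>\<gamma>. r'' \<gamma> \<in> carrier (PH n \<alpha>)"
    and q''e: "\<And>\<beta>. \<beta> \<in> multi n (Suc j) \<Longrightarrow> q'' \<beta> = lin_mult n j (e_coord n \<alpha>) r'' \<beta>" by blast
  define \<rho> where "\<rho> \<gamma> = B * r'' \<gamma> + (- (const (1 / D) * A ^ d)) * const (r \<gamma>)" for \<gamma>
  have "\<rho> \<gamma> \<in> carrier (PH n \<alpha>)" for \<gamma>
    unfolding \<rho>_def by (intro PH_closed PH_power r'')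
  moreover have "q \<beta> = lin_mult n j (e_coord n \<alpha>) \<rho> \<beta>" if \<beta>: "\<beta> \<in> multi n (Suc j)" for \<beta>
  proof -
    have "lin_mult n j (e_coord n \<alpha>) (\<lambda>\<gamma>. const (r \<gamma>)) \<beta> =
        lin_mult n j (\<lambda>m. const D * (B * const (a $ m) - A * const (b $ m))) (\<lambda>\<gamma>. const (r \<gamma>)) \<beta>"
      unfolding lin_mult_def by (intro sum.cong refl) (auto simp: e_coord mult.commute)
    also have "\<dots> = const D * (B * const (lin_mult n j (($) a) r \<beta>) - A * const (lin_mult n j (($) b) r \<beta>))"
      unfolding lin_mult_scale_left lin_mult_diff_left lin_mult_const ..
    finally have er: "lin_mult n j (e_coord n \<alpha>) (\<lambda>\<gamma>. const (r \<gamma>)) \<beta> = \<dots>" .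
    have D1: "const (1 / D) * const D = (1 :: nat cpoly)" by (simp add: const_hom.hom_mult[symmetric])
    have "lin_mult n j (e_coord n \<alpha>) \<rho> \<beta> =
        B * q'' \<beta> - (const (1 / D) * const D) * A ^ d *
          (B * const (lin_mult n j (($) a) r \<beta>) - A * const (lin_mult n j (($) b) r \<beta>))"
      unfolding \<rho>_def lin_mult_add_right lin_mult_scale_right er q''e[OF \<beta>, symmetric] by (simp add: algebra_simps)
    also have "\<dots> = const (c \<beta>) * A ^ Suc d + B * q' \<beta>"
      unfolding D1 q''_def cb[OF \<beta>] by (simp add: algebra_simps)
    finally show ?thesis using qc[OF \<beta>] by simp
  qed
  ultimately show ?case by blast
qed

end

section \<open>Derivations near the dual line\<close>

lemma meval_scale: "meval (\<lambda>i. c * x i) m = c ^ tdeg m * meval x m"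
  by (simp add: meval_def tdeg_def power_mult_distrib prod.distrib power_sum)

lemma subst_xpow: "peval const x (xpow \<beta>) = meval x \<beta>"
  by (subst peval_single) simp_all

lemma ev_xpow: "ev p (xpow \<beta>) = meval (($) p) \<beta>"
  by (simp add: ev_single)

lemma hom_meval: "comm_ring_hom h \<Longrightarrow> h (meval x m) = meval (\<lambda>i. h (x i)) m"
proof -
  assume "comm_ring_hom h"
  then interpret comm_ring_hom h .
  show ?thesis by (simp add: meval_def hom_prod hom_power)
qed

lemma apply_der_meval:
  "apply_der n k \<theta> g = (\<Sum>\<beta>\<in>multi n k. \<theta> \<beta> * meval (\<lambda>i. pdiff i g) \<beta>)"
  unfolding apply_der_def
proof (intro sum.cong refl)
  fix \<beta> assume "\<beta> \<in> multi n k"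
  then have "meval (\<lambda>i. pdiff i g) \<beta> = (\<Prod>i\<le>n. pdiff i g ^ lookup \<beta> i)"
    by (intro meval_superset) (auto simp: multi_def)
  then show "\<theta> \<beta> * (\<Prod>i\<le>n. pdiff i g ^ lookup \<beta> i) = \<theta> \<beta> * meval (\<lambda>i. pdiff i g) \<beta>" by simp
qed

lemma ideal_pow_ideal: "ideal I (Sring n) \<Longrightarrow> ideal (ideal_pow n I j) (Sring n)"
proof (induction j)
  case 0
  show ?case using Sring.oneideal by (simp add: ideal_pow_def nat_pow_def ideals_set_def)
next
  case (Suc j)
  then show ?case
    using Sring.ideal_prod_is_ideal by (simp add: ideal_pow_def nat_pow_def ideals_set_def)
qed

lemma ideal_pow_mult: "x \<in> ideal_pow n I j \<Longrightarrow> y \<in> I \<Longrightarrow> x * y \<in> ideal_pow n I (Suc j)"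
  using ideal_prod.prod[of x "ideal_pow n I j" y I "Sring n"]
  by (simp add: ideal_pow_def nat_pow_def ideals_set_def)

lemma one_in_ideal_pow_0: "1 \<in> ideal_pow n I 0"
  by (simp add: ideal_pow_def nat_pow_def ideals_set_def carrier_Sring)

lemma power_in_ideal_pow: "y \<in> I \<Longrightarrow> y ^ j \<in> ideal_pow n I j"
proof (induction j)
  case (Suc j)
  then show ?case using ideal_pow_mult[of "y ^ j" n I j y] by (simp add: mult.commute)
qed (simp add: one_in_ideal_pow_0)

lemma meval_in_ideal_pow:
  assumes "\<And>i. i \<in> keys m \<Longrightarrow> x i \<in> I"
  shows "meval x m \<in> ideal_pow n I (tdeg m)"
  using assms
proof (induction "tdeg m" arbitrary: m)
  case 0
  then have "m = 0" by (simp add: tdeg_eq_0_iff)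
  then show ?case by (simp add: one_in_ideal_pow_0)
next
  case (Suc d)
  then obtain i where i: "i \<in> keys m" by (metis equals0I keys_eq_empty tdeg_zero nat.distinct(1))
  have m: "m = single i 1 + (m - single i 1)"
    using i by (intro poly_mapping_eqI) (auto simp: lookup_add lookup_minus lookup_single when_def in_keys_iff)
  then have "tdeg m = 1 + tdeg (m - single i 1)" by (metis tdeg_add tdeg_single)
  then have t: "d = tdeg (m - single i 1)" using Suc.hyps by simp
  have "keys (m - single i 1) \<subseteq> keys m" by (metis in_keys_iff lookup_minus subsetI zero_diff)
  then have "meval x (m - single i 1) \<in> ideal_pow n I d" using Suc t by auto
  moreover have "meval x m = meval x (m - single i 1) * x i"
    by (subst m) (simp add: meval_add mult.commute)
  ultimately show ?case using ideal_pow_mult Suc i by metis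
qed

lemma carrier_Der: "\<theta> \<in> carrier (Der n k) \<longleftrightarrow> \<theta> \<in> extensional (multi n k) \<and> (\<forall>\<beta>\<in>multi n k. vars_in {..n} (\<theta> \<beta>))"
  by (auto simp: Der_def free_module_def PiE_def Pi_def carrier_Sring)

lemma module_Der: "module (Sring n) (Der n k)"
  unfolding Der_def by (rule free_module_is_module[OF cring_Sring])

lemma Der_ops:
  "x \<oplus>\<^bsub>Der n k\<^esub> y = (\<lambda>\<beta>\<in>multi n k. x \<beta> + y \<beta>)"
  "r \<odot>\<^bsub>Der n k\<^esub> x = (\<lambda>\<beta>\<in>multi n k. r * x \<beta>)"
  "\<zero>\<^bsub>Der n k\<^esub> = (\<lambda>\<beta>\<in>multi n k. 0)"
  by (simp_all add: Der_def free_module_def)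

text \<open>The value of \<open>\<theta>\<close> on the linear form dual to \<open>p\<close>.\<close>

definition contract :: "nat \<Rightarrow> nat \<Rightarrow> (mindex \<Rightarrow> nat cpoly) \<Rightarrow> complex vec \<Rightarrow> nat cpoly" where
  "contract n k \<theta> p = (\<Sum>\<beta>\<in>multi n k. \<theta> \<beta> * const (ev p (xpow \<beta>)))"

context general_line
begin

definition f :: "nat cpoly" where "f = arr_poly n Z"
definition f_off :: "complex vec \<Rightarrow> nat cpoly" where "f_off p = arr_poly n (Z - {p})"
definition J :: "nat cpoly set" where "J = jacobian_ideal n f"

lemma finite_Z: "finite Z" and Z_carrier: "Z \<subseteq> carrier_vec (Suc n)"
  using Z by (auto simp: distinct_points_def points_def)

lemma Z_vec [simp]: "p \<in> Z \<Longrightarrow> p \<in> carrier_vec (Suc n)"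
  using Z_carrier by blast

lemma Z_nonzero_entry: "p \<in> Z \<Longrightarrow> \<exists>i\<le>n. p $ i \<noteq> 0"
  using Z by (metis (no_types, lifting) DiffE carrier_vecD distinct_points_def eq_vecI index_zero_vec(1) index_zero_vec(2) less_Suc_eq_le points_def singletonI subsetD)

lemma f_split: "p \<in> Z \<Longrightarrow> f = linear_form n p * f_off p"
  using finite_Z by (simp add: f_def f_off_def arr_poly_def prod.remove)

lemma vars_in_f [simp]: "vars_in {..n} f" and vars_in_f_off [simp]: "vars_in {..n} (f_off p)"
  by (simp_all add: f_def f_off_def arr_poly_def)

lemma homog_f: "homog (card Z) f" and homog_f_off: "homog (card (Z - {p})) (f_off p)"
  using homog_prod[of Z "\<lambda>_. 1" "linear_form n"] homog_prod[of "Z - {p}" "\<lambda>_. 1" "linear_form n"]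
  by (simp_all add: f_def f_off_def arr_poly_def)

lemma pdiff_f: "p \<in> Z \<Longrightarrow> i \<le> n \<Longrightarrow>
    pdiff i f = const (p $ i) * f_off p + linear_form n p * pdiff i (f_off p)"
  unfolding f_def f_off_def by (rule pdiff_arr_poly[OF finite_Z])

lemma ideal_J: "ideal J (Sring n)"
  unfolding J_def jacobian_ideal_def by (rule Sring.genideal_ideal) (auto simp: carrier_Sring)

lemma pdiff_in_J: "i \<le> n \<Longrightarrow> pdiff i f \<in> J"
  unfolding J_def jacobian_ideal_def
proof -
  assume "i \<le> n"
  moreover have "(\<lambda>i. pdiff i f) ` {..n} \<subseteq> carrier (Sring n)" by (auto simp: carrier_Sring)
  from Sring.genideal_self[OF this] have "pdiff i f \<in> Idl\<^bsub>Sring n\<^esub> (\<lambda>i. pdiff i f) ` {..n}" if "i \<le> n"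
    using that by blast
  ultimately show "pdiff i f \<in> Idl\<^bsub>Sring n\<^esub> (\<lambda>i. pdiff i f) ` {..n}" by blast
qed

lemma J_pow:
  "ideal_pow n J j \<subseteq> carrier (Sring n)" "0 \<in> ideal_pow n J j"
  "x \<in> ideal_pow n J j \<Longrightarrow> y \<in> ideal_pow n J j \<Longrightarrow> x + y \<in> ideal_pow n J j"
  "x \<in> ideal_pow n J j \<Longrightarrow> vars_in {..n} r \<Longrightarrow> r * x \<in> ideal_pow n J j"
  using ideal_pow_ideal[OF ideal_J, of j] unfolding Sring_ideal_iff by (auto simp: carrier_Sring)

lemma carrier_Dk: "\<theta> \<in> carrier (Dk n k Z) \<longleftrightarrow> \<theta> \<in> carrier (Der n k) \<and>
    (\<exists>c\<in>ideal_pow n J (k - 1). apply_der n k \<theta> f = c * f)"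
  by (simp add: Dk_def f_def J_def)

lemma Dk_ops:
  "add (Dk n k Z) = add (Der n k)" "zero (Dk n k Z) = zero (Der n k)" "smult (Dk n k Z) = smult (Der n k)"
  by (simp_all add: Dk_def)

lemma apply_der_add: "apply_der n k (x \<oplus>\<^bsub>Der n k\<^esub> y) g = apply_der n k x g + apply_der n k y g"
  unfolding apply_der_def sum.distrib[symmetric] by (intro sum.cong refl) (simp add: Der_ops distrib_right)

lemma apply_der_smult: "apply_der n k (r \<odot>\<^bsub>Der n k\<^esub> x) g = r * apply_der n k x g"
  unfolding apply_der_def sum_distrib_left by (intro sum.cong refl) (simp add: Der_ops mult.assoc)

lemma module_Dk: "module (Sring n) (Dk n k Z)"
proof (rule module_pullback[OF module_Der cring_Sring, where \<phi> = "\<lambda>x. x"])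
  show "\<zero>\<^bsub>Der n k\<^esub> \<in> carrier (Dk n k Z)"
    unfolding carrier_Dk using J_pow(2)
    by (auto simp: carrier_Der Der_ops apply_der_def intro!: bexI[of _ 0])
  fix x y assume "x \<in> carrier (Dk n k Z)" "y \<in> carrier (Dk n k Z)"
  then obtain c e where "c \<in> ideal_pow n J (k - 1)" "e \<in> ideal_pow n J (k - 1)"
    and "apply_der n k x f = c * f" "apply_der n k y f = e * f" 
    and xy: "x \<in> carrier (Der n k)" "y \<in> carrier (Der n k)" unfolding carrier_Dk by blast
  then have "c + e \<in> ideal_pow n J (k - 1)" "apply_der n k (x \<oplus>\<^bsub>Der n k\<^esub> y) f = (c + e) * f"
    using J_pow(3) by (auto simp: apply_der_add distrib_right)
  moreover have "x \<oplus>\<^bsub>Der n k\<^esub> y \<in> carrier (Der n k)" using xy by (simp add: carrier_Der Der_ops)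
  ultimately show "x \<oplus>\<^bsub>Der n k\<^esub> y \<in> carrier (Dk n k Z)" unfolding carrier_Dk by blast
next
  fix r x assume r: "r \<in> carrier (Sring n)" and "x \<in> carrier (Dk n k Z)"
  then obtain c where "c \<in> ideal_pow n J (k - 1)" "apply_der n k x f = c * f" 
    and x: "x \<in> carrier (Der n k)" unfolding carrier_Dk by blast
  then have "r * c \<in> ideal_pow n J (k - 1)" "apply_der n k (r \<odot>\<^bsub>Der n k\<^esub> x) f = (r * c) * f"
    using J_pow(4) r by (auto simp: apply_der_smult carrier_Sring)
  moreover have "r \<odot>\<^bsub>Der n k\<^esub> x \<in> carrier (Der n k)" using x r by (simp add: carrier_Der Der_ops carrier_Sring)
  ultimately show "r \<odot>\<^bsub>Der n k\<^esub> x \<in> carrier (Dk n k Z)" unfolding carrier_Dk by blast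
qed (auto simp: Dk_ops carrier_Dk intro!: ring_hom_memI)

interpretation Dk: module "Sring n" "Dk n k Z"
  by (rule module_Dk)

text \<open>Every \<open>k\<close>-derivation maps \<open>f\<close> into \<open>J\<^sup>k\<close>, so \<open>f \<theta>\<close> always lies in the module.\<close>

lemma f_smult_in_Dk:
  assumes "\<theta> \<in> carrier (Der n k)"
  shows "f \<odot>\<^bsub>Der n k\<^esub> \<theta> \<in> carrier (Dk n k Z)"
proof -
  have "apply_der n k \<theta> f \<in> ideal_pow n J (k - 1)"
  proof -
    have t: "\<theta> \<beta> * meval (\<lambda>i. pdiff i f) \<beta> \<in> ideal_pow n J (k - 1)" if \<beta>: "\<beta> \<in> multi n k" for \<beta>
    proof -
      have "meval (\<lambda>i. pdiff i f) \<beta> \<in> ideal_pow n J k"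
        using meval_in_ideal_pow[of \<beta> "\<lambda>i. pdiff i f" J n] pdiff_in_J \<beta> by (auto simp: multi_def)
      moreover have "ideal_pow n J (Suc (k - 1)) \<subseteq> ideal_pow n J (k - 1)"
        using Sring.ideal_prod_inter[OF ideal_pow_ideal[OF ideal_J] ideal_J, of "k - 1"]
        by (auto simp: ideal_pow_simps)
      ultimately have "meval (\<lambda>i. pdiff i f) \<beta> \<in> ideal_pow n J (k - 1)" using k by auto
      then show ?thesis using J_pow(4) assms \<beta> by (simp add: carrier_Der)
    qed
    have "(\<Sum>\<beta>\<in>M. \<theta> \<beta> * meval (\<lambda>i. pdiff i f) \<beta>) \<in> ideal_pow n J (k - 1)"
      if "finite M" "M \<subseteq> multi n k" for M
      using that
    proof (induction M rule: finite_induct)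
      case (insert \<beta> M)
      then show ?case using J_pow(3)[OF t[of \<beta>]] by simp
    qed (simp add: J_pow(2))
    then show ?thesis unfolding apply_der_meval by simp
  qed
  moreover have "apply_der n k (f \<odot>\<^bsub>Der n k\<^esub> \<theta>) f = apply_der n k \<theta> f * f"
    by (simp add: apply_der_smult mult.commute)
  moreover have "f \<odot>\<^bsub>Der n k\<^esub> \<theta> \<in> carrier (Der n k)" using assms by (simp add: carrier_Der Der_ops)
  ultimately show ?thesis unfolding carrier_Dk by blast
qed

text \<open>Modulo the form of \<open>p\<close>, the derivatives of \<open>f\<close> are \<open>p\<^sub>i\<close> times the product of the other forms.\<close>

lemma apply_der_mod:
  assumes p: "p \<in> Z" and \<theta>: "\<theta> \<in> carrier (Der n k)"
  shows "\<exists>t. vars_in {..n} t \<and> apply_der n k \<theta> f = f_off p ^ k * contract n k \<theta> p + linear_form n p * t"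
proof -
  let ?x = "\<lambda>i. pdiff i f" and ?y = "\<lambda>i. f_off p * const (p $ i)"
  have "\<exists>t. vars_in {..n} t \<and> meval ?x \<beta> = f_off p ^ k * const (ev p (xpow \<beta>)) + linear_form n p * t"
    if \<beta>: "\<beta> \<in> multi n k" for \<beta>
  proof -
    have "\<exists>u v. vars_in {..n} u \<and> vars_in {..n} v \<and>
        peval const ?x (xpow \<beta>) - peval const ?y (xpow \<beta>) = linear_form n p * u + 0 * v"
    proof (rule subst_cong_mod)
      show "vars_in {..n} (xpow \<beta>)" using \<beta> by (rule vars_in_xpow)
      fix i assume "i \<in> {..n}"
      then have "?x i - ?y i = linear_form n p * pdiff i (f_off p) + 0 * 0"
        using pdiff_f[OF p, of i] by (simp add: mult.commute)
      then show "\<exists>u v. vars_in {..n} u \<and> vars_in {..n} v \<and> ?x i - ?y i = linear_form n p * u + 0 * v"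
        using vars_in_pdiff[OF vars_in_f_off] vars_in_zero by blast
    qed auto
    then obtain u where u: "vars_in {..n} u" "meval ?x \<beta> = meval ?y \<beta> + linear_form n p * u"
      by (auto simp: subst_xpow algebra_simps)
    have "meval ?y \<beta> = f_off p ^ k * meval (\<lambda>i. const (p $ i)) \<beta>"
      unfolding meval_scale using \<beta> by (simp add: multi_def)
    also have "meval (\<lambda>i. const (p $ i)) \<beta> = const (ev p (xpow \<beta>))"
      by (simp add: ev_xpow hom_meval[OF const_hom.comm_ring_hom_axioms])
    finally show ?thesis using u by auto
  qed
  then obtain t where t: "\<And>\<beta>. \<beta> \<in> multi n k \<Longrightarrow> vars_in {..n} (t \<beta>)"
    "\<And>\<beta>. \<beta> \<in> multi n k \<Longrightarrow> meval ?x \<beta> = f_off p ^ k * const (ev p (xpow \<beta>)) + linear_form n p * t \<beta>"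
    by metis
  have "apply_der n k \<theta> f = f_off p ^ k * contract n k \<theta> p + linear_form n p * (\<Sum>\<beta>\<in>multi n k. \<theta> \<beta> * t \<beta>)"
    unfolding apply_der_meval contract_def sum_distrib_left sum.distrib[symmetric]
    by (intro sum.cong refl) (simp add: t algebra_simps)
  moreover have "vars_in {..n} (\<Sum>\<beta>\<in>multi n k. \<theta> \<beta> * t \<beta>)"
    using \<theta> t by (intro vars_in_sum vars_in_mult) (auto simp: carrier_Der)
  ultimately show ?thesis by blast
qed

lemma epoint_dot: "q \<in> carrier_vec (Suc n) \<Longrightarrow> q \<bullet> epoint p = D * ((a \<bullet> q) * (b \<bullet> p) - (b \<bullet> q) * (a \<bullet> p))"
  unfolding epoint_def
  by (subst scalar_prod_add_distrib[of _ "Suc n"])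
    (simp_all add: comm_scalar_prod[of q "Suc n"] algebra_simps)

lemma ev_linear_form_epoint: "p \<in> Z \<Longrightarrow> ev (epoint p) (linear_form n p) = 0"
  by (simp add: ev_linear_form epoint_dot)

lemma ev_f_off_epoint: "p \<in> Z \<Longrightarrow> ev (epoint p) (f_off p) \<noteq> 0"
  using finite_Z separated
  by (auto simp: f_off_def arr_poly_def ev_hom.hom_prod ev_linear_form epoint_dot algebra_simps)

lemma epoint_Z_in_L: "p \<in> Z \<Longrightarrow> epoint p \<in> L_pts n \<alpha>"
  using epoint_in_L_pts off_H by simp

text \<open>The forms of the other points do not vanish at \<open>epoint p\<close>, while \<open>f\<close> does.\<close>

lemma Dk_contract:
  assumes \<theta>: "\<theta> \<in> carrier (Dk n k Z)" and p: "p \<in> Z"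
  shows "ev (epoint p) (contract n k \<theta> p) = 0"
proof -
  obtain c where c: "\<theta> \<in> carrier (Der n k)" "apply_der n k \<theta> f = c * f" using \<theta> carrier_Dk by blast
  obtain t where t: "apply_der n k \<theta> f = f_off p ^ k * contract n k \<theta> p + linear_form n p * t"
    using apply_der_mod[OF p c(1)] by blast
  have "f_off p ^ k * contract n k \<theta> p = linear_form n p * (c * f_off p - t)"
    using t c(2) f_split[OF p] by (simp add: algebra_simps)
  then have "ev (epoint p) (f_off p ^ k * contract n k \<theta> p) = 0"
    by (simp add: ev_hom.hom_mult ev_linear_form_epoint[OF p])
  then show ?thesis using ev_f_off_epoint[OF p] by (simp add: ev_hom.hom_mult ev_hom.hom_power)
qed

text \<open>The restriction of \<open>p\<close> to \<open>L\<close> is \<open>D ((a \<bullet> p) B - (b \<bullet> p) A)\<close>. Modulo it every form is a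
  constant multiple of a power of \<open>A\<close> or of \<open>B\<close>, whichever does not vanish at \<open>p\<close>, and the value at
  \<open>p\<close> shows that this constant is zero.\<close>

lemma PH_divides:
  assumes p: "p \<in> Z" and q: "q \<in> PH_comp n \<alpha> d" and z: "ev p q = 0"
  shows "\<exists>q'\<in>carrier (PH n \<alpha>). q = psi (linear_form n p) * q'"
proof -
  define ap where "ap = a \<bullet> p"
  define bp where "bp = b \<bullet> p"
  have pl: "psi (linear_form n p) = const D * (const ap * B - const bp * A)"
  proof -
    have "psi (linear_form n p) = (\<Sum>i\<le>n. const D * (const (p $ i * a $ i) * B - const (p $ i * b $ i) * A))"
      unfolding linear_form_def[of n p] subst_hom.hom_sum
      by (intro sum.cong refl) (simp add: subst_hom.hom_mult e_coord const_hom.hom_mult algebra_simps)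
    also have "\<dots> = const D * (const (\<Sum>i\<le>n. p $ i * a $ i) * B - const (\<Sum>i\<le>n. p $ i * b $ i) * A)"
      by (simp only: sum_distrib_left[symmetric] sum_subtractf sum_distrib_right[symmetric] const_hom.hom_sum)
    finally show ?thesis
      using Z_vec[OF p] by (simp add: ap_def bp_def scalar_prod_def mult.commute lessThan_Suc_atMost[symmetric] atLeast0LessThan)
  qed
  have zero: "0 \<in> carrier (PH n \<alpha>)" using PH_closed(4)[of 0] by simp
  show ?thesis
  proof (cases "ap = 0")
    case False
    have B: "B = const (1 / ap) * (const (1 / D) * psi (linear_form n p) + const bp * A)"
    proof -
      have "const (1 / ap) * const ap = (1 :: nat cpoly)" "const (1 / D) * const D = (1 :: nat cpoly)"
        using False by (simp_all add: const_hom.hom_mult[symmetric])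
      then have e: "const (1 / ap) * (const ap * B) = B" "const (1 / D) * (const D * X) = X" for X :: "nat cpoly"
        by (simp_all only: mult.assoc[symmetric] mult_1_left)
      show ?thesis unfolding pl e(2) by (simp only: diff_add_cancel e(1))
    qed
    have "\<exists>c q'. q' \<in> carrier (PH n \<alpha>) \<and> q = const c * A ^ d + psi (linear_form n p) * q'"
      using q unfolding PH_comp_adic
    proof (induction d arbitrary: q)
      case 0
      then obtain c where "q = const c * A ^ 0 + psi (linear_form n p) * 0" by auto
      then show ?case using zero by blast
    next
      case (Suc d)
      then obtain c0 q1 where q1: "q1 \<in> adic (range const) d" "q = const c0 * A ^ Suc d + B * q1" by auto
      then obtain c1 q' where q': "q' \<in> carrier (PH n \<alpha>)" "q1 = const c1 * A ^ d + psi (linear_form n p) * q'"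
        using Suc.IH by blast
      have "q = const c0 * A ^ Suc d + const c1 * A ^ d * B + psi (linear_form n p) * (B * q')"
        unfolding q1(2) q'(2) by (simp add: algebra_simps)
      also have "const c1 * A ^ d * B = const c1 * A ^ d * (const (1 / ap) * (const (1 / D) * psi (linear_form n p) + const bp * A))"
        using B by simp
      finally have "q = const (c0 + c1 * (1 / ap) * bp) * A ^ Suc d +
          psi (linear_form n p) * (const (c1 * (1 / ap) * (1 / D)) * A ^ d + B * q')"
        unfolding const_hom.hom_add const_hom.hom_mult by (simp add: algebra_simps)
      moreover have "const (c1 * (1 / ap) * (1 / D)) * A ^ d + B * q' \<in> carrier (PH n \<alpha>)"
        by (intro PH_closed PH_power q')
      ultimately show ?case by blast
    qed
    then obtain c q' where c: "q' \<in> carrier (PH n \<alpha>)" "q = const c * A ^ d + psi (linear_form n p) * q'" by blast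
    have "ev p q = c * ap ^ d"
      unfolding c(2) pl using p by (simp add: ev_hom.hom_add ev_hom.hom_mult ev_hom.hom_minus ev_hom.hom_power ev_linear_form ap_def bp_def)
    then have "c = 0" using z False by simp
    then show ?thesis using c by auto
  next
    case True
    then have bp: "bp \<noteq> 0" using off_H[OF p] by (simp add: ap_def bp_def)
    have A: "A = psi (linear_form n p) * const (- 1 / (D * bp))"
    proof -
      have "const D * const bp * const (- 1 / (D * bp)) = (- 1 :: nat cpoly)"
        using bp by (simp add: const_hom.hom_mult[symmetric] const_hom.hom_uminus)
      moreover have "psi (linear_form n p) * const (- 1 / (D * bp)) = - (const D * const bp * const (- 1 / (D * bp))) * A"
        unfolding pl using True by (simp add: algebra_simps)
      ultimately show ?thesis by simp
    qed
    have "\<exists>c q'. q' \<in> carrier (PH n \<alpha>) \<and> q = const c * B ^ d + A * q'"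
      using q unfolding PH_comp_adic
    proof (induction d arbitrary: q)
      case 0
      then obtain c where "q = const c * B ^ 0 + A * 0" by auto
      then show ?case using zero by blast
    next
      case (Suc d)
      then obtain c0 q1 where q1: "q1 \<in> adic (range const) d" "q = const c0 * A ^ Suc d + B * q1" by auto
      then obtain c1 q' where q': "q' \<in> carrier (PH n \<alpha>)" "q1 = const c1 * B ^ d + A * q'"
        using Suc.IH by blast
      have "q = const c1 * B ^ Suc d + A * (const c0 * A ^ d + B * q')"
        unfolding q1(2) q'(2) by (simp add: algebra_simps)
      moreover have "const c0 * A ^ d + B * q' \<in> carrier (PH n \<alpha>)"
        by (intro PH_closed PH_power q')
      ultimately show ?case by blast
    qed
    then obtain c q' where c: "q' \<in> carrier (PH n \<alpha>)" "q = const c * B ^ d + A * q'" by blast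
    have "ev p q = c * bp ^ d"
      unfolding c(2) using p True by (simp add: ev_hom.hom_add ev_hom.hom_mult ev_hom.hom_power ev_linear_form ap_def bp_def)
    then have "c = 0" using z bp by simp
    then have "q = psi (linear_form n p) * (const (- 1 / (D * bp)) * q')" using c(2) A by (simp add: mult.assoc[symmetric])
    moreover have "const (- 1 / (D * bp)) * q' \<in> carrier (PH n \<alpha>)" by (intro PH_closed c)
    ultimately show ?thesis by blast
  qed
qed

text \<open>Divisibility on \<open>L\<close> lifts to \<open>S\<close> at the price of an element of \<open>I(L)\<close>. The homogeneous part of
  degree \<open>d\<close> makes that element homogeneous.\<close>

lemma point_ideal:
  assumes p: "p \<in> Z" and w: "vars_in {..n} w" "homog d w" and z: "ev (epoint p) w = 0"
  shows "\<exists>c u. c \<in> IL n \<alpha> \<and> homog d c \<and> vars_in {..n} u \<and> w = linear_form n p * u + c"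
proof -
  have "ev p (psi w) = 0" using z ev_psi[OF w(1) Z_vec[OF p]] by simp
  moreover have "psi w \<in> PH_comp n \<alpha> d" using w PH_comp_iff by blast
  ultimately have "\<exists>q'\<in>carrier (PH n \<alpha>). psi w = psi (linear_form n p) * q'"
    using PH_divides[OF p] by blast
  then obtain u where u: "vars_in {..n} u" "psi w = psi (linear_form n p) * psi u"
    unfolding carrier_PH by (auto simp: carrier_Sring)
  define c where "c = hpart d (w - linear_form n p * u)"
  have v: "vars_in {..n} (w - linear_form n p * u)" using w u by simp
  have "psi (w - linear_form n p * u) = 0" using u by (simp add: subst_hom.hom_minus subst_hom.hom_mult)
  then have "psi c = 0" unfolding c_def hpart_psi[OF v, symmetric] by simp
  then have cI: "c \<in> IL n \<alpha>" using psi_eq_0_iff v by (simp add: c_def)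
  have "hpart d w = hpart d (linear_form n p * u) + c"
    unfolding c_def hpart_add[symmetric] by simp
  then have "w = hpart d (linear_form n p * u) + c" using w homog_hpart_eq by simp
  moreover have "hpart d (linear_form n p * u) = linear_form n p * (if d < 1 then 0 else hpart (d - 1) u)"
    unfolding hpart_mult[OF homog_linear_form(1)] by simp
  ultimately show ?thesis using cI u
    by (intro exI[of _ c] exI[of _ "if d < 1 then 0 else hpart (d - 1) u"]) (auto simp: c_def)
qed

lemma ev_contract:
  "ev y (contract n k \<theta> p) = (\<Sum>\<beta>\<in>multi n k. ev y (\<theta> \<beta>) * ev p (xpow \<beta>))"
  by (simp add: contract_def ev_hom.hom_sum ev_hom.hom_mult)

text \<open>Subtracting from one coefficient of \<open>\<theta>\<close> a multiple of the element of \<open>I(L)\<close> from \<open>point_ideal\<close> makes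
  \<open>\<theta>(p)\<close> divisible by \<open>p\<close>, and then so is \<open>\<theta>(f)\<close>. The factor \<open>f_off p\<close> completes \<open>p\<close> to \<open>f\<close>, and
  a power of a derivative of \<open>f\<close> that is nonzero at \<open>epoint p\<close> brings the quotient into \<open>J\<^sup>k\<^sup>-\<^sup>1\<close>.\<close>

lemma local_fraction:
  assumes p: "p \<in> Z" and \<theta>: "\<theta> \<in> Der_comp n k d" and z: "ev (epoint p) (contract n k \<theta> p) = 0"
  shows "\<exists>g \<theta>' e. \<theta>' \<in> Der_comp n k d \<and> (\<forall>\<beta>\<in>multi n k. \<theta>' \<beta> - \<theta> \<beta> \<in> IL n \<alpha>) \<and>
    vars_in {..n} g \<and> homog e g \<and> ev (epoint p) g \<noteq> 0 \<and> g \<odot>\<^bsub>Der n k\<^esub> \<theta>' \<in> carrier (Dk n k Z) \<and>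
    (\<forall>q. ev q (f_off p) = 0 \<longrightarrow> ev q g = 0)"
proof -
  have \<theta>D: "\<theta> \<in> carrier (Der n k)" and \<theta>h: "\<And>\<beta>. \<beta> \<in> multi n k \<Longrightarrow> homog d (\<theta> \<beta>)"
    and \<theta>v: "\<And>\<beta>. \<beta> \<in> multi n k \<Longrightarrow> vars_in {..n} (\<theta> \<beta>)"
    using \<theta> by (auto simp: Der_comp_def carrier_Der)
  have w: "vars_in {..n} (contract n k \<theta> p)" "homog d (contract n k \<theta> p)"
    unfolding contract_def using \<theta>v \<theta>h
    by (auto intro!: vars_in_sum vars_in_mult homog_sum simp: mult.commute[of _ "const _"])
  obtain c u where c: "c \<in> IL n \<alpha>" "homog d c" and u: "vars_in {..n} u"
    and e: "contract n k \<theta> p = linear_form n p * u + c" using point_ideal[OF p w z] by blast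
  have cv: "vars_in {..n} c" using c(1) by (simp add: IL_def vanish_def carrier_Sring)
  obtain i where i: "i \<le> n" "p $ i \<noteq> 0" using Z_nonzero_entry[OF p] by blast
  \<comment> \<open>The monomial \<open>X\<^sub>i\<^sup>k\<close> does not vanish at \<open>p\<close>, so its coefficient can absorb \<open>c\<close>.\<close>
  let ?\<beta>0 = "single i k"
  have \<beta>0: "?\<beta>0 \<in> multi n k" using i by (auto simp: multi_def)
  define s :: "nat cpoly" where "s = const (1 / p $ i ^ k)"
  define \<theta>' where "\<theta>' = (\<lambda>\<beta>\<in>multi n k. \<theta> \<beta> - (if \<beta> = ?\<beta>0 then s * c else 0))"
  have sc: "homog d (s * c)" "vars_in {..n} (s * c)" "s * c \<in> IL n \<alpha>"
    using c cv ideal_IL unfolding s_def Sring_ideal_iff by (auto simp: carrier_Sring)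
  have \<theta>'c: "\<theta>' \<in> Der_comp n k d"
    using \<theta>v \<theta>h sc by (auto simp: Der_comp_def carrier_Der \<theta>'_def)
  have \<theta>'D: "\<theta>' \<in> carrier (Der n k)" using \<theta>'c by (simp add: Der_comp_def)
  have "IL n \<alpha> \<subseteq> carrier (Sring n)" "0 \<in> IL n \<alpha>" "\<And>x. x \<in> IL n \<alpha> \<Longrightarrow> - x \<in> IL n \<alpha>"
    by (auto simp: IL_eq carrier_Sring subst_hom.hom_uminus)
  then have diff: "\<forall>\<beta>\<in>multi n k. \<theta>' \<beta> - \<theta> \<beta> \<in> IL n \<alpha>" using sc by (auto simp: \<theta>'_def)
  have "contract n k \<theta>' p = (\<Sum>\<beta>\<in>multi n k. \<theta> \<beta> * const (ev p (xpow \<beta>)) -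
      (if \<beta> = ?\<beta>0 then s * c * const (ev p (xpow ?\<beta>0)) else 0))"
    unfolding contract_def by (intro sum.cong refl) (simp add: \<theta>'_def algebra_simps)
  also have "\<dots> = contract n k \<theta> p - s * c * const (ev p (xpow ?\<beta>0))"
    using \<beta>0 by (simp add: sum_subtractf contract_def)
  also have "s * c * const (ev p (xpow ?\<beta>0)) = (s * const (p $ i ^ k)) * c"
    by (simp add: ev_xpow mult_ac)
  also have "s * const (p $ i ^ k) = 1"
    using i by (simp add: s_def const_hom.hom_mult[symmetric])
  finally have con: "contract n k \<theta>' p = linear_form n p * u" by (simp add: e)
  obtain t where t: "vars_in {..n} t" "apply_der n k \<theta>' f = f_off p ^ k * contract n k \<theta>' p + linear_form n p * t"
    using apply_der_mod[OF p \<theta>'D] by blast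
  define t' where "t' = f_off p ^ k * u + t"
  have t': "vars_in {..n} t'" "apply_der n k \<theta>' f = linear_form n p * t'"
    using t u by (simp_all add: t'_def con algebra_simps)
  define g where "g = f_off p * pdiff i f ^ (k - 1)"
  have "apply_der n k (g \<odot>\<^bsub>Der n k\<^esub> \<theta>') f = (t' * pdiff i f ^ (k - 1)) * f"
    unfolding apply_der_smult t' g_def using f_split[OF p] by (simp add: mult_ac)
  moreover have "t' * pdiff i f ^ (k - 1) \<in> ideal_pow n J (k - 1)"
    by (intro J_pow(4) power_in_ideal_pow pdiff_in_J i t')
  moreover have gv: "vars_in {..n} g" by (simp add: g_def)
  then have "g \<odot>\<^bsub>Der n k\<^esub> \<theta>' \<in> carrier (Der n k)" using \<theta>'D by (simp add: carrier_Der Der_ops)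
  ultimately have "g \<odot>\<^bsub>Der n k\<^esub> \<theta>' \<in> carrier (Dk n k Z)" unfolding carrier_Dk by blast
  moreover have "homog (card (Z - {p}) + (k - 1) * (card Z - 1)) g"
    unfolding g_def by (intro homog_mult homog_f_off homog_power homog_pdiff homog_f)
  moreover have "ev (epoint p) g \<noteq> 0"
    using ev_f_off_epoint[OF p] i ev_linear_form_epoint[OF p]
    by (simp add: g_def ev_hom.hom_mult ev_hom.hom_power pdiff_f[OF p i(1)] ev_hom.hom_add)
  moreover have "\<forall>q. ev q (f_off p) = 0 \<longrightarrow> ev q g = 0" by (simp add: g_def ev_hom.hom_mult)
  ultimately show ?thesis using \<theta>'c diff gv by blast
qed

end

section \<open>Sections over the dual line\<close>

context general_line
begin

interpretation Dk: module "Sring n" "Dk n k Z"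
  by (rule module_Dk)

abbreviation "N \<equiv> IL_D n k Z \<alpha>"
abbreviation "Q \<equiv> quot_module (Dk n k Z) N"

lemma Dk_smult: "r \<odot>\<^bsub>Dk n k Z\<^esub> x = r \<odot>\<^bsub>Der n k\<^esub> x"
  and Dk_add: "x \<oplus>\<^bsub>Dk n k Z\<^esub> y = x \<oplus>\<^bsub>Der n k\<^esub> y"
  and Dk_zero: "\<zero>\<^bsub>Dk n k Z\<^esub> = \<zero>\<^bsub>Der n k\<^esub>"
  by (simp_all add: Dk_ops)

lemma IL_D_gen: "x \<in> IL n \<alpha> \<Longrightarrow> \<theta> \<in> carrier (Dk n k Z) \<Longrightarrow> x \<odot>\<^bsub>Dk n k Z\<^esub> \<theta> \<in> N"
  unfolding IL_D_def by (intro generate.incl) blast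

lemma IL_sub: "x \<in> IL n \<alpha> \<Longrightarrow> x \<in> carrier (Sring n)"
  by (simp add: IL_def vanish_def)

text \<open>The generators are closed under negation, because \<open>I(L)\<close> is; so sums of generators suffice.\<close>

lemma IL_D_induct [consumes 1, case_names gen add]:
  assumes "x \<in> N"
    and gen: "\<And>y \<theta>. y \<in> IL n \<alpha> \<Longrightarrow> \<theta> \<in> carrier (Dk n k Z) \<Longrightarrow> P (y \<odot>\<^bsub>Dk n k Z\<^esub> \<theta>)"
    and add: "\<And>u v. u \<in> carrier (Dk n k Z) \<Longrightarrow> v \<in> carrier (Dk n k Z) \<Longrightarrow> P u \<Longrightarrow> P v \<Longrightarrow> P (u \<oplus>\<^bsub>Dk n k Z\<^esub> v)"
  shows "P x" and "x \<in> carrier (Dk n k Z)"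
proof -
  have il: "0 \<in> IL n \<alpha>" "\<And>y. y \<in> IL n \<alpha> \<Longrightarrow> - y \<in> IL n \<alpha>"
    by (auto simp: IL_eq carrier_Sring subst_hom.hom_uminus)
  have "x \<in> carrier (Dk n k Z) \<and> P x"
    using assms(1) unfolding IL_D_def
  proof (induction rule: generate.induct)
    case one
    have "\<zero>\<^bsub>Dk n k Z\<^esub> = 0 \<odot>\<^bsub>Dk n k Z\<^esub> \<zero>\<^bsub>Dk n k Z\<^esub>"
      using Dk.smult_l_null[of "\<zero>\<^bsub>Dk n k Z\<^esub>"] by simp
    then show ?case using gen[OF il(1), of "\<zero>\<^bsub>Dk n k Z\<^esub>"] by simp
  next
    case (incl h)
    then obtain y \<theta> where "y \<in> IL n \<alpha>" "\<theta> \<in> carrier (Dk n k Z)" "h = y \<odot>\<^bsub>Dk n k Z\<^esub> \<theta>" by blast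
    then show ?case using gen IL_sub by simp
  next
    case (inv h)
    then obtain y \<theta> where y: "y \<in> IL n \<alpha>" "\<theta> \<in> carrier (Dk n k Z)" "h = y \<odot>\<^bsub>Dk n k Z\<^esub> \<theta>" by blast
    then have "inv\<^bsub>add_monoid (Dk n k Z)\<^esub> h = (- y) \<odot>\<^bsub>Dk n k Z\<^esub> \<theta>"
      using IL_sub Dk.smult_l_minus[of y \<theta>] by (simp add: a_inv_def[symmetric])
    then show ?case using gen[OF il(2)[OF y(1)] y(2)] y IL_sub il(2) by simp
  next
    case (eng h1 h2)
    then show ?case using add by simp
  qed
  then show "P x" "x \<in> carrier (Dk n k Z)" by auto
qed

lemma IL_D_coeffs: "x \<in> N \<Longrightarrow> \<beta> \<in> multi n k \<Longrightarrow> psi (x \<beta>) = 0"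
  by (induction rule: IL_D_induct(1))
    (simp_all add: Dk_smult Dk_add Der_ops subst_hom.hom_add subst_hom.hom_mult IL_eq)

interpretation quotient_module "Sring n" "Dk n k Z" N
proof
  show "N \<subseteq> carrier (Dk n k Z)" using IL_D_induct(2)[where P = "\<lambda>_. True"] by blast
  show "\<zero>\<^bsub>Dk n k Z\<^esub> \<in> N"
    unfolding IL_D_def using generate.one[of "add_monoid (Dk n k Z)"] by simp
  show add: "x \<oplus>\<^bsub>Dk n k Z\<^esub> y \<in> N" if "x \<in> N" "y \<in> N" for x y
    using that generate.eng[of x "add_monoid (Dk n k Z)" _ y] unfolding IL_D_def by simp
  show "r \<odot>\<^bsub>Dk n k Z\<^esub> x \<in> N" if r: "r \<in> carrier (Sring n)" and x: "x \<in> N" for r x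
    using x
  proof (induction rule: IL_D_induct(1))
    case (gen y \<theta>)
    have "r * y \<in> IL n \<alpha>" using ideal_IL gen r unfolding Sring_ideal_iff by blast
    moreover have "r \<odot>\<^bsub>Dk n k Z\<^esub> (y \<odot>\<^bsub>Dk n k Z\<^esub> \<theta>) = (r * y) \<odot>\<^bsub>Dk n k Z\<^esub> \<theta>"
      using Dk.smult_assoc1[of r y \<theta>] r gen IL_sub by simp
    ultimately show ?case using IL_D_gen gen by simp
  next
    case (add u v)
    then show ?case using r \<open>\<And>x y. x \<in> N \<Longrightarrow> y \<in> N \<Longrightarrow> x \<oplus>\<^bsub>Dk n k Z\<^esub> y \<in> N\<close> by (simp add: Dk.smult_r_distr)
  qed
qed

interpretation Q: module "Sring n" Q
  by (rule module_quot)

abbreviation "cls \<theta> \<equiv> N +>\<^bsub>Dk n k Z\<^esub> \<theta>"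
abbreviation "gr \<equiv> quot_grading (Dk n k Z) N (Dk_comp n k Z)"

lemma Dk_comp_carrier: "\<theta> \<in> Dk_comp n k Z d \<Longrightarrow> \<theta> \<in> carrier (Dk n k Z)"
  by (simp add: Dk_comp_def)

lemma Dk_Der: "\<theta> \<in> carrier (Dk n k Z) \<Longrightarrow> \<theta> \<in> carrier (Der n k)"
  by (simp add: carrier_Dk)

lemma cls_eq_coeffs:
  assumes "\<theta> \<in> carrier (Dk n k Z)" "\<theta>' \<in> carrier (Dk n k Z)" "cls \<theta> = cls \<theta>'" "\<beta> \<in> multi n k"
  shows "psi (\<theta> \<beta>) = psi (\<theta>' \<beta>)"
proof -
  have "\<theta> \<in> cls \<theta>'" using N.a_rcos_self[OF assms(1)] assms(3) by simp
  then obtain m where m: "m \<in> N" "\<theta> = m \<oplus>\<^bsub>Dk n k Z\<^esub> \<theta>'" unfolding a_r_coset_def' by blast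
  have "\<theta> \<beta> = m \<beta> + \<theta>' \<beta>" unfolding m(2) Dk_add Der_ops using assms(4) by simp
  then show ?thesis using IL_D_coeffs[OF m(1) assms(4)] by (simp add: subst_hom.hom_add)
qed

lemma restr_eq_iff:
  assumes "\<theta> \<in> carrier (Der n k)" "\<theta>' \<in> carrier (Der n k)"
  shows "restr n k \<alpha> \<theta> = restr n k \<alpha> \<theta>' \<longleftrightarrow> (\<forall>\<beta>\<in>multi n k. psi (\<theta> \<beta>) = psi (\<theta>' \<beta>))"
proof -
  have c: "IL n \<alpha> +>\<^bsub>Sring n\<^esub> \<theta> \<beta> = IL n \<alpha> +>\<^bsub>Sring n\<^esub> \<theta>' \<beta> \<longleftrightarrow> psi (\<theta> \<beta>) = psi (\<theta>' \<beta>)"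
    if "\<beta> \<in> multi n k" for \<beta>
    using assms that by (intro line.coset_eq_iff[OF line_axioms]) (auto simp: carrier_Der carrier_Sring)
  have "restr n k \<alpha> \<theta> = restr n k \<alpha> \<theta>' \<longleftrightarrow>
      (\<forall>\<beta>\<in>multi n k. IL n \<alpha> +>\<^bsub>Sring n\<^esub> \<theta> \<beta> = IL n \<alpha> +>\<^bsub>Sring n\<^esub> \<theta>' \<beta>)"
    unfolding restr_def by (auto simp: fun_eq_iff restrict_def)
  then show ?thesis using c by simp
qed

lemma restr_cls:
  assumes "\<theta> \<in> carrier (Dk n k Z)"
  shows "the_elem (restr n k \<alpha> ` cls \<theta>) = restr n k \<alpha> \<theta>"
proof -
  have "restr n k \<alpha> \<theta>' = restr n k \<alpha> \<theta>" if t: "\<theta>' \<in> cls \<theta>" for \<theta>'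
  proof -
    have "cls \<theta>' = cls \<theta>" using N.a_repr_independence'[OF t] assms by simp
    moreover have "\<theta>' \<in> carrier (Dk n k Z)"
      using t assms N_sub by (auto simp: a_r_coset_def')
    ultimately show ?thesis using cls_eq_coeffs assms restr_eq_iff Dk_Der by metis
  qed
  moreover have "\<theta> \<in> cls \<theta>" using N.a_rcos_self assms by blast
  ultimately have "restr n k \<alpha> ` cls \<theta> = {restr n k \<alpha> \<theta>}" by blast
  then show ?thesis by simp
qed

lemma Der_L_smult:
  assumes "g \<in> carrier (Sring n)" "\<theta> \<in> carrier (Der n k)"
  shows "(IL n \<alpha> +>\<^bsub>Sring n\<^esub> g) \<odot>\<^bsub>Der_L n k \<alpha>\<^esub> restr n k \<alpha> \<theta> = restr n k \<alpha> (g \<odot>\<^bsub>Der n k\<^esub> \<theta>)"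
proof -
  have "(IL n \<alpha> +>\<^bsub>Sring n\<^esub> g) \<otimes>\<^bsub>SL n \<alpha>\<^esub> (IL n \<alpha> +>\<^bsub>Sring n\<^esub> \<theta> \<beta>) = IL n \<alpha> +>\<^bsub>Sring n\<^esub> (g * \<theta> \<beta>)"
    if "\<beta> \<in> multi n k" for \<beta>
    using ideal.rcoset_mult_add[OF ideal_IL assms(1), of "\<theta> \<beta>"] assms that
    by (simp add: SL_def FactRing_def carrier_Der carrier_Sring)
  then show ?thesis
    unfolding Der_L_def free_module_def restr_def Der_ops by (intro ext) (simp add: restrict_def)
qed

lemma psi_nonzero_on_L:
  assumes "y \<in> L_pts n \<alpha>" "vars_in {..n} h" "ev y h \<noteq> 0"
  shows "psi h \<noteq> 0"
proof
  assume "psi h = 0"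
  then have "h \<in> IL n \<alpha>" using psi_eq_0_iff assms by blast
  then show False using assms by (simp add: IL_def vanish_def)
qed

lemma fractionsE:
  assumes "(m, g) \<in> fractions n gr d q"
  obtains \<theta> e where "\<theta> \<in> Dk_comp n k Z (d + e)" "m = cls \<theta>" "vars_in {..n} g" "homog e g" "ev q g \<noteq> 0"
  using assms by (auto simp: fractions_def quot_grading_def carrier_Sring)

lemma fraction_in_Q:
  assumes "(m, g) \<in> fractions n gr d q"
  shows "m \<in> carrier Q" "g \<in> carrier (Sring n)" "ev q g \<noteq> 0" "\<exists>e. homog e g"
  using assms Dk_comp_carrier by (auto simp: fractions_def quot_grading_def carrier_quot)

lemma mem_germ: "(m, g) \<in> fractions n gr d q \<Longrightarrow> (m, g) \<in> germ n Q gr d q m g"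
  by (auto simp: germ_def carrier_Sring intro!: bexI[of _ 1] exI[of _ 0])

text \<open>Transitivity of equality of fractions: the witness is the product of both witnesses and the middle
  denominator.\<close>

lemma germ_subset:
  assumes f1: "(m1, g1) \<in> fractions n gr d q" and f2: "(m2, g2) \<in> fractions n gr d q"
    and h: "h \<in> carrier (Sring n)" "homog e h" "ev q h \<noteq> 0"
    and eq: "h \<odot>\<^bsub>Q\<^esub> (g2 \<odot>\<^bsub>Q\<^esub> m1) = h \<odot>\<^bsub>Q\<^esub> (g1 \<odot>\<^bsub>Q\<^esub> m2)"
  shows "germ n Q gr d q m1 g1 \<subseteq> germ n Q gr d q m2 g2"
proof (rule subrelI)
  fix m' g' assume "(m', g') \<in> germ n Q gr d q m1 g1"
  then obtain h' e' where f': "(m', g') \<in> fractions n gr d q" and h': "h' \<in> carrier (Sring n)" "homog e' h'" "ev q h' \<noteq> 0"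
    and eq': "h' \<odot>\<^bsub>Q\<^esub> (g' \<odot>\<^bsub>Q\<^esub> m1) = h' \<odot>\<^bsub>Q\<^esub> (g1 \<odot>\<^bsub>Q\<^esub> m')"
    by (auto simp: germ_def)
  note c1 = fraction_in_Q[OF f1] and c2 = fraction_in_Q[OF f2] and c' = fraction_in_Q[OF f']
  have as: "r \<odot>\<^bsub>Q\<^esub> (s \<odot>\<^bsub>Q\<^esub> m) = (r * s) \<odot>\<^bsub>Q\<^esub> m"
    if "r \<in> carrier (Sring n)" "s \<in> carrier (Sring n)" "m \<in> carrier Q" for r s m
    using Q.smult_assoc1[OF that] by simp
  have cl: "r * s \<in> carrier (Sring n)" if "r \<in> carrier (Sring n)" "s \<in> carrier (Sring n)" for r s
    using that by (simp add: carrier_Sring)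
  define H where "H = h * h' * g1"
  have "H \<odot>\<^bsub>Q\<^esub> (g' \<odot>\<^bsub>Q\<^esub> m2) = (h' * g') \<odot>\<^bsub>Q\<^esub> (h \<odot>\<^bsub>Q\<^esub> (g1 \<odot>\<^bsub>Q\<^esub> m2))"
    using c1 c2 c' h h' by (simp add: as cl H_def mult_ac)
  also have "\<dots> = (h * g2) \<odot>\<^bsub>Q\<^esub> (h' \<odot>\<^bsub>Q\<^esub> (g' \<odot>\<^bsub>Q\<^esub> m1))"
    unfolding eq[symmetric] using c1 c2 c' h h' by (simp add: as cl mult_ac)
  also have "\<dots> = H \<odot>\<^bsub>Q\<^esub> (g2 \<odot>\<^bsub>Q\<^esub> m')"
    unfolding eq' using c1 c2 c' h h' by (simp add: as cl H_def mult_ac)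
  finally have "H \<odot>\<^bsub>Q\<^esub> (g' \<odot>\<^bsub>Q\<^esub> m2) = H \<odot>\<^bsub>Q\<^esub> (g2 \<odot>\<^bsub>Q\<^esub> m')" .
  moreover have "H \<in> carrier (Sring n)" unfolding H_def using h h' c1 cl by simp
  moreover have "\<exists>e. homog e H" unfolding H_def using homog_mult h(2) h'(2) c1(4) by blast
  moreover have "ev q H \<noteq> 0" using h h' c1 by (simp add: H_def ev_hom.hom_mult)
  ultimately show "(m', g') \<in> germ n Q gr d q m2 g2" using f' by (auto simp: germ_def)
qed

lemma germ_eq:
  assumes f1: "(m1, g1) \<in> fractions n gr d q" and f2: "(m2, g2) \<in> fractions n gr d q"
    and h: "h \<in> carrier (Sring n)" "homog e h" "ev q h \<noteq> 0"
    and eq: "h \<odot>\<^bsub>Q\<^esub> (g2 \<odot>\<^bsub>Q\<^esub> m1) = h \<odot>\<^bsub>Q\<^esub> (g1 \<odot>\<^bsub>Q\<^esub> m2)"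
  shows "germ n Q gr d q m1 g1 = germ n Q gr d q m2 g2"
  using germ_subset[OF f1 f2 h eq] germ_subset[OF f2 f1 h eq[symmetric]] by blast

lemma smult_cls:
  assumes "r \<in> carrier (Sring n)" "\<theta> \<in> carrier (Dk n k Z)"
  shows "r \<odot>\<^bsub>Q\<^esub> cls \<theta> = cls (r \<odot>\<^bsub>Der n k\<^esub> \<theta>)" "r \<odot>\<^bsub>Der n k\<^esub> \<theta> \<in> carrier (Dk n k Z)"
  using smult_coset[OF assms] Dk.smult_closed[OF assms] by (simp_all add: Dk_smult)

text \<open>All members of one germ restrict to the same section: cross-multiplied equality in the
  quotient module restricts to equality of coefficients, and \<open>S/I(L)\<close> is a domain.\<close>

lemma germ_value:
  assumes y: "y \<in> L_pts n \<alpha>" and f0: "(cls \<theta>, g) \<in> fractions n gr d y"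
    and \<theta>: "\<theta> \<in> carrier (Dk n k Z)" and \<theta>0: "\<theta>0 \<in> carrier (Der n k)"
    and val: "\<And>\<beta>. \<beta> \<in> multi n k \<Longrightarrow> psi (\<theta> \<beta>) = psi g * psi (\<theta>0 \<beta>)"
    and m: "(m', g') \<in> germ n Q gr d y (cls \<theta>) g"
  shows "the_elem (restr n k \<alpha> ` m') = (IL n \<alpha> +>\<^bsub>Sring n\<^esub> g') \<odot>\<^bsub>Der_L n k \<alpha>\<^esub> restr n k \<alpha> \<theta>0"
proof -
  obtain h where h: "h \<in> carrier (Sring n)" "ev y h \<noteq> 0"
    and f': "(m', g') \<in> fractions n gr d y"
    and eq: "h \<odot>\<^bsub>Q\<^esub> (g' \<odot>\<^bsub>Q\<^esub> cls \<theta>) = h \<odot>\<^bsub>Q\<^esub> (g \<odot>\<^bsub>Q\<^esub> m')"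
    using m by (auto simp: germ_def)
  obtain \<theta>' e where \<theta>': "\<theta>' \<in> Dk_comp n k Z (d + e)" "m' = cls \<theta>'" "vars_in {..n} g'" using fractionsE[OF f'] by metis
  have g: "g \<in> carrier (Sring n)" "ev y g \<noteq> 0" using fraction_in_Q[OF f0] by auto
  have g': "g' \<in> carrier (Sring n)" using \<theta>' by (simp add: carrier_Sring)
  have \<theta>'D: "\<theta>' \<in> carrier (Dk n k Z)" using \<theta>' Dk_comp_carrier by blast
  have "cls (h \<odot>\<^bsub>Der n k\<^esub> (g' \<odot>\<^bsub>Der n k\<^esub> \<theta>)) = cls (h \<odot>\<^bsub>Der n k\<^esub> (g \<odot>\<^bsub>Der n k\<^esub> \<theta>'))"
    using eq h g g' \<theta> \<theta>'D unfolding \<theta>'(2) by (simp add: smult_cls)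
  moreover have "h \<odot>\<^bsub>Der n k\<^esub> (g' \<odot>\<^bsub>Der n k\<^esub> \<theta>) \<in> carrier (Dk n k Z)" "h \<odot>\<^bsub>Der n k\<^esub> (g \<odot>\<^bsub>Der n k\<^esub> \<theta>') \<in> carrier (Dk n k Z)"
    using h g g' \<theta> \<theta>'D by (auto intro!: smult_cls(2))
  ultimately have c': "psi ((h \<odot>\<^bsub>Der n k\<^esub> (g' \<odot>\<^bsub>Der n k\<^esub> \<theta>)) \<beta>) = psi ((h \<odot>\<^bsub>Der n k\<^esub> (g \<odot>\<^bsub>Der n k\<^esub> \<theta>')) \<beta>)"
    if "\<beta> \<in> multi n k" for \<beta> using cls_eq_coeffs that by blast
  have c: "psi (h * (g' * \<theta> \<beta>)) = psi (h * (g * \<theta>' \<beta>))" if "\<beta> \<in> multi n k" for \<beta>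
    using c'[OF that] that by (simp only: Der_ops restrict_apply' if_True)
  have nz: "psi h \<noteq> 0" "psi g \<noteq> 0"
    using psi_nonzero_on_L[OF y] h g by (auto simp: carrier_Sring)
  have "psi (\<theta>' \<beta>) = psi (g' * \<theta>0 \<beta>)" if \<beta>: "\<beta> \<in> multi n k" for \<beta>
  proof -
    have "(psi h * psi g) * psi (\<theta>' \<beta>) = (psi h * psi g) * (psi g' * psi (\<theta>0 \<beta>))"
      using c[OF \<beta>, symmetric] val[OF \<beta>] by (simp add: subst_hom.hom_mult mult_ac)
    moreover have "psi h * psi g \<noteq> 0" using nz mult_eq_0_iff by blast
    ultimately have "psi (\<theta>' \<beta>) = psi g' * psi (\<theta>0 \<beta>)" using mult_left_cancel by blast
    then show ?thesis unfolding subst_hom.hom_mult .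
  qed
  moreover have "g' \<odot>\<^bsub>Der n k\<^esub> \<theta>0 \<in> carrier (Der n k)"
    using g' \<theta>0 by (simp add: carrier_Der Der_ops carrier_Sring)
  ultimately have "restr n k \<alpha> \<theta>' = restr n k \<alpha> (g' \<odot>\<^bsub>Der n k\<^esub> \<theta>0)"
    using restr_eq_iff Dk_Der[OF \<theta>'D] by (simp add: Der_ops)
  then show ?thesis unfolding \<theta>'(2) restr_cls[OF \<theta>'D] Der_L_smult[OF g' \<theta>0] .
qed

lemma fractionI:
  assumes "\<theta> \<in> Dk_comp n k Z (d + e)" "vars_in {..n} g" "homog e g" "ev q g \<noteq> 0"
  shows "(cls \<theta>, g) \<in> fractions n gr d q"
  using assms by (auto simp: fractions_def quot_grading_def carrier_Sring)

lemma smult_Dk_comp: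
  assumes "\<theta> \<in> Der_comp n k d" "homog e g" "g \<odot>\<^bsub>Der n k\<^esub> \<theta> \<in> carrier (Dk n k Z)"
  shows "g \<odot>\<^bsub>Der n k\<^esub> \<theta> \<in> Dk_comp n k Z (d + e)"
  using assms homog_mult[OF assms(2)] by (auto simp: Dk_comp_def Der_comp_def Dk_Der Der_ops add.commute)

text \<open>The fraction \<open>g \<theta>' / g\<close> near the point on \<open>p\<close> agrees with \<open>f \<theta> / f\<close> off the arrangement:
  their cross-difference is \<open>g (\<theta>' - \<theta>)\<close> times \<open>f\<close>, which lies in \<open>I(L) D\<close>.\<close>

lemma fraction_compat:
  assumes g: "vars_in {..n} g" and \<theta>: "\<theta> \<in> carrier (Der n k)" "\<theta>' \<in> carrier (Der n k)"
    and diff: "\<forall>\<beta>\<in>multi n k. \<theta>' \<beta> - \<theta> \<beta> \<in> IL n \<alpha>"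
    and gD: "g \<odot>\<^bsub>Der n k\<^esub> \<theta>' \<in> carrier (Dk n k Z)"
  shows "f \<odot>\<^bsub>Q\<^esub> cls (g \<odot>\<^bsub>Der n k\<^esub> \<theta>') = g \<odot>\<^bsub>Q\<^esub> cls (f \<odot>\<^bsub>Der n k\<^esub> \<theta>)"
proof -
  have fS: "f \<in> carrier (Sring n)" "g \<in> carrier (Sring n)" using g by (simp_all add: carrier_Sring)
  have fD: "f \<odot>\<^bsub>Der n k\<^esub> \<theta> \<in> carrier (Dk n k Z)" by (rule f_smult_in_Dk[OF \<theta>(1)])
  define basis where "basis \<gamma> = (\<lambda>\<beta>\<in>multi n k. if \<beta> = \<gamma> then g else 0)" for \<gamma> :: mindex
  have bD: "f \<odot>\<^bsub>Der n k\<^esub> basis \<gamma> \<in> carrier (Dk n k Z)" for \<gamma>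
    by (rule f_smult_in_Dk) (simp add: carrier_Der basis_def g)
  have tN: "(\<theta>' \<gamma> - \<theta> \<gamma>) \<odot>\<^bsub>Dk n k Z\<^esub> (f \<odot>\<^bsub>Der n k\<^esub> basis \<gamma>) \<in> N" if "\<gamma> \<in> multi n k" for \<gamma>
    using diff that bD by (intro IL_D_gen) auto
  have part: "(\<lambda>\<beta>\<in>multi n k. if \<beta> \<in> M then (\<theta>' \<beta> - \<theta> \<beta>) * (f * g) else 0) \<in> N" if "finite M" "M \<subseteq> multi n k" for M
    using that
  proof (induction M rule: finite_induct)
    case empty
    have "(\<lambda>\<beta>\<in>multi n k. 0) \<in> N" using N_zero unfolding Dk_zero Der_ops .
    then show ?case by (simp only: empty_iff if_False)
  next
    case (insert \<gamma> M)
    have "(\<lambda>\<beta>\<in>multi n k. if \<beta> \<in> insert \<gamma> M then (\<theta>' \<beta> - \<theta> \<beta>) * (f * g) else 0) =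
        ((\<theta>' \<gamma> - \<theta> \<gamma>) \<odot>\<^bsub>Dk n k Z\<^esub> (f \<odot>\<^bsub>Der n k\<^esub> basis \<gamma>)) \<oplus>\<^bsub>Dk n k Z\<^esub>
        (\<lambda>\<beta>\<in>multi n k. if \<beta> \<in> M then (\<theta>' \<beta> - \<theta> \<beta>) * (f * g) else 0)"
      using insert.hyps by (auto simp: Dk_smult Dk_add Der_ops basis_def fun_eq_iff)
    moreover have "(\<lambda>\<beta>\<in>multi n k. if \<beta> \<in> M then (\<theta>' \<beta> - \<theta> \<beta>) * (f * g) else 0) \<in> N"
      using insert.IH insert.prems by blast
    moreover have "\<gamma> \<in> multi n k" using insert.prems by blast
    ultimately show ?case using N_add[OF tN] by presburger
  qed
  define \<delta> where "\<delta> = (\<lambda>\<beta>\<in>multi n k. (\<theta>' \<beta> - \<theta> \<beta>) * (f * g))"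
  have \<delta>: "\<delta> \<in> N" using part[of "multi n k"] unfolding \<delta>_def by (simp cong: restrict_cong)
  have l: "f \<odot>\<^bsub>Q\<^esub> cls (g \<odot>\<^bsub>Der n k\<^esub> \<theta>') = cls (f \<odot>\<^bsub>Der n k\<^esub> (g \<odot>\<^bsub>Der n k\<^esub> \<theta>'))"
    by (rule smult_cls(1)[OF fS(1) gD])
  have r: "g \<odot>\<^bsub>Q\<^esub> cls (f \<odot>\<^bsub>Der n k\<^esub> \<theta>) = cls (g \<odot>\<^bsub>Der n k\<^esub> (f \<odot>\<^bsub>Der n k\<^esub> \<theta>))"
    by (rule smult_cls(1)[OF fS(2) fD])
  have e: "f \<odot>\<^bsub>Der n k\<^esub> (g \<odot>\<^bsub>Der n k\<^esub> \<theta>') = \<delta> \<oplus>\<^bsub>Dk n k Z\<^esub> (g \<odot>\<^bsub>Der n k\<^esub> (f \<odot>\<^bsub>Der n k\<^esub> \<theta>))"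
    by (auto simp: \<delta>_def Dk_add Der_ops fun_eq_iff algebra_simps)
  have gfD: "g \<odot>\<^bsub>Der n k\<^esub> (f \<odot>\<^bsub>Der n k\<^esub> \<theta>) \<in> carrier (Dk n k Z)" by (rule smult_cls(2)[OF fS(2) fD])
  have "f \<odot>\<^bsub>Der n k\<^esub> (g \<odot>\<^bsub>Der n k\<^esub> \<theta>') \<in> cls (g \<odot>\<^bsub>Der n k\<^esub> (f \<odot>\<^bsub>Der n k\<^esub> \<theta>))"
    unfolding e a_r_coset_def' using \<delta> by blast
  then have "cls (f \<odot>\<^bsub>Der n k\<^esub> (g \<odot>\<^bsub>Der n k\<^esub> \<theta>')) = cls (g \<odot>\<^bsub>Der n k\<^esub> (f \<odot>\<^bsub>Der n k\<^esub> \<theta>))"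
    by (rule N.a_repr_independence'[symmetric]) (rule gfD)
  then show ?thesis unfolding l r .
qed

lemma eta_restr:
  assumes "\<theta> \<in> carrier (Der n k)"
  shows "eta n k \<alpha> (restr n k \<alpha> \<theta>) = (\<Sum>\<beta>\<in>multi n k. psi (\<theta> \<beta>) * xpow \<beta>)"
  unfolding eta_def using assms
  by (intro sum.cong refl) (simp add: restr_def subst_e_coset carrier_Der carrier_Sring)

lemma ev_eta:
  assumes "\<theta> \<in> carrier (Der n k)" "p \<in> Z"
  shows "ev p (eta n k \<alpha> (restr n k \<alpha> \<theta>)) = ev (epoint p) (contract n k \<theta> p)"
  unfolding eta_restr[OF assms(1)] ev_contract ev_hom.hom_sum
  by (intro sum.cong refl) (use assms in \<open>simp add: ev_hom.hom_mult ev_psi carrier_Der\<close>)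

lemma ev_contract_smult:
  assumes "\<theta> \<in> carrier (Der n k)"
  shows "ev y (contract n k (g \<odot>\<^bsub>Der n k\<^esub> \<theta>) p) = ev y g * ev y (contract n k \<theta> p)"
  unfolding ev_contract sum_distrib_left
  by (intro sum.cong refl) (simp add: Der_ops ev_hom.hom_mult)

text \<open>From left to right, a local fraction \<open>\<theta> / g\<close> at \<open>epoint p\<close> has \<open>\<eta>(\<theta>)(p) = 0\<close> and \<open>g\<close> is nonzero there.
  From right to left, \<open>f \<theta> / f\<close> and the fractions of \<open>local_fraction\<close> at the finitely many points of
  \<open>L\<close> on the arrangement cover \<open>L\<close> and agree on overlaps.\<close>

lemma DL_comp_eq:
  "DL_comp n k Z \<alpha> d = {s \<in> restr n k \<alpha> ` Der_comp n k d. \<forall>p\<in>Z. ev p (eta n k \<alpha> s) = 0}"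
proof (intro equalityI subsetI)
  fix s assume "s \<in> DL_comp n k Z \<alpha> d"
  then obtain \<theta>0 \<sigma> where \<theta>0: "\<theta>0 \<in> Der_comp n k d" "s = restr n k \<alpha> \<theta>0"
    and \<sigma>: "\<sigma> \<in> H0_D n k Z \<alpha> d"
    and val: "\<forall>p \<in> L_pts n \<alpha>. \<forall>(m, g) \<in> \<sigma> p.
       the_elem (restr n k \<alpha> ` m) = (IL n \<alpha> +>\<^bsub>Sring n\<^esub> g) \<odot>\<^bsub>Der_L n k \<alpha>\<^esub> s"
    by (auto simp: DL_comp_def)
  have \<theta>0D: "\<theta>0 \<in> carrier (Der n k)" using \<theta>0 by (simp add: Der_comp_def)
  have "ev p (eta n k \<alpha> s) = 0" if p: "p \<in> Z" for p
  proof -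
    let ?y = "epoint p"
    have y: "?y \<in> L_pts n \<alpha>" by (rule epoint_Z_in_L[OF p])
    obtain m g where mg: "(m, g) \<in> fractions n gr d ?y" "\<sigma> ?y = germ n Q gr d ?y m g"
      using \<sigma> y unfolding H0_D_def sheaf_sections_def by blast
    have "(m, g) \<in> \<sigma> ?y" unfolding mg(2) by (rule mem_germ[OF mg(1)])
    then have v: "the_elem (restr n k \<alpha> ` m) = (IL n \<alpha> +>\<^bsub>Sring n\<^esub> g) \<odot>\<^bsub>Der_L n k \<alpha>\<^esub> s"
      using val y by blast
    obtain \<theta> e where \<theta>: "\<theta> \<in> Dk_comp n k Z (d + e)" "m = cls \<theta>" and g: "vars_in {..n} g" "ev ?y g \<noteq> 0"
      using fractionsE[OF mg(1)] by metis
    have \<theta>D: "\<theta> \<in> carrier (Dk n k Z)" using \<theta> Dk_comp_carrier by blast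
    have gS: "g \<in> carrier (Sring n)" using g by (simp add: carrier_Sring)
    have "restr n k \<alpha> \<theta> = restr n k \<alpha> (g \<odot>\<^bsub>Der n k\<^esub> \<theta>0)"
      using v unfolding \<theta>(2) restr_cls[OF \<theta>D] \<theta>0(2) Der_L_smult[OF gS \<theta>0D] .
    moreover have gD: "g \<odot>\<^bsub>Der n k\<^esub> \<theta>0 \<in> carrier (Der n k)" using \<theta>0D g by (simp add: carrier_Der Der_ops)
    ultimately have "ev ?y (contract n k \<theta> p) = ev ?y (contract n k (g \<odot>\<^bsub>Der n k\<^esub> \<theta>0) p)"
      using ev_eta[OF Dk_Der[OF \<theta>D] p] ev_eta[OF gD p] by simp
    then have "ev ?y g * ev ?y (contract n k \<theta>0 p) = 0"
      using Dk_contract[OF \<theta>D p] by (simp add: ev_contract_smult[OF \<theta>0D])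
    then show ?thesis using g unfolding \<theta>0(2) ev_eta[OF \<theta>0D p] by simp
  qed
  then show "s \<in> {s \<in> restr n k \<alpha> ` Der_comp n k d. \<forall>p\<in>Z. ev p (eta n k \<alpha> s) = 0}" using \<theta>0 by blast
next
  fix s assume "s \<in> {s \<in> restr n k \<alpha> ` Der_comp n k d. \<forall>p\<in>Z. ev p (eta n k \<alpha> s) = 0}"
  then obtain \<theta> where \<theta>: "\<theta> \<in> Der_comp n k d" "s = restr n k \<alpha> \<theta>" and z: "\<And>p. p \<in> Z \<Longrightarrow> ev p (eta n k \<alpha> s) = 0" by blast
  have \<theta>D: "\<theta> \<in> carrier (Der n k)" using \<theta> by (simp add: Der_comp_def)
  define P where "P p g \<theta>' e \<longleftrightarrow> \<theta>' \<in> Der_comp n k d \<and> (\<forall>\<beta>\<in>multi n k. \<theta>' \<beta> - \<theta> \<beta> \<in> IL n \<alpha>) \<and>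
    vars_in {..n} g \<and> homog e g \<and> ev (epoint p) g \<noteq> 0 \<and> g \<odot>\<^bsub>Der n k\<^esub> \<theta>' \<in> carrier (Dk n k Z) \<and>
    (\<forall>q. ev q (f_off p) = 0 \<longrightarrow> ev q g = 0)" for p g \<theta>' e
  have "\<exists>g \<theta>' e. P p g \<theta>' e" if p: "p \<in> Z" for p
  proof -
    have "ev (epoint p) (contract n k \<theta> p) = 0" using z[OF p] ev_eta[OF \<theta>D p] \<theta>(2) by simp
    then show ?thesis unfolding P_def by (rule local_fraction[OF p \<theta>(1)])
  qed
  then obtain g \<theta>' e where P: "\<And>p. p \<in> Z \<Longrightarrow> P p (g p) (\<theta>' p) (e p)" by metis
  have T: "\<And>p. p \<in> Z \<Longrightarrow> \<theta>' p \<in> Der_comp n k d"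
    and diff: "\<And>p. p \<in> Z \<Longrightarrow> \<forall>\<beta>\<in>multi n k. \<theta>' p \<beta> - \<theta> \<beta> \<in> IL n \<alpha>"
    and gv: "\<And>p. p \<in> Z \<Longrightarrow> vars_in {..n} (g p)" and gh: "\<And>p. p \<in> Z \<Longrightarrow> homog (e p) (g p)"
    and ge: "\<And>p. p \<in> Z \<Longrightarrow> ev (epoint p) (g p) \<noteq> 0"
    and gD: "\<And>p. p \<in> Z \<Longrightarrow> g p \<odot>\<^bsub>Der n k\<^esub> \<theta>' p \<in> carrier (Dk n k Z)"
    and goff: "\<And>p q. p \<in> Z \<Longrightarrow> ev q (f_off p) = 0 \<Longrightarrow> ev q (g p) = 0"
    using P unfolding P_def by blast+
  have TD: "\<theta>' p \<in> carrier (Der n k)" if "p \<in> Z" for p using T[OF that] by (simp add: Der_comp_def)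
  have fD: "f \<odot>\<^bsub>Der n k\<^esub> \<theta> \<in> carrier (Dk n k Z)" by (rule f_smult_in_Dk[OF \<theta>D])
  have fr0: "(cls (f \<odot>\<^bsub>Der n k\<^esub> \<theta>), f) \<in> fractions n gr d q" if "ev q f \<noteq> 0" for q
    by (rule fractionI[OF smult_Dk_comp[OF \<theta>(1) homog_f fD] vars_in_f homog_f that])
  have frp: "(cls (g p \<odot>\<^bsub>Der n k\<^esub> \<theta>' p), g p) \<in> fractions n gr d q" if "p \<in> Z" "ev q (g p) \<noteq> 0" for p q
    by (rule fractionI[OF smult_Dk_comp[OF T[OF that(1)] gh[OF that(1)] gD[OF that(1)]] gv[OF that(1)] gh[OF that(1)] that(2)])
  define \<sigma> where "\<sigma> = (\<lambda>q\<in>L_pts n \<alpha>. if ev q f \<noteq> 0 then germ n Q gr d q (cls (f \<odot>\<^bsub>Der n k\<^esub> \<theta>)) f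
     else (let p = (SOME p. p \<in> Z \<and> ev q (linear_form n p) = 0) in germ n Q gr d q (cls (g p \<odot>\<^bsub>Der n k\<^esub> \<theta>' p)) (g p)))"
  \<comment> \<open>Where \<open>g p\<close> does not vanish, no hyperplane other than \<open>p\<close> passes.\<close>
  have \<sigma>p: "\<sigma> q = germ n Q gr d q (cls (g p \<odot>\<^bsub>Der n k\<^esub> \<theta>' p)) (g p)"
    if p: "p \<in> Z" and q: "q \<in> L_pts n \<alpha>" and gq: "ev q (g p) \<noteq> 0" for p q
  proof (cases "ev q f = 0")
    case False
    have "germ n Q gr d q (cls (f \<odot>\<^bsub>Der n k\<^esub> \<theta>)) f = germ n Q gr d q (cls (g p \<odot>\<^bsub>Der n k\<^esub> \<theta>' p)) (g p)"
    proof (rule germ_eq[OF fr0[OF False] frp[OF p gq], of 1 0])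
      show "1 \<odot>\<^bsub>Q\<^esub> (g p \<odot>\<^bsub>Q\<^esub> cls (f \<odot>\<^bsub>Der n k\<^esub> \<theta>)) = 1 \<odot>\<^bsub>Q\<^esub> (f \<odot>\<^bsub>Q\<^esub> cls (g p \<odot>\<^bsub>Der n k\<^esub> \<theta>' p))"
        using fraction_compat[OF gv[OF p] \<theta>D TD[OF p] diff[OF p] gD[OF p]] by simp
    qed (auto simp: carrier_Sring)
    then show ?thesis using False q by (simp add: \<sigma>_def)
  next
    case True
    have off: "ev q (f_off p) \<noteq> 0" using goff[OF p] gq by blast
    have uniq: "p' = p" if "p' \<in> Z" "ev q (linear_form n p') = 0" for p'
    proof (rule ccontr)
      assume "p' \<noteq> p"
      then have "p' \<in> Z - {p}" using that by simp
      then have "ev q (f_off p) = 0"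
        using that finite_Z by (auto simp: f_off_def arr_poly_def ev_hom.hom_prod prod_zero_iff)
      then show False using off by simp
    qed
    have "ev q (linear_form n p) = 0" using True off by (simp add: f_split[OF p] ev_hom.hom_mult)
    with p have "(SOME p. p \<in> Z \<and> ev q (linear_form n p) = 0) = p"
      by (intro some_equality conjI) (blast intro: uniq)+
    then show ?thesis unfolding \<sigma>_def restrict_apply'[OF q] Let_def using True by simp
  qed
  \<comment> \<open>A point of \<open>L\<close> on the hyperplane of \<open>p\<close> is a multiple of \<open>epoint p\<close>.\<close>
  have cover: "ev y f \<noteq> 0 \<or> (\<exists>p\<in>Z. ev y (g p) \<noteq> 0)" if y: "y \<in> L_pts n \<alpha>" for y
  proof (cases "ev y f = 0")
    case True
    then obtain p where p: "p \<in> Z" "ev y (linear_form n p) = 0"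
      using finite_Z by (auto simp: f_def arr_poly_def ev_hom.hom_prod prod_zero_iff)
    obtain X where X: "X \<in> carrier_vec (Suc n)" "y = epoint X" using L_pts_epoint[OF y] by metis
    have "(a \<bullet> p) * (b \<bullet> X) = (b \<bullet> p) * (a \<bullet> X)"
      using p X by (simp add: ev_linear_form epoint_dot)
    then have "\<exists>c. a \<bullet> X = c * (a \<bullet> p) \<and> b \<bullet> X = c * (b \<bullet> p)"
      using off_H[OF p(1)]
      by (cases "a \<bullet> p = 0") (auto simp: field_simps intro: exI[of _ "(b \<bullet> X) / (b \<bullet> p)"] exI[of _ "(a \<bullet> X) / (a \<bullet> p)"])
    then obtain c where "a \<bullet> X = c * (a \<bullet> p)" "b \<bullet> X = c * (b \<bullet> p)" by blast
    then have yc: "y = c \<cdot>\<^sub>v epoint p"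
      unfolding X(2) by (intro eq_vecI) (auto simp: epoint_index carrier_vecD[OF epoint_carrier] algebra_simps)
    have "0 \<cdot>\<^sub>v epoint p = 0\<^sub>v (Suc n)"
      by (intro eq_vecI) (simp_all add: carrier_vecD[OF epoint_carrier])
    moreover have "y \<noteq> 0\<^sub>v (Suc n)" using y by (simp add: L_pts points_def)
    ultimately have "c \<noteq> 0" using yc by metis
    then have "ev y (g p) \<noteq> 0" using ge[OF p(1)] ev_smult[OF gv[OF p(1)] gh[OF p(1)] epoint_carrier] by (simp add: yc)
    then show ?thesis using p by blast
  qed simp
  have "\<sigma> \<in> H0_D n k Z \<alpha> d"
    unfolding H0_D_def sheaf_sections_def
  proof (intro CollectI conjI ballI)
    show "\<sigma> \<in> extensional (L_pts n \<alpha>)" by (simp add: \<sigma>_def)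
    fix y assume y: "y \<in> L_pts n \<alpha>"
    show "\<exists>h\<in>carrier (Sring n). \<exists>m g. (\<exists>e. homog e h) \<and> ev y h \<noteq> 0 \<and>
        (\<forall>q\<in>L_pts n \<alpha>. ev q h \<noteq> 0 \<longrightarrow> (m, g) \<in> fractions n gr d q \<and> \<sigma> q = germ n Q gr d q m g)"
    proof (cases "ev y f = 0")
      case False
      show ?thesis
      proof (intro bexI[of _ f] exI conjI ballI impI)
        fix q assume "q \<in> L_pts n \<alpha>" "ev q f \<noteq> 0"
        then show "(cls (f \<odot>\<^bsub>Der n k\<^esub> \<theta>), f) \<in> fractions n gr d q"
          "\<sigma> q = germ n Q gr d q (cls (f \<odot>\<^bsub>Der n k\<^esub> \<theta>)) f"
          by (auto simp: fr0 \<sigma>_def)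
      qed (use False homog_f in \<open>auto simp: carrier_Sring\<close>)
    next
      case True
      then obtain p where p: "p \<in> Z" "ev y (g p) \<noteq> 0" using cover[OF y] by blast
      show ?thesis
      proof (intro bexI[of _ "g p"] exI conjI ballI impI)
        fix q assume "q \<in> L_pts n \<alpha>" "ev q (g p) \<noteq> 0"
        then show "(cls (g p \<odot>\<^bsub>Der n k\<^esub> \<theta>' p), g p) \<in> fractions n gr d q"
          "\<sigma> q = germ n Q gr d q (cls (g p \<odot>\<^bsub>Der n k\<^esub> \<theta>' p)) (g p)"
          using frp[OF p(1)] \<sigma>p[OF p(1)] by auto
      qed (use p gh gv in \<open>auto simp: carrier_Sring\<close>)
    qed
  qed
  moreover have "the_elem (restr n k \<alpha> ` m) = (IL n \<alpha> +>\<^bsub>Sring n\<^esub> g') \<odot>\<^bsub>Der_L n k \<alpha>\<^esub> s"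
    if y: "y \<in> L_pts n \<alpha>" and mg: "(m, g') \<in> \<sigma> y" for y m g'
  proof (cases "ev y f = 0")
    case False
    then have "(m, g') \<in> germ n Q gr d y (cls (f \<odot>\<^bsub>Der n k\<^esub> \<theta>)) f" using mg y by (simp add: \<sigma>_def)
    from germ_value[OF y fr0[OF False] fD \<theta>D _ this] show ?thesis
      by (simp add: Der_ops subst_hom.hom_mult \<theta>(2))
  next
    case True
    then obtain p where p: "p \<in> Z" "ev y (g p) \<noteq> 0" using cover[OF y] by blast
    have m: "(m, g') \<in> germ n Q gr d y (cls (g p \<odot>\<^bsub>Der n k\<^esub> \<theta>' p)) (g p)" using mg \<sigma>p[OF p(1) y p(2)] by simp
    have "psi ((g p \<odot>\<^bsub>Der n k\<^esub> \<theta>' p) \<beta>) = psi (g p) * psi (\<theta> \<beta>)" if "\<beta> \<in> multi n k" for \<beta>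
    proof -
      have "psi (\<theta>' p \<beta> - \<theta> \<beta>) = 0" using diff[OF p(1)] that by (simp add: IL_eq)
      then show ?thesis using that by (simp add: Der_ops subst_hom.hom_mult subst_hom.hom_minus)
    qed
    from germ_value[OF y frp[OF p] gD[OF p(1)] \<theta>D this m] show ?thesis by (simp add: \<theta>(2))
  qed
  ultimately show "s \<in> DL_comp n k Z \<alpha> d" unfolding DL_comp_def using \<theta> by blast
qed

end

section \<open>Gradings\<close>

lemma graded_moduleI:
  assumes "module R M" and "\<ominus>\<^bsub>R\<^esub> \<one>\<^bsub>R\<^esub> \<in> RC 0"
    and sub: "\<And>d. MC d \<subseteq> carrier M" and z: "\<And>d. \<zero>\<^bsub>M\<^esub> \<in> MC d"
    and add: "\<And>d x y. x \<in> MC d \<Longrightarrow> y \<in> MC d \<Longrightarrow> x \<oplus>\<^bsub>M\<^esub> y \<in> MC d"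
    and smult: "\<And>i j r x. r \<in> RC i \<Longrightarrow> x \<in> MC j \<Longrightarrow> r \<odot>\<^bsub>M\<^esub> x \<in> MC (i + j)"
    and gen: "\<And>x. x \<in> carrier M \<Longrightarrow> \<exists>u (b::nat). (\<forall>d\<le>b. u d \<in> MC d) \<and> x = finsum M u {..b}"
    and indep: "\<And>F u i. finite F \<Longrightarrow> (\<And>i. i \<in> F \<Longrightarrow> u i \<in> MC i) \<Longrightarrow>
      finsum M u F = \<zero>\<^bsub>M\<^esub> \<Longrightarrow> i \<in> F \<Longrightarrow> u i = \<zero>\<^bsub>M\<^esub>"
  shows "graded_module R RC M MC"
  unfolding graded_module_def
proof (intro conjI allI ballI)
  interpret M: module R M by fact
  show "module R M" by fact
  show "internal_direct_sum M UNIV MC (carrier M)"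
  proof (rule internal_direct_sumI)
    show "abelian_group M" ..
    show "subgroup (MC d) (add_monoid M)" for d
    proof (rule M.M.add.subgroupI)
      fix x assume x: "x \<in> MC d"
      then have "(\<ominus>\<^bsub>R\<^esub> \<one>\<^bsub>R\<^esub>) \<odot>\<^bsub>M\<^esub> x \<in> MC d" using smult[OF assms(2) x] by simp
      moreover have "x \<in> carrier M" using x sub by blast
      ultimately show "\<ominus>\<^bsub>M\<^esub> x \<in> MC d" using M.smult_l_minus[of "\<one>\<^bsub>R\<^esub>" x] by simp
    next
      show "MC d \<noteq> {}" using z[of d] by blast
    qed (use sub add in auto)
    fix x assume "x \<in> carrier M"
    then obtain u and b :: nat where u: "\<forall>d\<le>b. u d \<in> MC d" "x = finsum M u {..b}" using gen by blast
    then show "\<exists>F u. finite F \<and> F \<subseteq> UNIV \<and> (\<forall>i\<in>F. u i \<in> MC i) \<and> x = finsum M u F"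
      by (intro exI[of _ "{..b}"] exI[of _ u]) auto
  next
    fix F :: "nat set" and u assume "\<And>i. i \<in> F \<Longrightarrow> u i \<in> MC i"
    then show "finsum M u F \<in> carrier M" using sub by (intro M.M.finsum_closed) blast
  qed (use indep in blast)
qed (use smult in blast)

lemma (in quotient_module) finsum_coset:
  assumes "finite F" "\<And>i. i \<in> F \<Longrightarrow> u i \<in> carrier M"
  shows "finsum (quot_module M N) (\<lambda>i. N +>\<^bsub>M\<^esub> u i) F = N +>\<^bsub>M\<^esub> finsum M u F"
proof -
  interpret Q: module R "quot_module M N" by (rule module_quot)
  show ?thesis using assms
  proof (induction F rule: finite_induct)
    case empty
    then show ?case by (simp add: zero_coset quot_simps)
  next
    case (insert i F)
    then have "finsum (quot_module M N) (\<lambda>i. N +>\<^bsub>M\<^esub> u i) (insert i F) =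
        (N +>\<^bsub>M\<^esub> u i) \<oplus>\<^bsub>quot_module M N\<^esub> finsum (quot_module M N) (\<lambda>i. N +>\<^bsub>M\<^esub> u i) F"
      by (intro Q.M.finsum_insert) (auto simp: carrier_quot)
    moreover have "finsum M u (insert i F) = u i \<oplus>\<^bsub>M\<^esub> finsum M u F"
      using insert by (intro M.M.finsum_insert) auto
    moreover have "finsum M u F \<in> carrier M" using insert by (intro M.M.finsum_closed) auto
    ultimately show ?case using insert by (simp add: add_coset)
  qed
qed

lemma lin_mult_sum:
  "lin_mult n j l (\<lambda>\<gamma>. \<Sum>d\<le>(b::nat). r d \<gamma>) \<beta> = (\<Sum>d\<le>b. lin_mult n j l (r d) \<beta>)"
proof (induction b)
  case (Suc b)
  then show ?case using lin_mult_add_right[of n j l "\<lambda>\<gamma>. \<Sum>d\<le>b. r d \<gamma>" "r (Suc b)" \<beta>] by simp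
qed simp

lemma ideal_vanish: "ideal (vanish n V) (Sring n)"
  unfolding Sring_ideal_iff by (auto simp: vanish_def carrier_Sring ev_hom.hom_add ev_hom.hom_mult)

section \<open>The components of \<open>I(Z,H)\<close> as images of \<open>\<eta>\<close>\<close>

context general_line
begin

lemma module_DerL: "module (SL n \<alpha>) (Der_L n k \<alpha>)"
  unfolding Der_L_def by (rule free_module_is_module[OF cring_SL])

interpretation SL: cring "SL n \<alpha>" by (rule cring_SL)
interpretation PH: cring "PH n \<alpha>" by (rule cring_PH)
interpretation DerL: module "SL n \<alpha>" "Der_L n k \<alpha>" by (rule module_DerL)

abbreviation "S_L \<equiv> carrier (SL n \<alpha>)"
abbreviation "P_H \<equiv> carrier (PH n \<alpha>)"
abbreviation "DerL \<equiv> Der_L n k \<alpha>"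
abbreviation "sub \<equiv> subst_e n \<alpha>"
abbreviation "lift \<equiv> inv_into S_L sub"
abbreviation "IZ \<equiv> vanish n (all_coords Z)"
abbreviation "\<eta> \<equiv> eta n k \<alpha>"

lemma sub_hom:
  "x \<in> S_L \<Longrightarrow> sub x \<in> P_H"
  "x \<in> S_L \<Longrightarrow> y \<in> S_L \<Longrightarrow> sub (x \<oplus>\<^bsub>SL n \<alpha>\<^esub> y) = sub x + sub y"
  "x \<in> S_L \<Longrightarrow> y \<in> S_L \<Longrightarrow> sub (x \<otimes>\<^bsub>SL n \<alpha>\<^esub> y) = sub x * sub y"
  "inj_on sub S_L" "sub ` S_L = P_H"
  using ring_iso_memE[OF subst_e_iso] by (auto simp: bij_betw_def)

lemma sub_zero: "sub \<zero>\<^bsub>SL n \<alpha>\<^esub> = 0"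
  using sub_hom(2)[of "\<zero>\<^bsub>SL n \<alpha>\<^esub>" "\<zero>\<^bsub>SL n \<alpha>\<^esub>"] by simp

lemma lift: "q \<in> P_H \<Longrightarrow> lift q \<in> S_L" "q \<in> P_H \<Longrightarrow> sub (lift q) = q"
  using sub_hom(5) by (auto intro: inv_into_into f_inv_into_f)

lemma lift_hom: "lift \<in> Ring.ring_hom (PH n \<alpha>) (SL n \<alpha>)"
proof -
  have "lift \<in> ring_iso (PH n \<alpha>) (SL n \<alpha>)"
    using ring_iso_set_sym[OF SL.ring_axioms subst_e_iso] .
  then show ?thesis by (simp add: ring_iso_def)
qed

lemma PH_Sring: "q \<in> P_H \<Longrightarrow> vars_in {..n} q"
  unfolding carrier_PH by (auto simp: carrier_Sring)

lemma PH_comp_PH: "q \<in> PH_comp n \<alpha> d \<Longrightarrow> q \<in> P_H" and PH_comp_homog: "q \<in> PH_comp n \<alpha> d \<Longrightarrow> homog d q"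
  by (simp_all add: PH_comp_def)

lemma hpart_PH: "q \<in> P_H \<Longrightarrow> hpart d q \<in> PH_comp n \<alpha> d"
proof -
  assume "q \<in> P_H"
  then obtain p where p: "vars_in {..n} p" "q = psi p" unfolding carrier_PH by (auto simp: carrier_Sring)
  then show ?thesis unfolding PH_comp_iff
    using hpart_psi[OF p(1), of d] by (intro exI[of _ "hpart d p"]) simp
qed

lemma zero_PH_comp: "0 \<in> PH_comp n \<alpha> d"
  using PH_closed(4)[of 0] by (simp add: PH_comp_def)

lemma PH_comp_add: "p \<in> PH_comp n \<alpha> d \<Longrightarrow> q \<in> PH_comp n \<alpha> d \<Longrightarrow> p + q \<in> PH_comp n \<alpha> d"
  and PH_comp_mult: "p \<in> PH_comp n \<alpha> i \<Longrightarrow> q \<in> PH_comp n \<alpha> d \<Longrightarrow> p * q \<in> PH_comp n \<alpha> (i + d)"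
  by (auto simp: PH_comp_def PH_closed homog_mult)

lemma minus_one_PH: "\<ominus>\<^bsub>PH n \<alpha>\<^esub> \<one>\<^bsub>PH n \<alpha>\<^esub> \<in> PH_comp n \<alpha> 0"
proof -
  have m: "- 1 \<in> P_H" using PH_closed(3)[OF PH.one_closed] by simp
  have "1 \<in> P_H" using PH.one_closed by simp
  then have "\<ominus>\<^bsub>PH n \<alpha>\<^esub> \<one>\<^bsub>PH n \<alpha>\<^esub> = - 1" using m by (intro PH.minus_equality) simp_all
  then show ?thesis using m by (simp add: PH_comp_def)
qed

lemma carrier_DerL: "s \<in> carrier DerL \<longleftrightarrow> s \<in> extensional (multi n k) \<and> (\<forall>\<beta>\<in>multi n k. s \<beta> \<in> S_L)"
  by (auto simp: Der_L_def free_module_def PiE_def Pi_def)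

lemma DerL_ops:
  "s \<oplus>\<^bsub>DerL\<^esub> t = (\<lambda>\<beta>\<in>multi n k. s \<beta> \<oplus>\<^bsub>SL n \<alpha>\<^esub> t \<beta>)"
  "c \<odot>\<^bsub>DerL\<^esub> s = (\<lambda>\<beta>\<in>multi n k. c \<otimes>\<^bsub>SL n \<alpha>\<^esub> s \<beta>)"
  "\<zero>\<^bsub>DerL\<^esub> = (\<lambda>\<beta>\<in>multi n k. \<zero>\<^bsub>SL n \<alpha>\<^esub>)"
  by (simp_all add: Der_L_def free_module_def)

lemma coeff_ops:
  assumes "\<beta> \<in> multi n k" "s \<in> carrier DerL"
  shows "sub (s \<beta>) \<in> P_H"
    and "t \<in> carrier DerL \<Longrightarrow> sub ((s \<oplus>\<^bsub>DerL\<^esub> t) \<beta>) = sub (s \<beta>) + sub (t \<beta>)"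
    and "c \<in> S_L \<Longrightarrow> sub ((c \<odot>\<^bsub>DerL\<^esub> s) \<beta>) = sub c * sub (s \<beta>)"
  using assms by (auto simp: carrier_DerL DerL_ops sub_hom)

lemma coeff_zero: "\<beta> \<in> multi n k \<Longrightarrow> sub (\<zero>\<^bsub>DerL\<^esub> \<beta>) = 0"
  by (simp add: DerL_ops sub_zero)

lemma DerL_eqI:
  assumes "s \<in> carrier DerL" "t \<in> carrier DerL" "\<And>\<beta>. \<beta> \<in> multi n k \<Longrightarrow> sub (s \<beta>) = sub (t \<beta>)"
  shows "s = t"
proof (rule extensionalityI[of _ "multi n k"])
  fix \<beta> assume "\<beta> \<in> multi n k"
  then show "s \<beta> = t \<beta>" using assms inj_onD[OF sub_hom(4)] by (auto simp: carrier_DerL)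
qed (use assms in \<open>auto simp: carrier_DerL\<close>)

text \<open>Elements of the free module over \<open>S/I(L)\<close> are handled through their images in \<open>P\<close>, which determine
  them and can be prescribed.\<close>

definition of_coeffs :: "(mindex \<Rightarrow> nat cpoly) \<Rightarrow> mindex \<Rightarrow> nat cpoly set" where
  "of_coeffs q = (\<lambda>\<beta>\<in>multi n k. lift (q \<beta>))"

lemma of_coeffs:
  assumes "\<And>\<beta>. \<beta> \<in> multi n k \<Longrightarrow> q \<beta> \<in> P_H"
  shows "of_coeffs q \<in> carrier DerL" "\<And>\<beta>. \<beta> \<in> multi n k \<Longrightarrow> sub (of_coeffs q \<beta>) = q \<beta>"
  using assms lift by (auto simp: of_coeffs_def carrier_DerL)

lemma coeff_finsum:
  assumes "finite F" "\<And>i. i \<in> F \<Longrightarrow> u i \<in> carrier DerL" "\<beta> \<in> multi n k"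
  shows "sub (finsum DerL u F \<beta>) = (\<Sum>i\<in>F. sub (u i \<beta>))"
  by (rule DerL.M.additive_finsum[where h = "\<lambda>s. sub (s \<beta>)"])
    (use assms coeff_ops coeff_zero in auto)

lemma eta_add: "s \<in> carrier DerL \<Longrightarrow> t \<in> carrier DerL \<Longrightarrow> \<eta> (s \<oplus>\<^bsub>DerL\<^esub> t) = \<eta> s + \<eta> t"
  unfolding eta_def sum.distrib[symmetric] by (intro sum.cong refl) (simp add: coeff_ops distrib_right)

lemma eta_smult: "c \<in> S_L \<Longrightarrow> s \<in> carrier DerL \<Longrightarrow> \<eta> (c \<odot>\<^bsub>DerL\<^esub> s) = sub c * \<eta> s"
  unfolding eta_def sum_distrib_left by (intro sum.cong refl) (simp add: coeff_ops mult.assoc)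

lemma eta_zero: "\<eta> \<zero>\<^bsub>DerL\<^esub> = 0"
  by (simp add: eta_def coeff_zero)

lemma eta_finsum:
  assumes "finite F" "\<And>i. i \<in> F \<Longrightarrow> u i \<in> carrier DerL"
  shows "\<eta> (finsum DerL u F) = (\<Sum>i\<in>F. \<eta> (u i))"
  by (rule DerL.M.additive_finsum) (use assms eta_add eta_zero in auto)

lemma vars_in_eta: "s \<in> carrier DerL \<Longrightarrow> vars_in {..n} (\<eta> s)"
  unfolding eta_def by (intro vars_in_sum vars_in_mult vars_in_xpow PH_Sring coeff_ops(1))

lemma restr_Der_comp_iff:
  "s \<in> restr n k \<alpha> ` Der_comp n k d \<longleftrightarrow>
    s \<in> carrier DerL \<and> (\<forall>\<beta>\<in>multi n k. sub (s \<beta>) \<in> PH_comp n \<alpha> d)"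
proof
  assume "s \<in> restr n k \<alpha> ` Der_comp n k d"
  then obtain \<theta> where \<theta>: "\<theta> \<in> carrier (Der n k)" "\<And>\<beta>. \<beta> \<in> multi n k \<Longrightarrow> homog d (\<theta> \<beta>)" "s = restr n k \<alpha> \<theta>"
    by (auto simp: Der_comp_def)
  have "s \<beta> \<in> S_L \<and> sub (s \<beta>) \<in> PH_comp n \<alpha> d" if "\<beta> \<in> multi n k" for \<beta>
    using \<theta> that unfolding PH_comp_iff carrier_SL
    by (auto simp: restr_def carrier_Der carrier_Sring subst_e_coset)
  then show "s \<in> carrier DerL \<and> (\<forall>\<beta>\<in>multi n k. sub (s \<beta>) \<in> PH_comp n \<alpha> d)"
    unfolding carrier_DerL using \<theta>(3) by (simp add: restr_def)
next
  assume s: "s \<in> carrier DerL \<and> (\<forall>\<beta>\<in>multi n k. sub (s \<beta>) \<in> PH_comp n \<alpha> d)"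
  then have "\<forall>\<beta>\<in>multi n k. \<exists>p. vars_in {..n} p \<and> homog d p \<and> sub (s \<beta>) = psi p" using PH_comp_iff by blast
  then obtain p where p: "\<And>\<beta>. \<beta> \<in> multi n k \<Longrightarrow> vars_in {..n} (p \<beta>) \<and> homog d (p \<beta>) \<and> sub (s \<beta>) = psi (p \<beta>)" by metis
  define \<theta> where "\<theta> = (\<lambda>\<beta>\<in>multi n k. p \<beta>)"
  have \<theta>: "\<theta> \<in> Der_comp n k d" using p by (auto simp: \<theta>_def Der_comp_def carrier_Der)
  have "restr n k \<alpha> \<theta> \<in> carrier DerL"
    unfolding carrier_DerL carrier_SL using p by (auto simp: restr_def \<theta>_def carrier_Sring)
  then have "s = restr n k \<alpha> \<theta>"
    using s p by (intro DerL_eqI) (auto simp: restr_def \<theta>_def subst_e_coset carrier_Sring)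
  then show "s \<in> restr n k \<alpha> ` Der_comp n k d" using \<theta> by blast
qed

lemma homog_eta:
  assumes "\<And>\<beta>. \<beta> \<in> multi n k \<Longrightarrow> sub (s \<beta>) \<in> PH_comp n \<alpha> d"
  shows "homog (d + k) (\<eta> s)"
  unfolding eta_def by (intro homog_sum homog_mult PH_comp_homog[OF assms] homog_xpow)

lemma DL_comp_iff:
  "s \<in> DL_comp n k Z \<alpha> d \<longleftrightarrow>
    s \<in> carrier DerL \<and> (\<forall>\<beta>\<in>multi n k. sub (s \<beta>) \<in> PH_comp n \<alpha> d) \<and> \<eta> s \<in> IZ"
  unfolding DL_comp_eq mem_Collect_eq restr_Der_comp_iff
  using homog_vanish_all_coords[OF Z_carrier vars_in_eta homog_eta] by blast

lemma DL_comp_carrier: "s \<in> DL_comp n k Z \<alpha> d \<Longrightarrow> s \<in> carrier DerL"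
  by (simp add: DL_comp_iff)

definition comp_part :: "nat \<Rightarrow> (mindex \<Rightarrow> nat cpoly set) \<Rightarrow> mindex \<Rightarrow> nat cpoly set" where
  "comp_part d s = of_coeffs (\<lambda>\<beta>. hpart d (sub (s \<beta>)))"

lemma comp_part:
  assumes "s \<in> carrier DerL"
  shows "comp_part d s \<in> carrier DerL"
    and "\<And>\<beta>. \<beta> \<in> multi n k \<Longrightarrow> sub (comp_part d s \<beta>) = hpart d (sub (s \<beta>))"
    and "\<eta> (comp_part d s) = hpart (d + k) (\<eta> s)"
proof -
  have q: "hpart d (sub (s \<beta>)) \<in> P_H" if "\<beta> \<in> multi n k" for \<beta>
    using hpart_PH coeff_ops(1) assms that PH_comp_PH by blast
  show c: "comp_part d s \<in> carrier DerL" "\<And>\<beta>. \<beta> \<in> multi n k \<Longrightarrow> sub (comp_part d s \<beta>) = hpart d (sub (s \<beta>))"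
    using of_coeffs[OF q] by (auto simp: comp_part_def)
  have "hpart (d + k) (sub (s \<beta>) * xpow \<beta>) = hpart d (sub (s \<beta>)) * xpow \<beta>" if "\<beta> \<in> multi n k" for \<beta>
    using hpart_mult[OF homog_xpow[OF that], of "d + k" "sub (s \<beta>)"] by (simp add: mult.commute)
  then show "\<eta> (comp_part d s) = hpart (d + k) (\<eta> s)"
    unfolding eta_def hpart_sum using c(2) by (intro sum.cong refl) simp
qed

lemma sum_comp_part:
  assumes "s \<in> carrier DerL"
  obtains e where "s = finsum DerL (\<lambda>d. comp_part d s) {..e}"
proof -
  define b where "b = (\<Sum>\<beta>\<in>multi n k. deg_bound (sub (s \<beta>)))"
  have "s = finsum DerL (\<lambda>d. comp_part d s) {..b}"
  proof (rule DerL_eqI[OF assms])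
    show "finsum DerL (\<lambda>d. comp_part d s) {..b} \<in> carrier DerL"
      using comp_part(1)[OF assms] by (intro DerL.M.finsum_closed) auto
    fix \<beta> assume \<beta>: "\<beta> \<in> multi n k"
    have "deg_bound (sub (s \<beta>)) \<le> b" unfolding b_def using \<beta> by (intro member_le_sum) auto
    then have "sub (s \<beta>) = (\<Sum>d\<le>b. hpart d (sub (s \<beta>)))" by (simp add: sum_hpart)
    also have "\<dots> = (\<Sum>d\<le>b. sub (comp_part d s \<beta>))" using comp_part(2)[OF assms \<beta>] by simp
    also have "\<dots> = sub (finsum DerL (\<lambda>d. comp_part d s) {..b} \<beta>)"
      using comp_part(1)[OF assms] \<beta> by (subst coeff_finsum) auto
    finally show "sub (s \<beta>) = sub (finsum DerL (\<lambda>d. comp_part d s) {..b} \<beta>)" .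
  qed
  then show thesis using that by blast
qed

lemma IZ_closed: "0 \<in> IZ" "x \<in> IZ \<Longrightarrow> y \<in> IZ \<Longrightarrow> x + y \<in> IZ" "vars_in {..n} r \<Longrightarrow> x \<in> IZ \<Longrightarrow> r * x \<in> IZ"
  using ideal_vanish[of n "all_coords Z"] unfolding Sring_ideal_iff by (auto simp: carrier_Sring)

lemma comp_part_DL:
  assumes "s \<in> carrier DerL" "\<eta> s \<in> IZ"
  shows "comp_part d s \<in> DL_comp n k Z \<alpha> d"
  unfolding DL_comp_iff using comp_part[OF assms(1)] assms coeff_ops(1) hpart_PH
    hpart_vanish_all_coords[OF Z_carrier assms(2)] by auto

text \<open>The part of degree \<open>d\<close> of an element has as image under \<open>\<eta>\<close> the part of degree \<open>d + k\<close> of its image,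
  and the vanishing ideal of \<open>Z\<close> is homogeneous.\<close>

lemma carrier_DL: "s \<in> carrier (DL n k Z \<alpha>) \<longleftrightarrow> s \<in> carrier DerL \<and> \<eta> s \<in> IZ"
proof
  assume "s \<in> carrier (DL n k Z \<alpha>)"
  then obtain u and b :: nat where u: "\<And>d. d \<le> b \<Longrightarrow> u d \<in> DL_comp n k Z \<alpha> d" "s = finsum DerL u {..b}"
    by (auto simp: DL_def)
  have c: "u d \<in> carrier DerL" "\<eta> (u d) \<in> IZ" if "d \<in> {..b}" for d using u(1) that by (auto simp: DL_comp_iff)
  have "(\<Sum>d\<in>F. \<eta> (u d)) \<in> IZ" if "finite F" "F \<subseteq> {..b}" for F
    using that by (induction F rule: finite_induct) (use IZ_closed c in auto)
  then have "\<eta> s \<in> IZ" unfolding u(2) using c by (subst eta_finsum) auto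
  moreover have "s \<in> carrier DerL" unfolding u(2) using c by (intro DerL.M.finsum_closed) auto
  ultimately show "s \<in> carrier DerL \<and> \<eta> s \<in> IZ" by blast
next
  assume s: "s \<in> carrier DerL \<and> \<eta> s \<in> IZ"
  then obtain b where "s = finsum DerL (\<lambda>d. comp_part d s) {..b}" using sum_comp_part by blast
  moreover have "\<forall>d\<le>b. comp_part d s \<in> DL_comp n k Z \<alpha> d" using comp_part_DL s by blast
  ultimately show "s \<in> carrier (DL n k Z \<alpha>)" unfolding DL_def by (simp, intro exI[of _ "\<lambda>d. comp_part d s"] exI[of _ b]) blast
qed

lemma DL_ops: "zero (DL n k Z \<alpha>) = zero DerL" "add (DL n k Z \<alpha>) = add DerL"
  "q \<odot>\<^bsub>DL n k Z \<alpha>\<^esub> s = lift q \<odot>\<^bsub>DerL\<^esub> s"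
  by (simp_all add: DL_def)

lemma finsum_DL: "finsum (DL n k Z \<alpha>) u F = finsum DerL u F" if "\<And>i. i \<in> F \<Longrightarrow> u i \<in> carrier (DL n k Z \<alpha>)" "module (PH n \<alpha>) (DL n k Z \<alpha>)" "finite F"
proof -
  interpret DL: module "PH n \<alpha>" "DL n k Z \<alpha>" by fact
  show ?thesis using that(3,1)
  proof (induction F rule: finite_induct)
    case empty
    then show ?case by (simp add: DL_ops)
  next
    case (insert i F)
    have "finsum (DL n k Z \<alpha>) u (insert i F) = u i \<oplus>\<^bsub>DL n k Z \<alpha>\<^esub> finsum (DL n k Z \<alpha>) u F"
      using insert by (intro DL.M.finsum_insert) auto
    moreover have "finsum DerL u (insert i F) = u i \<oplus>\<^bsub>DerL\<^esub> finsum DerL u F"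
      using insert by (intro DerL.M.finsum_insert) (auto simp: carrier_DL)
    ultimately show ?case using insert by (simp add: DL_ops)
  qed
qed

lemma module_DL: "module (PH n \<alpha>) (DL n k Z \<alpha>)"
proof (rule module_pullback[OF module_DerL cring_PH, where \<phi> = lift])
  show "lift q \<odot>\<^bsub>DerL\<^esub> x \<in> carrier (DL n k Z \<alpha>)" if "q \<in> P_H" "x \<in> carrier (DL n k Z \<alpha>)" for q x
    using that lift PH_Sring IZ_closed(3) by (auto simp: carrier_DL eta_smult)
qed (auto simp: carrier_DL DL_ops eta_zero IZ_closed eta_add lift_hom)

interpretation DL: module "PH n \<alpha>" "DL n k Z \<alpha>" by (rule module_DL)

lemma DL_comp_in_DL: "s \<in> DL_comp n k Z \<alpha> d \<Longrightarrow> s \<in> carrier (DL n k Z \<alpha>)"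
  by (simp add: DL_comp_iff carrier_DL)

lemma DL_comp_zero: "\<zero>\<^bsub>DerL\<^esub> \<in> DL_comp n k Z \<alpha> d"
  by (simp add: DL_comp_iff coeff_zero zero_PH_comp eta_zero IZ_closed)

lemma DL_comp_add: "s \<in> DL_comp n k Z \<alpha> d \<Longrightarrow> t \<in> DL_comp n k Z \<alpha> d \<Longrightarrow> s \<oplus>\<^bsub>DerL\<^esub> t \<in> DL_comp n k Z \<alpha> d"
  by (simp add: DL_comp_iff coeff_ops PH_comp_add eta_add IZ_closed)

lemma DL_comp_smult:
  assumes "r \<in> PH_comp n \<alpha> i" "s \<in> DL_comp n k Z \<alpha> d"
  shows "r \<odot>\<^bsub>DL n k Z \<alpha>\<^esub> s \<in> DL_comp n k Z \<alpha> (i + d)"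
  using assms lift[OF PH_comp_PH[OF assms(1)]] PH_Sring[OF PH_comp_PH[OF assms(1)]]
  by (simp add: DL_comp_iff DL_ops coeff_ops PH_comp_mult eta_smult IZ_closed)

lemma eta_DL_smult:
  assumes "q \<in> P_H" "s \<in> carrier DerL"
  shows "\<eta> (q \<odot>\<^bsub>DL n k Z \<alpha>\<^esub> s) = q * \<eta> s"
  using assms lift by (simp add: DL_ops eta_smult)

lemma graded_DL: "graded_module (PH n \<alpha>) (PH_comp n \<alpha>) (DL n k Z \<alpha>) (DL_comp n k Z \<alpha>)"
proof (rule graded_moduleI, rule module_DL, rule minus_one_PH)
  fix s assume "s \<in> carrier (DL n k Z \<alpha>)"
  then have s: "s \<in> carrier DerL" "\<eta> s \<in> IZ" by (auto simp: carrier_DL)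
  then obtain b where "s = finsum DerL (\<lambda>d. comp_part d s) {..b}" using sum_comp_part by blast
  then have "s = finsum (DL n k Z \<alpha>) (\<lambda>d. comp_part d s) {..b}"
    using comp_part_DL[OF s] DL_comp_in_DL by (subst finsum_DL) (auto simp: module_DL)
  then show "\<exists>u b. (\<forall>d\<le>b. u d \<in> DL_comp n k Z \<alpha> d) \<and> s = finsum (DL n k Z \<alpha>) u {..b}"
    using comp_part_DL[OF s] by (intro exI[of _ "\<lambda>d. comp_part d s"] exI[of _ b]) blast
next
  fix F u and i :: nat
  assume F: "finite F" "\<And>i. i \<in> F \<Longrightarrow> u i \<in> DL_comp n k Z \<alpha> i" and z: "finsum (DL n k Z \<alpha>) u F = \<zero>\<^bsub>DL n k Z \<alpha>\<^esub>" and i: "i \<in> F"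
  have uc: "u i \<in> carrier DerL" if "i \<in> F" for i using F that DL_comp_carrier by blast
  have z': "finsum DerL u F = \<zero>\<^bsub>DerL\<^esub>"
    using z finsum_DL[OF DL_comp_in_DL[OF F(2)] module_DL F(1)] unfolding DL_ops by simp
  have "sub (u i \<beta>) = 0" if \<beta>: "\<beta> \<in> multi n k" for \<beta>
  proof (rule homog_sum_eq_0[OF F(1), of id "\<lambda>i. sub (u i \<beta>)"])
    show "(\<Sum>i\<in>F. sub (u i \<beta>)) = 0" using coeff_finsum[of F u \<beta>] F(1) uc \<beta> z' coeff_zero[OF \<beta>] by simp
    show "homog (id j) (sub (u j \<beta>))" if "j \<in> F" for j
      using F(2)[OF that] \<beta> PH_comp_homog by (auto simp: DL_comp_iff)
  qed (use i in auto)
  then have "u i = \<zero>\<^bsub>DerL\<^esub>" using uc[OF i] by (intro DerL_eqI) (auto simp: coeff_zero)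
  then show "u i = \<zero>\<^bsub>DL n k Z \<alpha>\<^esub>" by (simp add: DL_ops)
qed (auto simp: DL_ops(1,2) DL_comp_in_DL DL_comp_zero DL_comp_add DL_comp_smult)

lemma eta_in_IH_pow:
  assumes "s \<in> carrier DerL" "\<And>\<beta>. \<beta> \<in> multi n k \<Longrightarrow> sub (s \<beta>) \<in> PH_comp n \<alpha> d"
  shows "\<eta> s \<in> IH_pow d"
proof -
  have I: "0 \<in> IH_pow d" "\<And>x y. x \<in> IH_pow d \<Longrightarrow> y \<in> IH_pow d \<Longrightarrow> x + y \<in> IH_pow d"
    "\<And>x r. x \<in> IH_pow d \<Longrightarrow> vars_in {..n} r \<Longrightarrow> r * x \<in> IH_pow d"
    using ideal_pow_ideal[OF ideal_vanish, of n "H_pts n \<alpha>" d] unfolding Sring_ideal_iff by (auto simp: carrier_Sring)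
  have t: "sub (s \<beta>) * xpow \<beta> \<in> IH_pow d" if "\<beta> \<in> multi n k" for \<beta>
    using I(3)[OF _ vars_in_xpow[OF that]] assms(2)[OF that] PH_comp_in_IH_pow by (metis mult.commute subsetD)
  have "(\<Sum>\<beta>\<in>M. sub (s \<beta>) * xpow \<beta>) \<in> IH_pow d" if "finite M" "M \<subseteq> multi n k" for M
    using that by (induction M rule: finite_induct) (use I t in auto)
  then show ?thesis unfolding eta_def by simp
qed

text \<open>Surjectivity of \<open>\<eta>\<close> in each degree. All remaining closure properties of \<open>I(Z,H)\<close> are inherited from
  \<open>D\<^sup>k|\<^sub>L\<close> through this equality.\<close>

lemma IZH_comp_eq: "IZH_comp n k Z \<alpha> (d + k) = \<eta> ` DL_comp n k Z \<alpha> d"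
proof (intro equalityI subsetI)
  fix F assume "F \<in> IZH_comp n k Z \<alpha> (d + k)"
  then have F: "F \<in> IZ" "F \<in> IH_pow d" "homog (d + k) F" by (auto simp: IZH_comp_def)
  obtain q where q: "\<And>\<beta>. \<beta> \<in> multi n k \<Longrightarrow> q \<beta> \<in> PH_comp n \<alpha> d"
    and e: "hpart (d + k) F = (\<Sum>\<beta>\<in>multi n k. q \<beta> * xpow \<beta>)" using IH_pow_expand[OF F(2)] by blast
  note c = of_coeffs[OF PH_comp_PH[OF q]]
  have "\<eta> (of_coeffs q) = F" using e c(2) homog_hpart_eq[OF F(3)] by (simp add: eta_def)
  moreover from this have "of_coeffs q \<in> DL_comp n k Z \<alpha> d" using c q F by (simp add: DL_comp_iff)
  ultimately show "F \<in> \<eta> ` DL_comp n k Z \<alpha> d" by blast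
next
  fix F assume "F \<in> \<eta> ` DL_comp n k Z \<alpha> d"
  then obtain s where s: "s \<in> DL_comp n k Z \<alpha> d" "F = \<eta> s" by blast
  then show "F \<in> IZH_comp n k Z \<alpha> (d + k)"
    using homog_eta[of s d] eta_in_IH_pow[of s d] by (auto simp: DL_comp_iff IZH_comp_def)
qed

lemma IZH_comp_low: "j < k \<Longrightarrow> IZH_comp n k Z \<alpha> j = {0}"
  by (simp add: IZH_comp_def)

lemma IZH_comp_cases:
  assumes "F \<in> IZH_comp n k Z \<alpha> j"
  obtains "F = 0" "j < k" | s d where "j = d + k" "s \<in> DL_comp n k Z \<alpha> d" "F = \<eta> s"
proof (cases "j < k")
  case True
  then show thesis using assms IZH_comp_low that(1) by blast
next
  case False
  then have j: "j = (j - k) + k" by simp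
  then obtain s where "s \<in> DL_comp n k Z \<alpha> (j - k)" "F = \<eta> s"
    using assms IZH_comp_eq[of "j - k"] by auto
  then show thesis using that(2) j by blast
qed

lemma homog_IZH_comp: "F \<in> IZH_comp n k Z \<alpha> j \<Longrightarrow> homog j F"
  by (auto simp: IZH_comp_def split: if_splits)

lemma hpart_eta_low: "s \<in> carrier DerL \<Longrightarrow> j < k \<Longrightarrow> hpart j (\<eta> s) = 0"
  unfolding eta_def hpart_sum
  by (intro sum.neutral ballI) (subst mult.commute, simp add: hpart_mult[OF homog_xpow])

lemma carrier_IZH: "carrier (IZH n k Z \<alpha>) = \<eta> ` carrier (DL n k Z \<alpha>)"
proof (intro equalityI subsetI)
  fix F assume "F \<in> carrier (IZH n k Z \<alpha>)"
  then have F: "\<And>j. hpart j F \<in> IZH_comp n k Z \<alpha> j" by (simp add: IZH_def)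
  have "\<forall>d. \<exists>s\<in>DL_comp n k Z \<alpha> d. hpart (d + k) F = \<eta> s" using F IZH_comp_eq by blast
  then obtain s where s: "\<And>d. s d \<in> DL_comp n k Z \<alpha> d" "\<And>d. hpart (d + k) F = \<eta> (s d)" by metis
  define b where "b = deg_bound F"
  have c: "s d \<in> carrier DerL" "s d \<in> carrier (DL n k Z \<alpha>)" for d using s(1) DL_comp_carrier DL_comp_in_DL by blast+
  have "F = (\<Sum>j\<le>b + k. hpart j F)" by (simp add: sum_hpart b_def)
  also have "\<dots> = (\<Sum>j\<in>{k..b + k}. hpart j F)"
  proof (rule sum.mono_neutral_right)
    show "\<forall>j\<in>{..b + k} - {k..b + k}. hpart j F = 0"
    proof
      fix j assume "j \<in> {..b + k} - {k..b + k}"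
      then have "j < k" by auto
      then show "hpart j F = 0" using F[of j] IZH_comp_low by blast
    qed
  qed auto
  also have "\<dots> = (\<Sum>d\<le>b. hpart (d + k) F)"
    by (rule sum.reindex_bij_witness[of _ "\<lambda>d. d + k" "\<lambda>j. j - k"]) auto
  also have "\<dots> = \<eta> (finsum DerL s {..b})" using c by (subst eta_finsum) (auto simp: s(2))
  finally have e: "F = \<eta> (finsum DerL s {..b})" .
  have "finsum (DL n k Z \<alpha>) s {..b} \<in> carrier (DL n k Z \<alpha>)" using c by (intro DL.M.finsum_closed) auto
  then have "finsum DerL s {..b} \<in> carrier (DL n k Z \<alpha>)" using finsum_DL[OF _ module_DL, of "{..b}" s] c by simp
  then show "F \<in> \<eta> ` carrier (DL n k Z \<alpha>)" using e by blast
next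
  fix F assume "F \<in> \<eta> ` carrier (DL n k Z \<alpha>)"
  then obtain s where s: "s \<in> carrier DerL" "\<eta> s \<in> IZ" "F = \<eta> s" by (auto simp: carrier_DL)
  have "hpart j F \<in> IZH_comp n k Z \<alpha> j" for j
  proof (cases "j < k")
    case True
    then show ?thesis using s hpart_eta_low IZH_comp_low by simp
  next
    case False
    then have j: "j = (j - k) + k" by simp
    have "hpart ((j - k) + k) F \<in> IZH_comp n k Z \<alpha> ((j - k) + k)"
      unfolding IZH_comp_eq s(3) comp_part(3)[OF s(1), symmetric] using comp_part_DL[OF s(1,2)] by blast
    then show ?thesis using j by simp
  qed
  then show "F \<in> carrier (IZH n k Z \<alpha>)" using vars_in_eta[OF s(1)] s(3) by (simp add: IZH_def carrier_Sring)
qed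

lemma IZH_ops: "\<zero>\<^bsub>IZH n k Z \<alpha>\<^esub> = 0" "x \<oplus>\<^bsub>IZH n k Z \<alpha>\<^esub> y = x + y" "r \<odot>\<^bsub>IZH n k Z \<alpha>\<^esub> x = r * x"
  by (simp_all add: IZH_def)

lemma IZH_closed:
  "0 \<in> carrier (IZH n k Z \<alpha>)"
  "x \<in> carrier (IZH n k Z \<alpha>) \<Longrightarrow> y \<in> carrier (IZH n k Z \<alpha>) \<Longrightarrow> x + y \<in> carrier (IZH n k Z \<alpha>)"
  "r \<in> P_H \<Longrightarrow> x \<in> carrier (IZH n k Z \<alpha>) \<Longrightarrow> r * x \<in> carrier (IZH n k Z \<alpha>)"
proof -
  show "0 \<in> carrier (IZH n k Z \<alpha>)" unfolding carrier_IZH using eta_zero DL.M.zero_closed DL_ops by (metis imageI)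
  show "x \<in> carrier (IZH n k Z \<alpha>) \<Longrightarrow> y \<in> carrier (IZH n k Z \<alpha>) \<Longrightarrow> x + y \<in> carrier (IZH n k Z \<alpha>)"
    unfolding carrier_IZH by (auto simp: carrier_DL eta_add[symmetric] IZ_closed intro!: imageI) (simp add: eta_add IZ_closed)
  show "r * x \<in> carrier (IZH n k Z \<alpha>)" if r: "r \<in> P_H" and x: "x \<in> carrier (IZH n k Z \<alpha>)"
  proof -
    obtain s where s: "s \<in> carrier (DL n k Z \<alpha>)" "x = \<eta> s" using x carrier_IZH by blast
    then have "r * x = \<eta> (r \<odot>\<^bsub>DL n k Z \<alpha>\<^esub> s)" using eta_DL_smult[OF r] by (simp add: carrier_DL)
    then show ?thesis unfolding carrier_IZH using DL.smult_closed[OF r s(1)] by blast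
  qed
qed

lemma module_IZH: "module (PH n \<alpha>) (IZH n k Z \<alpha>)"
proof (rule moduleI[OF cring_PH])
  show "abelian_group (IZH n k Z \<alpha>)"
  proof (rule abelian_groupI)
    fix x assume x: "x \<in> carrier (IZH n k Z \<alpha>)"
    have "- 1 \<in> P_H" using PH_closed(3)[OF PH.one_closed] by simp
    from IZH_closed(3)[OF this x] show "\<exists>y\<in>carrier (IZH n k Z \<alpha>). y \<oplus>\<^bsub>IZH n k Z \<alpha>\<^esub> x = \<zero>\<^bsub>IZH n k Z \<alpha>\<^esub>"
      by (intro bexI[of _ "- x"]) (simp_all add: IZH_ops)
  qed (auto simp: IZH_ops IZH_closed)
qed (auto simp: IZH_ops IZH_closed algebra_simps)

interpretation IZH: module "PH n \<alpha>" "IZH n k Z \<alpha>" by (rule module_IZH)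

lemma finsum_IZH:
  assumes "finite F" "\<And>i. i \<in> F \<Longrightarrow> u i \<in> carrier (IZH n k Z \<alpha>)"
  shows "finsum (IZH n k Z \<alpha>) u F = (\<Sum>i\<in>F. u i)"
  using IZH.M.additive_finsum[of F u "\<lambda>x. x"] assms by (simp add: IZH_ops)

lemma IZH_comp_sub: "IZH_comp n k Z \<alpha> j \<subseteq> carrier (IZH n k Z \<alpha>)"
proof
  fix F assume "F \<in> IZH_comp n k Z \<alpha> j"
  then show "F \<in> carrier (IZH n k Z \<alpha>)"
    by (cases rule: IZH_comp_cases) (use IZH_closed(1) DL_comp_in_DL in \<open>auto simp: carrier_IZH\<close>)
qed

lemma IZH_comp_closed:
  "0 \<in> IZH_comp n k Z \<alpha> j"
  "x \<in> IZH_comp n k Z \<alpha> j \<Longrightarrow> y \<in> IZH_comp n k Z \<alpha> j \<Longrightarrow> x + y \<in> IZH_comp n k Z \<alpha> j"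
  "r \<in> PH_comp n \<alpha> i \<Longrightarrow> x \<in> IZH_comp n k Z \<alpha> j \<Longrightarrow> r * x \<in> IZH_comp n k Z \<alpha> (i + j)"
proof -
  have hi: "0 \<in> IZH_comp n k Z \<alpha> (d + k)" for d
    unfolding IZH_comp_eq using eta_zero DL_comp_zero by (metis imageI)
  show z: "0 \<in> IZH_comp n k Z \<alpha> j" for j
    using hi[of "j - k"] IZH_comp_low[of j] by (cases "j < k") auto
  show "x + y \<in> IZH_comp n k Z \<alpha> j" if x: "x \<in> IZH_comp n k Z \<alpha> j" and y: "y \<in> IZH_comp n k Z \<alpha> j"
  proof (cases "j < k")
    case False
    then have j: "IZH_comp n k Z \<alpha> j = \<eta> ` DL_comp n k Z \<alpha> (j - k)" using IZH_comp_eq[of "j - k"] by simp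
    then obtain s t where "s \<in> DL_comp n k Z \<alpha> (j - k)" "t \<in> DL_comp n k Z \<alpha> (j - k)" "x = \<eta> s" "y = \<eta> t" using x y by auto
    then show ?thesis unfolding j
      by (intro image_eqI[of _ _ "s \<oplus>\<^bsub>DerL\<^esub> t"]) (simp_all add: eta_add DL_comp_carrier DL_comp_add)
  qed (use x y IZH_comp_low in auto)
  show "r * x \<in> IZH_comp n k Z \<alpha> (i + j)" if r: "r \<in> PH_comp n \<alpha> i" and x: "x \<in> IZH_comp n k Z \<alpha> j"
    using x
  proof (cases rule: IZH_comp_cases)
    case (2 s d)
    have "r * x = \<eta> (r \<odot>\<^bsub>DL n k Z \<alpha>\<^esub> s)" using 2 r PH_comp_PH DL_comp_carrier by (simp add: eta_DL_smult)
    then show ?thesis unfolding 2(1) add.assoc[symmetric] IZH_comp_eq using DL_comp_smult[OF r 2(2)] by blast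
  qed (use z in simp)
qed

text \<open>The two gradings of \<open>I(Z,H)\<close>, by degree in \<open>X\<close> and shifted by \<open>k\<close>, differ only by zero
  components.\<close>

lemma graded_IZH:
  assumes "c = 0 \<or> c = k"
  shows "graded_module (PH n \<alpha>) (PH_comp n \<alpha>) (IZH n k Z \<alpha>) (\<lambda>d. IZH_comp n k Z \<alpha> (d + c))"
proof (rule graded_moduleI, rule module_IZH, rule minus_one_PH)
  fix F assume F: "F \<in> carrier (IZH n k Z \<alpha>)"
  then have h: "\<And>j. hpart j F \<in> IZH_comp n k Z \<alpha> j" by (simp add: IZH_def)
  define b where "b = deg_bound F"
  have "F = (\<Sum>j\<le>b + c. hpart j F)" by (simp add: sum_hpart b_def)
  also have "\<dots> = (\<Sum>j\<in>{c..b + c}. hpart j F)"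
  proof (rule sum.mono_neutral_right)
    show "\<forall>j\<in>{..b + c} - {c..b + c}. hpart j F = 0"
    proof
      fix j assume "j \<in> {..b + c} - {c..b + c}"
      then have "j < k" using assms by auto
      then show "hpart j F = 0" using h[of j] IZH_comp_low by blast
    qed
  qed auto
  also have "\<dots> = (\<Sum>d\<le>b. hpart (d + c) F)"
    by (rule sum.reindex_bij_witness[of _ "\<lambda>d. d + c" "\<lambda>j. j - c"]) auto
  also have "\<dots> = finsum (IZH n k Z \<alpha>) (\<lambda>d. hpart (d + c) F) {..b}"
    using h IZH_comp_sub by (subst finsum_IZH) auto
  finally show "\<exists>u b. (\<forall>d\<le>b. u d \<in> IZH_comp n k Z \<alpha> (d + c)) \<and> F = finsum (IZH n k Z \<alpha>) u {..b}"
    using h by (intro exI[of _ "\<lambda>d. hpart (d + c) F"] exI[of _ b]) blast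
next
  fix F u and i :: nat
  assume F: "finite F" "\<And>i. i \<in> F \<Longrightarrow> u i \<in> IZH_comp n k Z \<alpha> (i + c)" and z: "finsum (IZH n k Z \<alpha>) u F = \<zero>\<^bsub>IZH n k Z \<alpha>\<^esub>" and i: "i \<in> F"
  have "u i = 0"
  proof (rule homog_sum_eq_0[OF F(1), of "\<lambda>i. i + c" u])
    have "u i \<in> carrier (IZH n k Z \<alpha>)" if "i \<in> F" for i using F(2)[OF that] IZH_comp_sub by blast
    then have "finsum (IZH n k Z \<alpha>) u F = (\<Sum>i\<in>F. u i)" by (rule finsum_IZH[OF F(1)])
    then show "(\<Sum>i\<in>F. u i) = 0" using z unfolding IZH_ops by simp
    show "homog (j + c) (u j)" if "j \<in> F" for j using F(2)[OF that] homog_IZH_comp by blast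
  qed (use i in auto)
  then show "u i = \<zero>\<^bsub>IZH n k Z \<alpha>\<^esub>" by (simp add: IZH_ops)
qed (auto simp: IZH_ops IZH_comp_closed add.assoc intro: subsetD[OF IZH_comp_sub])

lemma eta_hom: "\<eta> \<in> module_hom (PH n \<alpha>) (DL n k Z \<alpha>) (IZH n k Z \<alpha>)"
  unfolding module_hom_def carrier_IZH
  by (auto simp: IZH_ops DL_ops(1,2) eta_DL_smult carrier_DL eta_add)

lemma graded_hom_eta:
  "graded_hom (PH n \<alpha>) (PH_comp n \<alpha>) (DL n k Z \<alpha>) (DL_comp n k Z \<alpha>) (IZH n k Z \<alpha>) (IZH_comp n k Z \<alpha>) k \<eta>"
  unfolding graded_hom_def using graded_DL graded_IZH[of 0] eta_hom IZH_comp_eq by auto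

section \<open>The kernel\<close>

abbreviation "euler \<equiv> euler_L n k \<alpha>"
abbreviation "ker_eta \<equiv> {s \<in> carrier (DL n k Z \<alpha>). \<eta> s = 0}"

lemma ker_eta_iff: "s \<in> ker_eta \<longleftrightarrow> s \<in> carrier DerL \<and> \<eta> s = 0"
  using IZ_closed(1) by (auto simp: carrier_DL)

lemma euler_carrier: "euler \<gamma> \<in> carrier DerL"
  and coeff_euler: "\<beta> \<in> multi n k \<Longrightarrow> sub (euler \<gamma> \<beta>) = (\<Sum>m\<le>n. if \<beta> = \<gamma> + single m 1 then e_coord n \<alpha> m else 0)"
proof -
  have v: "vars_in {..n} (\<Sum>m\<le>n. if \<beta> = \<gamma> + single m 1 then var m else 0)" for \<beta>
    by (intro vars_in_sum) auto
  show "euler \<gamma> \<in> carrier DerL"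
    unfolding carrier_DerL carrier_SL euler_L_def restr_def euler_der_def
    using v by (auto simp: carrier_Sring)
  show "sub (euler \<gamma> \<beta>) = (\<Sum>m\<le>n. if \<beta> = \<gamma> + single m 1 then e_coord n \<alpha> m else 0)" if \<beta>: "\<beta> \<in> multi n k"
  proof -
    have "sub (euler \<gamma> \<beta>) = psi (\<Sum>m\<le>n. if \<beta> = \<gamma> + single m 1 then var m else 0)"
      using v \<beta> by (simp add: euler_L_def restr_def euler_der_def subst_e_coset carrier_Sring)
    also have "\<dots> = (\<Sum>m\<le>n. if \<beta> = \<gamma> + single m 1 then e_coord n \<alpha> m else 0)"
      unfolding subst_hom.hom_sum by (intro sum.cong refl) simp
    finally show ?thesis .
  qed
qed

lemma k_Suc: "Suc (k - 1) = k"
  using k by simp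

lemma euler_sum_coeff:
  assumes F: "F \<subseteq> multi n (k - 1)" and c: "\<And>\<gamma>. \<gamma> \<in> F \<Longrightarrow> c \<gamma> \<in> S_L" and \<beta>: "\<beta> \<in> multi n k"
  shows "sub (finsum DerL (\<lambda>\<gamma>. c \<gamma> \<odot>\<^bsub>DerL\<^esub> euler \<gamma>) F \<beta>) =
    lin_mult n (k - 1) (e_coord n \<alpha>) (\<lambda>\<gamma>. if \<gamma> \<in> F then sub (c \<gamma>) else 0) \<beta>"
proof -
  have "finite F" using F finite_multi finite_subset by blast
  then have "sub (finsum DerL (\<lambda>\<gamma>. c \<gamma> \<odot>\<^bsub>DerL\<^esub> euler \<gamma>) F \<beta>) = (\<Sum>\<gamma>\<in>F. sub ((c \<gamma> \<odot>\<^bsub>DerL\<^esub> euler \<gamma>) \<beta>))"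
    using c \<beta> euler_carrier by (intro coeff_finsum) auto
  also have "\<dots> = (\<Sum>\<gamma>\<in>F. \<Sum>m\<le>n. if \<beta> = \<gamma> + single m 1 then e_coord n \<alpha> m * sub (c \<gamma>) else 0)"
    by (intro sum.cong refl) (simp add: coeff_ops \<beta> euler_carrier c coeff_euler sum_distrib_left if_distrib mult.commute cong: if_cong)
  also have "\<dots> = lin_mult n (k - 1) (e_coord n \<alpha>) (\<lambda>\<gamma>. if \<gamma> \<in> F then sub (c \<gamma>) else 0) \<beta>"
    unfolding lin_mult_def by (rule sum.mono_neutral_cong_left) (use F in auto)
  finally show ?thesis .
qed

text \<open>The image of an Euler derivation is \<open>X\<^sup>\<gamma> \<Sum> e(M\<^sub>m) X\<^sub>m = X\<^sup>\<gamma> D (B A - A B)\<close>.\<close>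

lemma eta_euler: "\<gamma> \<in> multi n (k - 1) \<Longrightarrow> \<eta> (euler \<gamma>) = 0"
proof -
  assume \<gamma>: "\<gamma> \<in> multi n (k - 1)"
  have "\<eta> (euler \<gamma>) = (\<Sum>\<beta>\<in>multi n (Suc (k - 1)). lin_mult n (k - 1) (e_coord n \<alpha>) (\<lambda>\<delta>. if \<delta> = \<gamma> then 1 else 0) \<beta> * xpow \<beta>)"
    unfolding eta_def k_Suc
  proof (intro sum.cong refl)
    fix \<beta> assume \<beta>: "\<beta> \<in> multi n k"
    have "sub (euler \<gamma> \<beta>) = (\<Sum>\<delta>\<in>multi n (k - 1). if \<delta> = \<gamma> then (\<Sum>m\<le>n. if \<beta> = \<gamma> + single m 1 then e_coord n \<alpha> m else 0) else 0)"
      using \<gamma> by (simp add: coeff_euler[OF \<beta>])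
    also have "\<dots> = lin_mult n (k - 1) (e_coord n \<alpha>) (\<lambda>\<delta>. if \<delta> = \<gamma> then 1 else 0) \<beta>"
      unfolding lin_mult_def by (intro sum.cong refl) (auto intro!: sum.cong)
    finally show "sub (euler \<gamma> \<beta>) * xpow \<beta> =
        lin_mult n (k - 1) (e_coord n \<alpha>) (\<lambda>\<delta>. if \<delta> = \<gamma> then 1 else 0) \<beta> * xpow \<beta>" by simp
  qed
  moreover have "(\<Sum>m\<le>n. e_coord n \<alpha> m * var m) = const D * (A * B - B * A)"
  proof -
    have "(\<Sum>m\<le>n. e_coord n \<alpha> m * var m) =
        (\<Sum>m\<le>n. const D * (B * (const (a $ m) * var m) - A * (const (b $ m) * var m)))"
      by (intro sum.cong refl) (simp add: e_coord algebra_simps)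
    also have "\<dots> = const D * (B * A - A * B)"
      by (simp only: sum_distrib_left[symmetric] sum_subtractf linear_form_def)
    finally show ?thesis by (simp add: mult.commute)
  qed
  ultimately show "\<eta> (euler \<gamma>) = 0" unfolding lin_mult_eval by (simp add: mult.commute)
qed

text \<open>The homogeneous parts of an element of the kernel lie in the kernel; \<open>relations\<close> applies to each.\<close>

lemma ker_eta_expand:
  assumes "s \<in> ker_eta"
  shows "\<exists>c. (\<forall>\<gamma>. c \<gamma> \<in> S_L) \<and> s = finsum DerL (\<lambda>\<gamma>. c \<gamma> \<odot>\<^bsub>DerL\<^esub> euler \<gamma>) (multi n (k - 1))"
proof -
  have s: "s \<in> carrier DerL" "\<eta> s = 0" using assms ker_eta_iff by auto
  have "\<exists>r. (\<forall>\<gamma>. r \<gamma> \<in> P_H) \<and> (\<forall>\<beta>\<in>multi n k. sub (comp_part d s \<beta>) = lin_mult n (k - 1) (e_coord n \<alpha>) r \<beta>)" for d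
  proof -
    have "(\<Sum>\<beta>\<in>multi n (Suc (k - 1)). sub (comp_part d s \<beta>) * xpow \<beta>) = 0"
      using comp_part(3)[OF s(1), of d] s(2) unfolding k_Suc eta_def by simp
    moreover have "sub (comp_part d s \<beta>) \<in> PH_comp n \<alpha> d" if "\<beta> \<in> multi n (Suc (k - 1))" for \<beta>
      using that comp_part(2)[OF s(1)] hpart_PH coeff_ops(1) s(1) unfolding k_Suc by simp
    ultimately show ?thesis using relations[of "k - 1" "\<lambda>\<beta>. sub (comp_part d s \<beta>)" d] unfolding k_Suc by blast
  qed
  then obtain r where r: "\<And>d \<gamma>. r d \<gamma> \<in> P_H"
    "\<And>d \<beta>. \<beta> \<in> multi n k \<Longrightarrow> sub (comp_part d s \<beta>) = lin_mult n (k - 1) (e_coord n \<alpha>) (r d) \<beta>" by metis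
  obtain b where b: "s = finsum DerL (\<lambda>d. comp_part d s) {..b}" using sum_comp_part[OF s(1)] by blast
  define \<rho> where "\<rho> \<gamma> = (\<Sum>d\<le>b. r d \<gamma>)" for \<gamma>
  have "(\<Sum>d\<in>F. r d \<gamma>) \<in> P_H" if "finite F" for F \<gamma>
    using that by (induction F rule: finite_induct) (use r PH_closed(1) PH_closed(4)[of 0] in auto)
  then have \<rho>: "\<rho> \<gamma> \<in> P_H" for \<gamma> by (simp add: \<rho>_def)
  define c where "c \<gamma> = lift (\<rho> \<gamma>)" for \<gamma>
  have c: "c \<gamma> \<in> S_L" "sub (c \<gamma>) = \<rho> \<gamma>" for \<gamma> using lift \<rho> by (auto simp: c_def)
  have "s = finsum DerL (\<lambda>\<gamma>. c \<gamma> \<odot>\<^bsub>DerL\<^esub> euler \<gamma>) (multi n (k - 1))"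
  proof (rule DerL_eqI[OF s(1)])
    show "finsum DerL (\<lambda>\<gamma>. c \<gamma> \<odot>\<^bsub>DerL\<^esub> euler \<gamma>) (multi n (k - 1)) \<in> carrier DerL"
      using c euler_carrier by (intro DerL.M.finsum_closed) auto
    fix \<beta> assume \<beta>: "\<beta> \<in> multi n k"
    have "sub (s \<beta>) = (\<Sum>d\<le>b. sub (comp_part d s \<beta>))"
      using comp_part(1)[OF s(1)] \<beta> by (subst b, subst coeff_finsum) auto
    also have "\<dots> = lin_mult n (k - 1) (e_coord n \<alpha>) \<rho> \<beta>"
      unfolding \<rho>_def lin_mult_sum by (intro sum.cong refl r(2) \<beta>)
    also have "\<dots> = lin_mult n (k - 1) (e_coord n \<alpha>) (\<lambda>\<gamma>. if \<gamma> \<in> multi n (k - 1) then sub (c \<gamma>) else 0) \<beta>"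
      unfolding lin_mult_def by (intro sum.cong refl) (simp add: c(2))
    also have "\<dots> = sub (finsum DerL (\<lambda>\<gamma>. c \<gamma> \<odot>\<^bsub>DerL\<^esub> euler \<gamma>) (multi n (k - 1)) \<beta>)"
      using c \<beta> by (subst euler_sum_coeff) auto
    finally show "sub (s \<beta>) = \<dots>" .
  qed
  then show ?thesis using c(1) by blast
qed

lemma ker_eta_finsum:
  assumes "F \<subseteq> multi n (k - 1)" "\<And>\<gamma>. \<gamma> \<in> F \<Longrightarrow> c \<gamma> \<in> S_L"
  shows "finsum DerL (\<lambda>\<gamma>. c \<gamma> \<odot>\<^bsub>DerL\<^esub> euler \<gamma>) F \<in> ker_eta"
proof -
  have f: "finite F" using assms(1) finite_multi finite_subset by blast
  have "\<eta> (finsum DerL (\<lambda>\<gamma>. c \<gamma> \<odot>\<^bsub>DerL\<^esub> euler \<gamma>) F) = (\<Sum>\<gamma>\<in>F. \<eta> (c \<gamma> \<odot>\<^bsub>DerL\<^esub> euler \<gamma>))"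
    using assms euler_carrier by (intro eta_finsum f) auto
  also have "\<dots> = 0" using assms eta_euler euler_carrier by (intro sum.neutral) (auto simp: eta_smult)
  finally show ?thesis unfolding ker_eta_iff using assms euler_carrier by (auto intro!: DerL.M.finsum_closed)
qed

lemma kernel_direct_sum:
  "internal_direct_sum DerL (multi n (k - 1)) (\<lambda>\<gamma>. {c \<odot>\<^bsub>DerL\<^esub> euler \<gamma> | c. c \<in> S_L}) ker_eta"
proof (rule internal_direct_sumI)
  show "abelian_group DerL" ..
  show "subgroup {c \<odot>\<^bsub>DerL\<^esub> euler \<gamma> | c. c \<in> S_L} (add_monoid DerL)" for \<gamma>
  proof (rule DerL.M.add.subgroupI)
    show "{c \<odot>\<^bsub>DerL\<^esub> euler \<gamma> | c. c \<in> S_L} \<noteq> {}" by (auto intro!: exI[of _ "\<zero>\<^bsub>SL n \<alpha>\<^esub>"])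
    fix x assume "x \<in> {c \<odot>\<^bsub>DerL\<^esub> euler \<gamma> | c. c \<in> S_L}"
    then obtain c where c: "c \<in> S_L" "x = c \<odot>\<^bsub>DerL\<^esub> euler \<gamma>" by blast
    then have "\<ominus>\<^bsub>DerL\<^esub> x = (\<ominus>\<^bsub>SL n \<alpha>\<^esub> c) \<odot>\<^bsub>DerL\<^esub> euler \<gamma>" using DerL.smult_l_minus euler_carrier by simp
    then show "\<ominus>\<^bsub>DerL\<^esub> x \<in> {c \<odot>\<^bsub>DerL\<^esub> euler \<gamma> | c. c \<in> S_L}" using c(1) by auto
    fix y assume "y \<in> {c \<odot>\<^bsub>DerL\<^esub> euler \<gamma> | c. c \<in> S_L}"
    then obtain e where e: "e \<in> S_L" "y = e \<odot>\<^bsub>DerL\<^esub> euler \<gamma>" by blast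
    then have "x \<oplus>\<^bsub>DerL\<^esub> y = (c \<oplus>\<^bsub>SL n \<alpha>\<^esub> e) \<odot>\<^bsub>DerL\<^esub> euler \<gamma>" using c DerL.smult_l_distr euler_carrier by simp
    then show "x \<oplus>\<^bsub>DerL\<^esub> y \<in> {c \<odot>\<^bsub>DerL\<^esub> euler \<gamma> | c. c \<in> S_L}" using c e by auto
  qed (use euler_carrier in auto)
next
  fix s assume "s \<in> ker_eta"
  from ker_eta_expand[OF this] obtain c where c: "\<And>\<gamma>. c \<gamma> \<in> S_L"
    "s = finsum DerL (\<lambda>\<gamma>. c \<gamma> \<odot>\<^bsub>DerL\<^esub> euler \<gamma>) (multi n (k - 1))" by blast
  then show "\<exists>F u. finite F \<and> F \<subseteq> multi n (k - 1) \<and> (\<forall>i\<in>F. u i \<in> {c \<odot>\<^bsub>DerL\<^esub> euler i | c. c \<in> S_L}) \<and> s = finsum DerL u F"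
    by (intro exI[of _ "multi n (k - 1)"] exI[of _ "\<lambda>\<gamma>. c \<gamma> \<odot>\<^bsub>DerL\<^esub> euler \<gamma>"]) auto
next
  fix F u assume F: "finite F" "F \<subseteq> multi n (k - 1)" and u: "\<And>i. i \<in> F \<Longrightarrow> u i \<in> {c \<odot>\<^bsub>DerL\<^esub> euler i | c. c \<in> S_L}"
  then have "\<forall>i\<in>F. \<exists>c. c \<in> S_L \<and> u i = c \<odot>\<^bsub>DerL\<^esub> euler i" by blast
  then obtain c where c: "\<And>i. i \<in> F \<Longrightarrow> c i \<in> S_L" "\<And>i. i \<in> F \<Longrightarrow> u i = c i \<odot>\<^bsub>DerL\<^esub> euler i" by metis
  have e: "finsum DerL u F = finsum DerL (\<lambda>\<gamma>. c \<gamma> \<odot>\<^bsub>DerL\<^esub> euler \<gamma>) F"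
    using c euler_carrier by (intro DerL.M.finsum_cong') auto
  show "finsum DerL u F \<in> ker_eta" unfolding e by (rule ker_eta_finsum[OF F(2) c(1)])
  fix i assume z: "finsum DerL u F = \<zero>\<^bsub>DerL\<^esub>" and i: "i \<in> F"
  have "(if i \<in> F then sub (c i) else 0) = 0"
  proof (rule lin_mult_inj[of "e_coord n \<alpha>" n "k - 1" "\<lambda>\<gamma>. if \<gamma> \<in> F then sub (c \<gamma>) else 0"])
    have "const D \<noteq> (0 :: nat cpoly)"
    proof
      assume "const D = (0 :: nat cpoly)"
      then have "lookup (const D :: nat cpoly) 0 = 0" by simp
      then show False by (simp add: const_def)
    qed
    then show "e_coord n \<alpha> 0 \<noteq> 0" using B_nonzero by (simp add: e_coord_0)
    fix \<beta> assume \<beta>: "\<beta> \<in> multi n (Suc (k - 1))"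
    then show "lin_mult n (k - 1) (e_coord n \<alpha>) (\<lambda>\<gamma>. if \<gamma> \<in> F then sub (c \<gamma>) else 0) \<beta> = 0"
      using euler_sum_coeff[of F c \<beta>] F(2) c(1) z e coeff_zero unfolding k_Suc by simp
  qed (use i F in auto)
  then have "sub (c i) = 0" using i by simp
  then show "u i = \<zero>\<^bsub>DerL\<^esub>"
    using c i euler_carrier by (intro DerL_eqI) (auto simp: coeff_ops coeff_zero)
qed

lemma euler_submodule_eq: "euler_submodule n k \<alpha> = ker_eta"
proof (intro equalityI subsetI)
  have es: "euler ` multi n (k - 1) \<subseteq> carrier DerL" using euler_carrier by blast
  fix s assume "s \<in> euler_submodule n k \<alpha>"
  then obtain c V where V: "finite V" "V \<subseteq> euler ` multi n (k - 1)" "c \<in> V \<rightarrow> S_L"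
    "s = finsum DerL (\<lambda>v. c v \<odot>\<^bsub>DerL\<^esub> v) V"
    unfolding euler_submodule_def DerL.span_def DerL.lincomb_def by blast
  have cv: "c v \<odot>\<^bsub>DerL\<^esub> v \<in> carrier DerL" if "v \<in> V" for v using V es that by blast
  have "\<eta> s = (\<Sum>v\<in>V. \<eta> (c v \<odot>\<^bsub>DerL\<^esub> v))" unfolding V(4) by (rule eta_finsum[OF V(1) cv])
  also have "\<dots> = 0"
  proof (intro sum.neutral ballI)
    fix v assume v: "v \<in> V"
    then obtain \<gamma> where "\<gamma> \<in> multi n (k - 1)" "v = euler \<gamma>" using V(2) by blast
    moreover have "c v \<in> S_L" using V(3) v by blast
    ultimately show "\<eta> (c v \<odot>\<^bsub>DerL\<^esub> v) = 0" using eta_smult[of "c v" v] euler_carrier eta_euler by simp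
  qed
  finally show "s \<in> ker_eta" unfolding ker_eta_iff V(4) using cv by (auto intro!: DerL.M.finsum_closed)
next
  have es: "euler ` multi n (k - 1) \<subseteq> carrier DerL" using euler_carrier by blast
  fix s assume "s \<in> ker_eta"
  from ker_eta_expand[OF this] obtain c where c: "\<And>\<gamma>. c \<gamma> \<in> S_L"
    "s = finsum DerL (\<lambda>\<gamma>. c \<gamma> \<odot>\<^bsub>DerL\<^esub> euler \<gamma>) (multi n (k - 1))" by blast
  let ?S = "DerL.span (euler ` multi n (k - 1))"
  have sm: "\<zero>\<^bsub>DerL\<^esub> \<in> ?S" "\<And>x y. x \<in> ?S \<Longrightarrow> y \<in> ?S \<Longrightarrow> x \<oplus>\<^bsub>DerL\<^esub> y \<in> ?S"
    "\<And>r x. r \<in> S_L \<Longrightarrow> x \<in> ?S \<Longrightarrow> r \<odot>\<^bsub>DerL\<^esub> x \<in> ?S"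
    using DerL.span_is_submodule[OF es] unfolding LinearCombinations.submodule_def by blast+
  have "finsum DerL (\<lambda>\<gamma>. c \<gamma> \<odot>\<^bsub>DerL\<^esub> euler \<gamma>) F \<in> ?S" if "finite F" "F \<subseteq> multi n (k - 1)" for F
    using that
  proof (induction F rule: finite_induct)
    case (insert \<gamma> F)
    have "finsum DerL (\<lambda>\<gamma>. c \<gamma> \<odot>\<^bsub>DerL\<^esub> euler \<gamma>) (insert \<gamma> F) =
        (c \<gamma> \<odot>\<^bsub>DerL\<^esub> euler \<gamma>) \<oplus>\<^bsub>DerL\<^esub> finsum DerL (\<lambda>\<gamma>. c \<gamma> \<odot>\<^bsub>DerL\<^esub> euler \<gamma>) F"
      using insert c euler_carrier by (intro DerL.M.finsum_insert) auto
    moreover have "euler \<gamma> \<in> ?S" using DerL.in_own_span[OF es] insert by blast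
    ultimately show ?case using sm insert c by simp
  qed (use sm(1) in simp)
  then show "s \<in> euler_submodule n k \<alpha>" unfolding c(2) euler_submodule_def by simp
qed

section \<open>The quotient\<close>

interpretation D0: quotient_module "PH n \<alpha>" "DL n k Z \<alpha>" ker_eta
proof
  show "ker_eta \<subseteq> carrier (DL n k Z \<alpha>)" by blast
  show "\<zero>\<^bsub>DL n k Z \<alpha>\<^esub> \<in> ker_eta" using eta_zero DL.M.zero_closed by (simp add: DL_ops)
  show "x \<oplus>\<^bsub>DL n k Z \<alpha>\<^esub> y \<in> ker_eta" if "x \<in> ker_eta" "y \<in> ker_eta" for x y
    using that DL.M.a_closed[of x y] IZ_closed(1) by (simp add: DL_ops carrier_DL eta_add)
  show "r \<odot>\<^bsub>DL n k Z \<alpha>\<^esub> x \<in> ker_eta" if "r \<in> P_H" "x \<in> ker_eta" for r x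
    using that DL.smult_closed[of r x] eta_DL_smult[of r x] carrier_DL IZ_closed(1) by simp
qed

abbreviation "D0L_mod \<equiv> D0L n k Z \<alpha>"
abbreviation "coset s \<equiv> ker_eta +>\<^bsub>DL n k Z \<alpha>\<^esub> s"

lemma D0L_quot: "D0L_mod = quot_module (DL n k Z \<alpha>) ker_eta"
  by (simp only: D0L_def euler_submodule_eq)

lemma D0L_comp: "D0L_comp n k Z \<alpha> d = coset ` DL_comp n k Z \<alpha> d"
  by (simp only: D0L_comp_def euler_submodule_eq quot_grading_def)

interpretation D0L: module "PH n \<alpha>" D0L_mod
  unfolding D0L_quot by (rule D0.module_quot)

definition eta_bar :: "(mindex \<Rightarrow> nat cpoly set) set \<Rightarrow> nat cpoly" where
  "eta_bar C = the_elem (\<eta> ` C)"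

lemma eta_bar_coset:
  assumes "s \<in> carrier (DL n k Z \<alpha>)"
  shows "eta_bar (coset s) = \<eta> s"
proof -
  have "\<eta> t = \<eta> s" if t: "t \<in> coset s" for t
  proof -
    obtain m where m: "m \<in> ker_eta" "t = m \<oplus>\<^bsub>DerL\<^esub> s" using t unfolding a_r_coset_def' DL_ops by blast
    have "\<eta> t = \<eta> m + \<eta> s" unfolding m(2) using m(1) assms by (intro eta_add) (simp_all add: carrier_DL)
    moreover have "\<eta> m = 0" using m(1) by blast
    ultimately show ?thesis by (metis add_0)
  qed
  moreover have "s \<in> coset s" using D0.N.a_rcos_self[OF assms] .
  ultimately have "\<eta> ` coset s = {\<eta> s}" by blast
  then show ?thesis unfolding eta_bar_def by (simp only: the_elem_eq)
qed

lemma carrier_D0L: "carrier D0L_mod = coset ` carrier (DL n k Z \<alpha>)"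
  unfolding D0L_quot by (rule D0.carrier_quot)

lemma D0L_zero: "\<zero>\<^bsub>D0L_mod\<^esub> = coset \<zero>\<^bsub>DL n k Z \<alpha>\<^esub>"
  unfolding D0L_quot D0.zero_coset D0.quot_simps ..

lemma D0L_add: "s \<in> carrier (DL n k Z \<alpha>) \<Longrightarrow> t \<in> carrier (DL n k Z \<alpha>) \<Longrightarrow>
    coset s \<oplus>\<^bsub>D0L_mod\<^esub> coset t = coset (s \<oplus>\<^bsub>DL n k Z \<alpha>\<^esub> t)"
  unfolding D0L_quot by (rule D0.add_coset)

lemma D0L_smult: "r \<in> P_H \<Longrightarrow> s \<in> carrier (DL n k Z \<alpha>) \<Longrightarrow>
    r \<odot>\<^bsub>D0L_mod\<^esub> coset s = coset (r \<odot>\<^bsub>DL n k Z \<alpha>\<^esub> s)"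
  unfolding D0L_quot by (rule D0.smult_coset)

lemma eta_bar_add:
  assumes "C \<in> carrier D0L_mod" "E \<in> carrier D0L_mod"
  shows "eta_bar (C \<oplus>\<^bsub>D0L_mod\<^esub> E) = eta_bar C + eta_bar E"
proof -
  obtain s t where st: "s \<in> carrier (DL n k Z \<alpha>)" "C = coset s" "t \<in> carrier (DL n k Z \<alpha>)" "E = coset t"
    using assms(1,2) unfolding carrier_D0L by blast
  have "\<eta> (s \<oplus>\<^bsub>DL n k Z \<alpha>\<^esub> t) = \<eta> s + \<eta> t"
    using st(1,3) unfolding DL_ops by (intro eta_add) (simp_all add: carrier_DL)
  then show ?thesis
    unfolding st(2,4) D0L_add[OF st(1,3)] eta_bar_coset[OF st(1)] eta_bar_coset[OF st(3)]
      eta_bar_coset[OF DL.M.a_closed[OF st(1,3)]] .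
qed

lemma eta_bar_zero: "eta_bar \<zero>\<^bsub>D0L_mod\<^esub> = 0"
  unfolding D0L_zero eta_bar_coset[OF DL.M.zero_closed] by (simp only: DL_ops eta_zero)

lemma eta_bar_inj:
  assumes "C \<in> carrier D0L_mod" "E \<in> carrier D0L_mod" "eta_bar C = eta_bar E"
  shows "C = E"
proof -
  obtain s t where st: "s \<in> carrier (DL n k Z \<alpha>)" "C = coset s" "t \<in> carrier (DL n k Z \<alpha>)" "E = coset t"
    using assms(1,2) unfolding carrier_D0L by blast
  have e: "\<eta> s = \<eta> t" using assms(3) unfolding st(2,4) eta_bar_coset[OF st(1)] eta_bar_coset[OF st(3)] .
  define w where "w = s \<ominus>\<^bsub>DL n k Z \<alpha>\<^esub> t"
  have m: "w \<in> carrier (DL n k Z \<alpha>)" unfolding w_def by (rule DL.M.minus_closed[OF st(1,3)])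
  have "w \<oplus>\<^bsub>DL n k Z \<alpha>\<^esub> t = s"
    unfolding w_def a_minus_def using DL.M.a_assoc[OF st(1) DL.M.a_inv_closed[OF st(3)] st(3)]
      DL.M.l_neg[OF st(3)] DL.M.r_zero[OF st(1)] by argo
  moreover have "\<eta> (w \<oplus>\<^bsub>DL n k Z \<alpha>\<^esub> t) = \<eta> w + \<eta> t"
    using m st(3) unfolding DL_ops by (intro eta_add) (simp_all add: carrier_DL)
  ultimately have "\<eta> w = 0" using e by (metis add_cancel_left_left)
  then have "w \<in> ker_eta" using m by blast
  then show ?thesis unfolding st(2,4) w_def using D0.coset_eq_iff[OF st(1,3)] by blast
qed

lemma eta_bar_comp: "eta_bar ` D0L_comp n k Z \<alpha> d = IZH_comp n k Z \<alpha> (d + k)"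
  unfolding D0L_comp IZH_comp_eq image_image by (intro image_cong refl eta_bar_coset DL_comp_in_DL)

lemma eta_bar_carrier: "eta_bar ` carrier D0L_mod = carrier (IZH n k Z \<alpha>)"
  unfolding carrier_D0L carrier_IZH image_image by (intro image_cong refl eta_bar_coset)

lemma D0L_comp_sub: "D0L_comp n k Z \<alpha> d \<subseteq> carrier D0L_mod"
  unfolding D0L_comp carrier_D0L using DL_comp_in_DL by blast

lemma graded_D0L: "graded_module (PH n \<alpha>) (PH_comp n \<alpha>) D0L_mod (D0L_comp n k Z \<alpha>)"
proof (rule graded_moduleI, rule D0L.module_axioms, rule minus_one_PH)
  show "\<zero>\<^bsub>D0L_mod\<^esub> \<in> D0L_comp n k Z \<alpha> d" for d
    unfolding D0L_zero D0L_comp DL_ops by (rule imageI[OF DL_comp_zero])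
  show "x \<oplus>\<^bsub>D0L_mod\<^esub> y \<in> D0L_comp n k Z \<alpha> d" if xy: "x \<in> D0L_comp n k Z \<alpha> d" "y \<in> D0L_comp n k Z \<alpha> d" for d x y
  proof -
    obtain s t where st: "s \<in> DL_comp n k Z \<alpha> d" "x = coset s" "t \<in> DL_comp n k Z \<alpha> d" "y = coset t"
      using xy unfolding D0L_comp by blast
    have "x \<oplus>\<^bsub>D0L_mod\<^esub> y = coset (s \<oplus>\<^bsub>DL n k Z \<alpha>\<^esub> t)"
      unfolding st(2,4) by (rule D0L_add[OF DL_comp_in_DL[OF st(1)] DL_comp_in_DL[OF st(3)]])
    then have "x \<oplus>\<^bsub>D0L_mod\<^esub> y = coset (s \<oplus>\<^bsub>DerL\<^esub> t)" unfolding DL_ops .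
    then show ?thesis unfolding D0L_comp using DL_comp_add st by blast
  qed
  show "r \<odot>\<^bsub>D0L_mod\<^esub> x \<in> D0L_comp n k Z \<alpha> (i + j)" if rx: "r \<in> PH_comp n \<alpha> i" "x \<in> D0L_comp n k Z \<alpha> j" for i j r x
  proof -
    obtain s where s: "s \<in> DL_comp n k Z \<alpha> j" "x = coset s" using rx unfolding D0L_comp by blast
    have "r \<odot>\<^bsub>D0L_mod\<^esub> x = coset (r \<odot>\<^bsub>DL n k Z \<alpha>\<^esub> s)"
      unfolding s(2) by (rule D0L_smult[OF PH_comp_PH[OF rx(1)] DL_comp_in_DL[OF s(1)]])
    then show ?thesis unfolding D0L_comp using DL_comp_smult rx(1) s by blast
  qed
  show "\<exists>u b. (\<forall>d\<le>b. u d \<in> D0L_comp n k Z \<alpha> d) \<and> x = finsum D0L_mod u {..b}" if x: "x \<in> carrier D0L_mod" for x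
  proof -
    obtain s where s: "s \<in> carrier (DL n k Z \<alpha>)" "x = coset s" using x unfolding carrier_D0L by blast
    then have s': "s \<in> carrier DerL" "\<eta> s \<in> IZ" by (auto simp: carrier_DL)
    obtain b where b: "s = finsum DerL (\<lambda>d. comp_part d s) {..b}" using sum_comp_part[OF s'(1)] by blast
    have c: "comp_part d s \<in> DL_comp n k Z \<alpha> d" for d using comp_part_DL[OF s'] .
    have "finsum (DL n k Z \<alpha>) (\<lambda>d. comp_part d s) {..b} = s"
      by (rule trans[OF finsum_DL[OF DL_comp_in_DL[OF c] module_DL finite_atMost] b[symmetric]])
    moreover have "finsum D0L_mod (\<lambda>d. coset (comp_part d s)) {..b} =
        coset (finsum (DL n k Z \<alpha>) (\<lambda>d. comp_part d s) {..b})"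
      unfolding D0L_quot by (rule D0.finsum_coset[OF finite_atMost DL_comp_in_DL[OF c]])
    ultimately have "x = finsum D0L_mod (\<lambda>d. coset (comp_part d s)) {..b}" unfolding s(2) by (simp only:)
    then show ?thesis using c D0L_comp by (intro exI[of _ "\<lambda>d. coset (comp_part d s)"] exI[of _ b]) blast
  qed
  fix F u and i :: nat
  assume F: "finite F" "\<And>i. i \<in> F \<Longrightarrow> u i \<in> D0L_comp n k Z \<alpha> i" and z: "finsum D0L_mod u F = \<zero>\<^bsub>D0L_mod\<^esub>" and i: "i \<in> F"
  have uc: "u i \<in> carrier D0L_mod" if "i \<in> F" for i using F(2)[OF that] D0L_comp_sub by blast
  have "eta_bar (u i) = 0"
  proof (rule homog_sum_eq_0[OF F(1), of "\<lambda>i. i + k" "\<lambda>i. eta_bar (u i)"])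
    show "(\<Sum>i\<in>F. eta_bar (u i)) = 0"
      using D0L.M.additive_finsum[of F u eta_bar, OF F(1) uc eta_bar_zero eta_bar_add] z eta_bar_zero by simp
    show "homog (j + k) (eta_bar (u j))" if "j \<in> F" for j
      using F(2)[OF that] eta_bar_comp homog_IZH_comp by blast
  qed (use i in auto)
  then show "u i = \<zero>\<^bsub>D0L_mod\<^esub>" using uc[OF i] eta_bar_zero by (intro eta_bar_inj) auto
qed (rule D0L_comp_sub)

lemma graded_iso:
  "graded_isomorphic (PH n \<alpha>) (PH_comp n \<alpha>) D0L_mod (D0L_comp n k Z \<alpha>)
     (IZH n k Z \<alpha>) (\<lambda>d. IZH_comp n k Z \<alpha> (d + k))"
  unfolding graded_isomorphic_def graded_hom_def
proof (intro exI[of _ eta_bar] conjI allI graded_D0L)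
  show "graded_module (PH n \<alpha>) (PH_comp n \<alpha>) (IZH n k Z \<alpha>) (\<lambda>d. IZH_comp n k Z \<alpha> (d + k))"
    using graded_IZH by blast
  have "eta_bar (r \<odot>\<^bsub>D0L_mod\<^esub> C) = r * eta_bar C" if rC: "r \<in> P_H" "C \<in> carrier D0L_mod" for r C
  proof -
    obtain s where s: "s \<in> carrier (DL n k Z \<alpha>)" "C = coset s" using rC(2) unfolding carrier_D0L by blast
    have "s \<in> carrier DerL" using s(1) by (simp add: carrier_DL)
    then show ?thesis
      unfolding s(2) D0L_smult[OF rC(1) s(1)] eta_bar_coset[OF s(1)]
        eta_bar_coset[OF DL.smult_closed[OF rC(1) s(1)]] by (rule eta_DL_smult[OF rC(1)])
  qed
  then show "eta_bar \<in> module_hom (PH n \<alpha>) D0L_mod (IZH n k Z \<alpha>)"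
    unfolding module_hom_def using eta_bar_carrier by (auto simp: IZH_ops eta_bar_add)
  show "bij_betw eta_bar (carrier D0L_mod) (carrier (IZH n k Z \<alpha>))"
    unfolding bij_betw_def using eta_bar_carrier eta_bar_inj by (auto intro: inj_onI)
  show "eta_bar ` D0L_comp n k Z \<alpha> d = IZH_comp n k Z \<alpha> (d + k)" for d by (rule eta_bar_comp)
  then show "eta_bar ` D0L_comp n k Z \<alpha> d \<subseteq> IZH_comp n k Z \<alpha> (d + 0 + k)" for d by simp
qed

end

theorem theorem4p13:
  fixes n k :: nat and Z :: "complex vec set"
  assumes "n \<ge> 2" and "k \<ge> 1" and "distinct_points n Z"
  shows "for_general_tuple n (n - 1) (\<lambda>\<alpha>. lin_indep_list n \<alpha> \<longrightarrow>
    graded_hom (PH n \<alpha>) (PH_comp n \<alpha>) (DL n k Z \<alpha>) (DL_comp n k Z \<alpha>)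
      (IZH n k Z \<alpha>) (IZH_comp n k Z \<alpha>) k (eta n k \<alpha>) \<and>
    internal_direct_sum (Der_L n k \<alpha>) (multi n (k - 1))
      (\<lambda>\<gamma>. {c \<odot>\<^bsub>Der_L n k \<alpha>\<^esub> euler_L n k \<alpha> \<gamma> | c. c \<in> carrier (SL n \<alpha>)})
      {s \<in> carrier (DL n k Z \<alpha>). eta n k \<alpha> s = 0} \<and>
    graded_isomorphic (PH n \<alpha>) (PH_comp n \<alpha>) (D0L n k Z \<alpha>) (D0L_comp n k Z \<alpha>)
      (IZH n k Z \<alpha>) (\<lambda>d. IZH_comp n k Z \<alpha> (d + k)))"
proof (rule for_general_line[OF assms])
  fix \<alpha> a b D assume "general_line n \<alpha> a b D k Z"
  then interpret general_line n \<alpha> a b D k Z .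
  show "lin_indep_list n \<alpha> \<longrightarrow>
    graded_hom (PH n \<alpha>) (PH_comp n \<alpha>) (DL n k Z \<alpha>) (DL_comp n k Z \<alpha>)
      (IZH n k Z \<alpha>) (IZH_comp n k Z \<alpha>) k (eta n k \<alpha>) \<and>
    internal_direct_sum (Der_L n k \<alpha>) (multi n (k - 1))
      (\<lambda>\<gamma>. {c \<odot>\<^bsub>Der_L n k \<alpha>\<^esub> euler_L n k \<alpha> \<gamma> | c. c \<in> carrier (SL n \<alpha>)})
      {s \<in> carrier (DL n k Z \<alpha>). eta n k \<alpha> s = 0} \<and>
    graded_isomorphic (PH n \<alpha>) (PH_comp n \<alpha>) (D0L n k Z \<alpha>) (D0L_comp n k Z \<alpha>)
      (IZH n k Z \<alpha>) (\<lambda>d. IZH_comp n k Z \<alpha> (d + k))"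
    using graded_hom_eta kernel_direct_sum graded_iso by blast
qed

end
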